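(* Let $(\Omega,m)$ be a PDE friendly domain, and let $\omega_0=\{\omega_0^X\}_{X\in\Omega}$ and $\omega_1=\{\omega_1^X\}_{X\in\Omega}$ be two elliptic measures on $\partial\Omega$. Then $\omega_1\in A_\infty(\omega_0)$ if and only if, for each $f\in L^2_{loc}(\Omega,m)$, $$f\in KCM(\omega_1)\quad\text{implies that}\quad f\in KCM(\omega_0).$$
   Context: **Notation.** $n\ge2$, $\Omega\subset\mathbb R^n$ open, $\delta(X)=\operatorname{dist}(X,\partial\Omega)$, $B_X=B(X,\delta(X)/4)$; for $x\in\partial\Omega$, $r>0$, $\Delta(x,r)=B(x,r)\cap\partial\Omega$ is a boundary ball. $u_B=m(B)^{-1}\iint_B u\,dm$ for balls $B\subset\Omega$. **The measure $m$.** (i) $dm=w\,dX$ with $0\le w\in L^1_{loc}(\Omega)$; (ii) $m(B(X,2r)\cap\Omega)\le C_m m(B(X,r)\cap\Omega)$ for all $X\in\overline\Omega$, $r>0$; (iii) for every open $D$ compactly contained in $\Omega$ and $\{u_i\}\subset C^\infty(\overline D)$ with $\iint_D|u_i|\,dm\to0$ and $\iint_D|\nabla u_i-v|^2dm\to0$, $v\in L^2(D,m)$ vector-valued, one has $v\equiv0$; (iv) for every ball $B$ of radius $r$ with $2B\subset\Omega$ and $u\in W^{1,2}(B,m)$, $(m(B)^{-1}\iint_B|u-u_B|^2dm)^{1/2}\le C_P r(m(B)^{-1}\iint_B|\nabla u|^2dm)^{1/2}$. By (iii) a gradient is well defined by $L^2$-approximation with smooth functions, and $W^{1,2}_{loc}(\Omega,m)$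 is the space of $u\in L^2_{loc}(\Omega,m)$ with gradient in $L^2_{loc}(\Omega,m)$. **1-sided NTA.** Corkscrew condition: there is $c_1\in(0,1)$ such that for $x\in\partial\Omega$, $r\in(0,\operatorname{diam}\Omega)$ there is $X$ with $B(X,c_1r)\subset B(x,r)\cap\Omega$. A point $X$ is a Corkscrew point associated to $(x,r)$ if $c_1r/100\le\delta(X)\le|X-x|\le100r$. Harnack chain condition: for every $\Lambda\ge1$ there is $N_\Lambda$ such that if $\delta(X)>r$, $\delta(Y)>r$, $|X-Y|\le\Lambda r$, there are balls $B_1,\dots,B_{N_\Lambda}$ with $X\in B_1$, $Y\in B_{N_\Lambda}$, $2B_i\subset\Omega$, $B_i\cap B_{i+1}\ne\emptyset$. **Operators.** $L=-\operatorname{div}(w\mathcal A\nabla)$, $\mathcal A$ real measurable (not necessarily symmetric), with $\mathcal A\xi\cdot\xi\ge C_L^{-1}|\xi|^2$, $|\mathcal A\xi\cdot\zeta|\le C_L|\xi||\zeta|$ a.e. in $\Omega$. A weak solution of $Lu=0$ is $u\in W^{1,2}_{loc}(\Omega,m)$ with $\iint\mathcal A\nabla u\cdot\nabla\varphi\,dm=0$ for all $\varphi\in C_c^\infty(\Omega)$ (similarly on open subsets). **PDE friendly.** $(\Omega,m)$ is PDE friendly if $\Omega$ is 1-sided NTA, $m$ is a measure on $\Omega$ with $dm=w\,dX$, $0\le w\in L^1_{loc}(\Omega)$, which is doubling ($m(B(X,2r)\cap\Omega)\le C_m m(B(X,r)\cap\Omega)$ for all $X\in\overline\Omega$, $r>0$),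 has the closability property that $v\equiv0$ whenever $D$ is open and compactly contained in $\Omega$, $\{u_i\}\subset C^\infty(\overline D)$, $v\in L^2(D,m)$ is vector-valued, $\iint_D|u_i|\,dm\to0$ and $\iint_D|\nabla u_i-v|^2dm\to0$, and satisfies the Poincaré inequality $(m(B)^{-1}\iint_B|u-u_B|^2dm)^{1/2}\le C_P r(m(B)^{-1}\iint_B|\nabla u|^2dm)^{1/2}$ for every ball $B$ of radius $r$ with $2B\subset\Omega$ and every $u\in W^{1,2}(B,m)$, and for every such $L$ (all constants depending on $L$ only via $C_L$): - there is a unique family of probability measures $\omega_L=\{\omega_L^X\}_{X\in\Omega}$ on $\partial\Omega$ (the elliptic measure of $L$) such that for $f\in C_c^\infty(\mathbb R^n)$, $u_f(X)=\int f\,d\omega_L^X$ is continuous on $\overline\Omega$, equals $f$ on $\partial\Omega$, and is a weak solution of $Lu=0$; - $\omega_L^X(\Delta(x,2r))\le C\omega_L^X(\Delta(x,r))$ for $X\in\Omega\setminus B(x,3r)$; - if $X$ is a Corkscrew point associated to $(x,r)$ and $E\subset\Delta(x,r)$ is Borel, $C^{-1}\omega_L^X(E)\le\omega_L^Y(E)/\omega_L^Y(\Delta(x,r))\le C\omega_L^X(E)$ for $Y\in\Omega\setminus B(x,2r)$; - $\omega_L^X(E)\le C(\delta(X)/\operatorname{dist}(X,E))^\gamma$ for $X\in\Omega$, $E\subset\partial\Omega$ Borel, some $\gamma\in(0,1)$; - for $X\in\Omega$, $r=\delta(X)/2$, $x\in\partial\Omega$ with $|X-x|=2r$, there is a weak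 solution $G_X^*$ of $L^*u=-\operatorname{div}(w\mathcal A^T\nabla u)=0$ in $B(x,r)\cap\Omega$ such that for $y\in\Delta(x,r)$, $s\in(0,r)$ and $Y\in B(x,r)\cap\Omega$ a Corkscrew point associated to $(y,s)$, $C^{-1}\frac{m(B(y,s)\cap\Omega)}{s^2}G_X^*(Y)\le\omega_L^X(\Delta(y,s))\le C\frac{m(B(y,s)\cap\Omega)}{s^2}G_X^*(Y)$. An elliptic measure on $\partial\Omega$ means $\omega_L$ for some such $L$. **Carleson condition.** $\gamma^r(x)=\{X\in\Omega:|X-x|\le2\delta(X)\le2r\}$, $\mathsf A^r(f)(x)=\big(\iint_{\gamma^r(x)}|f|^2\frac{dm(X)}{m(B_X)}\big)^{1/2}$. For a family $\omega=\{\omega^X\}$, $f\in KCM(\omega)$ if there is $M>0$ with $\int_{\Delta(x,r)}|\mathsf A^r(f)|^2d\omega^X\le M\omega^X(\Delta(x,r))$ for all $x\in\partial\Omega$, $r>0$, $X\in\Omega\setminus B(x,2r)$ (no condition if that set is empty). **$A_\infty$.** $\omega_1\in A_\infty(\omega_0)$ if for every $\xi>0$ there is $\zeta>0$ such that for every boundary ball $\Delta=\Delta(x,r)$, every $X\in\Omega\setminus B(x,2r)$ and every Borel $E\subset\Delta$: $\omega_1^X(E)/\omega_1^X(\Delta)<\zeta$ implies $\omega_0^X(E)/\omega_0^X(\Delta)<\xi$. *)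

theory Defs
  imports "HOL-Probability.Probability"
begin

section \<open>Smooth functions\<close>

text \<open>Only used with an open set \<open>S\<close>.\<close>

primrec C_k_on :: "nat \<Rightarrow> ((real ^ 'n) \<Rightarrow> real) \<Rightarrow> (real ^ 'n) set \<Rightarrow> bool" where
  "C_k_on 0 f S = continuous_on S f"
| "C_k_on (Suc k) f S =
     ((\<forall>x\<in>S. f differentiable (at x)) \<and>
      (\<forall>i. C_k_on k (\<lambda>x. frechet_derivative f (at x) (axis i 1)) S))"

definition C_infinity_on :: "((real ^ 'n) \<Rightarrow> real) \<Rightarrow> (real ^ 'n) set \<Rightarrow> bool" where
  "C_infinity_on f S \<longleftrightarrow> (\<forall>k. C_k_on k f S)"

definition smooth_grad :: "((real ^ 'n) \<Rightarrow> real) \<Rightarrow> real ^ 'n \<Rightarrow> real ^ 'n" where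
  "smooth_grad f x = (\<chi> i. frechet_derivative f (at x) (axis i 1))"

text \<open>\<open>C\<^sup>\<infinity>\<close> of the closure of \<open>D\<close>: functions smooth in a neighbourhood of the closure.\<close>

definition C_infinity_closure :: "((real ^ 'n) \<Rightarrow> real) \<Rightarrow> (real ^ 'n) set \<Rightarrow> bool" where
  "C_infinity_closure f D \<longleftrightarrow> (\<exists>V. open V \<and> closure D \<subseteq> V \<and> C_infinity_on f V)"

definition test_function :: "((real ^ 'n) \<Rightarrow> real) \<Rightarrow> (real ^ 'n) set \<Rightarrow> bool" where
  "test_function \<phi> U \<longleftrightarrow> C_infinity_on \<phi> UNIV \<and>
     compact (closure {x. \<phi> x \<noteq> 0}) \<and> closure {x. \<phi> x \<noteq> 0} \<subseteq> U"

definition compactly_contained :: "(real ^ 'n) set \<Rightarrow> (real ^ 'n) set \<Rightarrow> bool" where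
  "compactly_contained D U \<longleftrightarrow> compact (closure D) \<and> closure D \<subseteq> U"


section \<open>Geometry of the domain\<close>

definition bdist :: "(real ^ 'n) set \<Rightarrow> real ^ 'n \<Rightarrow> real" where
  "bdist \<Omega> X = infdist X (frontier \<Omega>)"

definition bball :: "(real ^ 'n) set \<Rightarrow> real ^ 'n \<Rightarrow> real \<Rightarrow> (real ^ 'n) set" where
  "bball \<Omega> x r = ball x r \<inter> frontier \<Omega>"

text \<open>The premise on \<open>diameter\<close> is guarded because that function is unspecified on unbounded sets,
  where the diameter is infinite.\<close>

definition corkscrew_condition :: "real \<Rightarrow> (real ^ 'n) set \<Rightarrow> bool" where
  "corkscrew_condition c \<Omega> \<longleftrightarrow>
     (\<forall>x\<in>frontier \<Omega>. \<forall>r>0. (bounded \<Omega> \<longrightarrow> r < diameter \<Omega>) \<longrightarrow>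
        (\<exists>X. ball X (c * r) \<subseteq> ball x r \<inter> \<Omega>))"

definition corkscrew_point :: "real \<Rightarrow> (real ^ 'n) set \<Rightarrow> real ^ 'n \<Rightarrow> real \<Rightarrow> real ^ 'n \<Rightarrow> bool" where
  "corkscrew_point c \<Omega> x r X \<longleftrightarrow>
     X \<in> \<Omega> \<and> c * r / 100 \<le> bdist \<Omega> X \<and> bdist \<Omega> X \<le> dist X x \<and> dist X x \<le> 100 * r"

definition harnack_chain_condition :: "(real ^ 'n) set \<Rightarrow> bool" where
  "harnack_chain_condition \<Omega> \<longleftrightarrow>
     (\<forall>\<Lambda>\<ge>1. \<exists>N\<ge>1. \<forall>X\<in>\<Omega>. \<forall>Y\<in>\<Omega>. \<forall>r>0.
        bdist \<Omega> X > r \<longrightarrow> bdist \<Omega> Y > r \<longrightarrow> dist X Y \<le> \<Lambda> * r \<longrightarrow>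
        (\<exists>(Z :: nat \<Rightarrow> real ^ 'n) (\<rho> :: nat \<Rightarrow> real).
           (\<forall>i\<in>{1..N}. \<rho> i > 0 \<and> ball (Z i) (2 * \<rho> i) \<subseteq> \<Omega>) \<and>
           X \<in> ball (Z 1) (\<rho> 1) \<and> Y \<in> ball (Z N) (\<rho> N) \<and>
           (\<forall>i\<in>{1..<N}. ball (Z i) (\<rho> i) \<inter> ball (Z (Suc i)) (\<rho> (Suc i)) \<noteq> {})))"


section \<open>The measure and its Sobolev spaces\<close>

text \<open>\<open>dm = w dX\<close> on \<open>\<Omega>\<close>; the space of \<open>m\<close> is \<open>\<Omega>\<close> and its measurable sets are the
  Lebesgue measurable subsets of \<open>\<Omega>\<close>.\<close>

definition weighted_measure_on :: "(real ^ 'n) set \<Rightarrow> (real ^ 'n) measure \<Rightarrow> bool" where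
  "weighted_measure_on \<Omega> m \<longleftrightarrow>
     (\<exists>w :: real ^ 'n \<Rightarrow> real.
        w \<in> borel_measurable (lebesgue_on \<Omega>) \<and> (\<forall>X\<in>\<Omega>. 0 \<le> w X) \<and>
        (\<forall>K. compact K \<and> K \<subseteq> \<Omega> \<longrightarrow> set_integrable lebesgue K w) \<and>
        m = density (lebesgue_on \<Omega>) (\<lambda>X. ennreal (w X)))"

definition doubling_on :: "(real ^ 'n) set \<Rightarrow> (real ^ 'n) measure \<Rightarrow> bool" where
  "doubling_on \<Omega> m \<longleftrightarrow>
     (\<exists>C>0. \<forall>X\<in>closure \<Omega>. \<forall>r>0.
        emeasure m (ball X (2 * r) \<inter> \<Omega>) \<le> ennreal C * emeasure m (ball X r \<inter> \<Omega>))"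

definition L2_on :: "(real ^ 'n) measure \<Rightarrow> (real ^ 'n) set
    \<Rightarrow> (real ^ 'n \<Rightarrow> 'b :: {real_normed_vector, second_countable_topology}) \<Rightarrow> bool" where
  "L2_on m D u \<longleftrightarrow> u \<in> borel_measurable (restrict_space m D) \<and>
     (\<integral>\<^sup>+X\<in>D. ennreal ((norm (u X))\<^sup>2) \<partial>m) < \<infinity>"

definition L2_loc :: "(real ^ 'n) measure \<Rightarrow> (real ^ 'n) set
    \<Rightarrow> (real ^ 'n \<Rightarrow> 'b :: {real_normed_vector, second_countable_topology}) \<Rightarrow> bool" where
  "L2_loc m U u \<longleftrightarrow> u \<in> borel_measurable (restrict_space m U) \<and>
     (\<forall>K. compact K \<and> K \<subseteq> U \<longrightarrow> (\<integral>\<^sup>+X\<in>K. ennreal ((norm (u X))\<^sup>2) \<partial>m) < \<infinity>)"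

definition gradient_closable :: "(real ^ 'n) set \<Rightarrow> (real ^ 'n) measure \<Rightarrow> bool" where
  "gradient_closable \<Omega> m \<longleftrightarrow>
     (\<forall>D (u :: nat \<Rightarrow> real ^ 'n \<Rightarrow> real) (v :: real ^ 'n \<Rightarrow> real ^ 'n).
        open D \<longrightarrow> compactly_contained D \<Omega> \<longrightarrow> (\<forall>i. C_infinity_closure (u i) D) \<longrightarrow> L2_on m D v \<longrightarrow>
        (\<lambda>i. \<integral>\<^sup>+X\<in>D. ennreal \<bar>u i X\<bar> \<partial>m) \<longlonglongrightarrow> 0 \<longrightarrow>
        (\<lambda>i. \<integral>\<^sup>+X\<in>D. ennreal ((norm (smooth_grad (u i) X - v X))\<^sup>2) \<partial>m) \<longlonglongrightarrow> 0 \<longrightarrow>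
        (AE X in m. X \<in> D \<longrightarrow> v X = 0))"

text \<open>\<open>v\<close> is the gradient of \<open>u\<close> in the open set \<open>U\<close>: locally in \<open>U\<close>, the pair \<open>(u, v)\<close> is the
  \<open>L\<^sup>2\<close> limit of smooth functions and their gradients.  This need not be the distributional
  gradient, since the weight may be degenerate.\<close>

definition has_m_gradient :: "(real ^ 'n) measure \<Rightarrow> (real ^ 'n) set
    \<Rightarrow> (real ^ 'n \<Rightarrow> real) \<Rightarrow> (real ^ 'n \<Rightarrow> real ^ 'n) \<Rightarrow> bool" where
  "has_m_gradient m U u v \<longleftrightarrow>
     (\<forall>D. open D \<and> compactly_contained D U \<longrightarrow>
        (\<exists>\<phi> :: nat \<Rightarrow> real ^ 'n \<Rightarrow> real.
           (\<forall>i. C_infinity_closure (\<phi> i) D) \<and>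
           (\<lambda>i. \<integral>\<^sup>+X\<in>D. ennreal (\<bar>\<phi> i X - u X\<bar>\<^sup>2) \<partial>m) \<longlonglongrightarrow> 0 \<and>
           (\<lambda>i. \<integral>\<^sup>+X\<in>D. ennreal ((norm (smooth_grad (\<phi> i) X - v X))\<^sup>2) \<partial>m) \<longlonglongrightarrow> 0))"

text \<open>\<open>u\<close> belongs to \<open>W\<^sup>1\<^sup>,\<^sup>2(U, m)\<close>, respectively to its local version, with gradient \<open>v\<close>.\<close>

definition W12 :: "(real ^ 'n) measure \<Rightarrow> (real ^ 'n) set
    \<Rightarrow> (real ^ 'n \<Rightarrow> real) \<Rightarrow> (real ^ 'n \<Rightarrow> real ^ 'n) \<Rightarrow> bool" where
  "W12 m U u v \<longleftrightarrow> L2_on m U u \<and> L2_on m U v \<and> has_m_gradient m U u v"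

definition W12_loc :: "(real ^ 'n) measure \<Rightarrow> (real ^ 'n) set
    \<Rightarrow> (real ^ 'n \<Rightarrow> real) \<Rightarrow> (real ^ 'n \<Rightarrow> real ^ 'n) \<Rightarrow> bool" where
  "W12_loc m U u v \<longleftrightarrow> L2_loc m U u \<and> L2_loc m U v \<and> has_m_gradient m U u v"

definition average :: "(real ^ 'n) measure \<Rightarrow> (real ^ 'n) set \<Rightarrow> (real ^ 'n \<Rightarrow> real) \<Rightarrow> real" where
  "average m B u = (LINT X:B|m. u X) / measure m B"

definition poincare_inequality :: "(real ^ 'n) set \<Rightarrow> (real ^ 'n) measure \<Rightarrow> bool" where
  "poincare_inequality \<Omega> m \<longleftrightarrow>
     (\<exists>C>0. \<forall>Z r u v. r > 0 \<longrightarrow> ball Z (2 * r) \<subseteq> \<Omega> \<longrightarrow> W12 m (ball Z r) u v \<longrightarrow>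
        sqrt (average m (ball Z r) (\<lambda>X. \<bar>u X - average m (ball Z r) u\<bar>\<^sup>2))
          \<le> C * r * sqrt (average m (ball Z r) (\<lambda>X. (norm (v X))\<^sup>2)))"


section \<open>Elliptic operators and elliptic measure\<close>

definition elliptic_matrix :: "(real ^ 'n) set \<Rightarrow> real \<Rightarrow> (real ^ 'n \<Rightarrow> real ^ 'n ^ 'n) \<Rightarrow> bool" where
  "elliptic_matrix \<Omega> C A \<longleftrightarrow>
     A \<in> borel_measurable (lebesgue_on \<Omega>) \<and>
     (AE X in lebesgue_on \<Omega>. \<forall>\<xi> \<zeta>.
        (A X *v \<xi>) \<bullet> \<xi> \<ge> inverse C * (norm \<xi>)\<^sup>2 \<and>
        \<bar>(A X *v \<xi>) \<bullet> \<zeta>\<bar> \<le> C * norm \<xi> * norm \<zeta>)"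

text \<open>Weak solutions in an open set \<open>U \<subseteq> \<Omega>\<close> of \<open>Lu = 0\<close>, \<open>L = - div (w A \<nabla>)\<close>.\<close>

definition weak_solution :: "(real ^ 'n) measure \<Rightarrow> (real ^ 'n \<Rightarrow> real ^ 'n ^ 'n)
    \<Rightarrow> (real ^ 'n) set \<Rightarrow> (real ^ 'n \<Rightarrow> real) \<Rightarrow> bool" where
  "weak_solution m A U u \<longleftrightarrow>
     (\<exists>v. W12_loc m U u v \<and>
        (\<forall>\<phi>. test_function \<phi> U \<longrightarrow> (LINT X:U|m. (A X *v v X) \<bullet> smooth_grad \<phi> X) = 0))"

text \<open>A family of measures is a function of the pole; only its values at poles in \<open>\<Omega>\<close> matter.\<close>

definition elliptic_measure_of :: "(real ^ 'n) set \<Rightarrow> (real ^ 'n) measure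
    \<Rightarrow> (real ^ 'n \<Rightarrow> real ^ 'n ^ 'n) \<Rightarrow> (real ^ 'n \<Rightarrow> (real ^ 'n) measure) \<Rightarrow> bool" where
  "elliptic_measure_of \<Omega> m A \<omega> \<longleftrightarrow>
     (\<forall>X\<in>\<Omega>. prob_space (\<omega> X) \<and> sets (\<omega> X) = sets (restrict_space borel (frontier \<Omega>))) \<and>
     (\<forall>f. test_function f UNIV \<longrightarrow>
        continuous_on (closure \<Omega>) (\<lambda>X. if X \<in> \<Omega> then (LINT y|\<omega> X. f y) else f X) \<and>
        weak_solution m A \<Omega> (\<lambda>X. LINT y|\<omega> X. f y))"

definition is_elliptic_measure :: "(real ^ 'n) set \<Rightarrow> (real ^ 'n) measure
    \<Rightarrow> (real ^ 'n \<Rightarrow> (real ^ 'n) measure) \<Rightarrow> bool" where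
  "is_elliptic_measure \<Omega> m \<omega> \<longleftrightarrow>
     (\<exists>C>0. \<exists>A. elliptic_matrix \<Omega> C A \<and> elliptic_measure_of \<Omega> m A \<omega>)"


section \<open>PDE friendly domains\<close>

definition em_doubling :: "(real ^ 'n) set \<Rightarrow> real \<Rightarrow> (real ^ 'n \<Rightarrow> (real ^ 'n) measure) \<Rightarrow> bool" where
  "em_doubling \<Omega> C \<omega> \<longleftrightarrow>
     (\<forall>x\<in>frontier \<Omega>. \<forall>r>0. \<forall>X\<in>\<Omega> - ball x (3 * r).
        measure (\<omega> X) (bball \<Omega> x (2 * r)) \<le> C * measure (\<omega> X) (bball \<Omega> x r))"

definition em_change_of_pole :: "(real ^ 'n) set \<Rightarrow> real \<Rightarrow> real
    \<Rightarrow> (real ^ 'n \<Rightarrow> (real ^ 'n) measure) \<Rightarrow> bool" where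
  "em_change_of_pole \<Omega> c C \<omega> \<longleftrightarrow>
     (\<forall>x\<in>frontier \<Omega>. \<forall>r>0. \<forall>X E. corkscrew_point c \<Omega> x r X \<longrightarrow>
        E \<in> sets borel \<longrightarrow> E \<subseteq> bball \<Omega> x r \<longrightarrow>
        (\<forall>Y\<in>\<Omega> - ball x (2 * r).
           inverse C * measure (\<omega> X) E \<le> measure (\<omega> Y) E / measure (\<omega> Y) (bball \<Omega> x r) \<and>
           measure (\<omega> Y) E / measure (\<omega> Y) (bball \<Omega> x r) \<le> C * measure (\<omega> X) E))"

text \<open>For empty \<open>E\<close> both sides vanish, as \<open>infdist X {} = 0\<close>.\<close>

definition em_decay :: "(real ^ 'n) set \<Rightarrow> real \<Rightarrow> real
    \<Rightarrow> (real ^ 'n \<Rightarrow> (real ^ 'n) measure) \<Rightarrow> bool" where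
  "em_decay \<Omega> C \<gamma> \<omega> \<longleftrightarrow>
     (\<forall>X\<in>\<Omega>. \<forall>E. E \<in> sets borel \<longrightarrow> E \<subseteq> frontier \<Omega> \<longrightarrow>
        measure (\<omega> X) E \<le> C * (bdist \<Omega> X / infdist X E) powr \<gamma>)"

definition em_green :: "(real ^ 'n) set \<Rightarrow> (real ^ 'n) measure \<Rightarrow> (real ^ 'n \<Rightarrow> real ^ 'n ^ 'n)
    \<Rightarrow> real \<Rightarrow> real \<Rightarrow> (real ^ 'n \<Rightarrow> (real ^ 'n) measure) \<Rightarrow> bool" where
  "em_green \<Omega> m A c C \<omega> \<longleftrightarrow>
     (\<forall>X\<in>\<Omega>. \<forall>x\<in>frontier \<Omega>. \<forall>r. r = bdist \<Omega> X / 2 \<longrightarrow> dist X x = 2 * r \<longrightarrow>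
        (\<exists>G. weak_solution m (\<lambda>Y. transpose (A Y)) (ball x r \<inter> \<Omega>) G \<and>
           (\<forall>y\<in>bball \<Omega> x r. \<forall>s\<in>{0<..<r}. \<forall>Y\<in>ball x r \<inter> \<Omega>. corkscrew_point c \<Omega> y s Y \<longrightarrow>
              inverse C * (measure m (ball y s \<inter> \<Omega>) / s\<^sup>2) * G Y \<le> measure (\<omega> X) (bball \<Omega> y s) \<and>
              measure (\<omega> X) (bball \<Omega> y s) \<le> C * (measure m (ball y s \<inter> \<Omega>) / s\<^sup>2) * G Y)))"

text \<open>The same corkscrew constant \<open>c\<close> is used for the corkscrew condition and for corkscrew points.
  The constants \<open>C\<close> and \<open>\<gamma>\<close> depend on the operator through its ellipticity constant \<open>CL\<close> only.\<close>

definition pde_friendly :: "(real ^ 'n) set \<Rightarrow> (real ^ 'n) measure \<Rightarrow> bool" where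
  "pde_friendly \<Omega> m \<longleftrightarrow>
     harnack_chain_condition \<Omega> \<and>
     weighted_measure_on \<Omega> m \<and> doubling_on \<Omega> m \<and> gradient_closable \<Omega> m \<and> poincare_inequality \<Omega> m \<and>
     (\<exists>c\<in>{0<..<1}. corkscrew_condition c \<Omega> \<and>
        (\<forall>CL>0. \<exists>C>0. \<exists>\<gamma>\<in>{0<..<1}. \<forall>A. elliptic_matrix \<Omega> CL A \<longrightarrow>
           (\<exists>\<omega>. elliptic_measure_of \<Omega> m A \<omega> \<and>
              (\<forall>\<omega>'. elliptic_measure_of \<Omega> m A \<omega>' \<longrightarrow> (\<forall>X\<in>\<Omega>. \<omega>' X = \<omega> X)) \<and>
              em_doubling \<Omega> C \<omega> \<and> em_change_of_pole \<Omega> c C \<omega> \<and>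
              em_decay \<Omega> C \<gamma> \<omega> \<and> em_green \<Omega> m A c C \<omega>)))"


section \<open>The Carleson condition and \<open>A\<^sub>\<infinity>\<close>\<close>

definition cone :: "(real ^ 'n) set \<Rightarrow> real \<Rightarrow> real ^ 'n \<Rightarrow> (real ^ 'n) set" where
  "cone \<Omega> r x = {X \<in> \<Omega>. dist X x \<le> 2 * bdist \<Omega> X \<and> 2 * bdist \<Omega> X \<le> 2 * r}"

text \<open>The square of the area functional, with values in the extended nonnegative reals; the Carleson
  condition only involves this square.\<close>

definition area_functional_sq :: "(real ^ 'n) set \<Rightarrow> (real ^ 'n) measure \<Rightarrow> real
    \<Rightarrow> (real ^ 'n \<Rightarrow> real) \<Rightarrow> real ^ 'n \<Rightarrow> ennreal" where
  "area_functional_sq \<Omega> m r f x =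
     (\<integral>\<^sup>+X\<in>cone \<Omega> r x. (ennreal (\<bar>f X\<bar>\<^sup>2) / emeasure m (ball X (bdist \<Omega> X / 4))) \<partial>m)"

definition KCM :: "(real ^ 'n) set \<Rightarrow> (real ^ 'n) measure \<Rightarrow> (real ^ 'n \<Rightarrow> (real ^ 'n) measure)
    \<Rightarrow> (real ^ 'n \<Rightarrow> real) set" where
  "KCM \<Omega> m \<omega> = {f. \<exists>M>0. \<forall>x\<in>frontier \<Omega>. \<forall>r>0. \<forall>X\<in>\<Omega> - ball x (2 * r).
     (\<integral>\<^sup>+y\<in>bball \<Omega> x r. area_functional_sq \<Omega> m r f y \<partial>(\<omega> X))
       \<le> ennreal M * emeasure (\<omega> X) (bball \<Omega> x r)}"

definition A_infinity :: "(real ^ 'n) set \<Rightarrow> (real ^ 'n \<Rightarrow> (real ^ 'n) measure)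
    \<Rightarrow> (real ^ 'n \<Rightarrow> (real ^ 'n) measure) set" where
  "A_infinity \<Omega> \<omega>0 = {\<omega>1. \<forall>\<xi>>0. \<exists>\<zeta>>0. \<forall>x\<in>frontier \<Omega>. \<forall>r>0. \<forall>X\<in>\<Omega> - ball x (2 * r). \<forall>E.
     E \<in> sets borel \<longrightarrow> E \<subseteq> bball \<Omega> x r \<longrightarrow>
     measure (\<omega>1 X) E / measure (\<omega>1 X) (bball \<Omega> x r) < \<zeta> \<longrightarrow>
     measure (\<omega>0 X) E / measure (\<omega>0 X) (bball \<Omega> x r) < \<xi>}"

end

theory Submission
  imports Defs
begin

text \<open>Extend every \<open>\<omega>\<^sup>X\<close> to a Borel measure \<open>\<nu> X\<close> on the whole space that is carried by \<open>\<partial>\<Omega>\<close>, and put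
\<open>G(Z) = f(Z)\<^sup>2 / m(B\<^sub>Z)\<close>.  The square of the area functional is the integral of \<open>G\<close> over a cone.  Write
\<open>\<delta>(Z)\<close> for the distance to the boundary and \<open>S(Z)\<close> for the shadow \<open>cball Z (2 \<delta>(Z))\<close>.  By Tonelli the
Carleson condition says that the integral of \<open>G(Z) \<nu>(\<Delta> \<inter> S(Z))\<close> over \<open>\<delta>(Z) \<le> r\<close> is at most
\<open>M \<nu>(\<Delta>)\<close> (\<open>area_fubini\<close>, \<open>tent_integral\<close>).  The proof uses that both families are doubling, charge every
boundary ball, and satisfy a change of pole formula.

From \<open>A\<^sub>\<infinity>\<close> to the Carleson conditions (\<open>Carleson_transfer\<close>).  On a boundary ball \<open>\<Delta>\<close> the set \<open>E\<close> where
the area functional is large is \<open>\<nu>\<^sub>1\<close>-small by the inequality of Chebyshev, hence \<open>\<nu>\<^sub>0\<close>-small.  The points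
\<open>Z\<close> with at least half of the shadow outside \<open>E\<close> contribute at most a constant times the bound for the area
functional off \<open>E\<close>.  The shadows of the other points are mostly contained in \<open>E\<close>; by the covering lemma of Vitali
these points lie below disjoint boundary balls of small total mass, so their contribution is at most half of the
best Carleson constant for \<open>\<nu>\<^sub>0\<close>.  That constant is finite when \<open>G\<close> is integrable, which is the case after
truncation, and the half is absorbed (\<open>Carleson_improvement\<close>, \<open>Carleson_remote_pole\<close>).  The argument enlarges \<open>\<Delta>\<close>
and so needs a remote pole.  For a pole at distance \<open>2r\<close> the part of \<open>Z\<close> with \<open>\<delta>(Z)\<close> far below \<open>r\<close> is summed
over small balls (\<open>local_to_global\<close>), and the part with \<open>\<delta>(Z)\<close> comparable to \<open>r\<close> is bounded by a geometric
dichotomy (\<open>pole_or_whole_boundary_in_shadow\<close>, \<open>large_scale_mass_bound\<close>).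

From the Carleson conditions to \<open>A\<^sub>\<infinity>\<close> (\<open>absolute_continuity_from_Carleson_transfer\<close>).  Suppose that there are
sets \<open>E\<close> of arbitrarily small relative \<open>\<nu>\<^sub>1\<close> measure and with relative \<open>\<nu>\<^sub>0\<close> measure bounded below.  Choose
an open set \<open>U\<close> around \<open>E\<close> that is still \<open>\<nu>\<^sub>1\<close>-small, and consider the increasing level sets \<open>A\<^sub>0, A\<^sub>1, \<dots>\<close>
on which the maximal function of \<open>1\<^sub>U\<close> with respect to \<open>\<nu>\<^sub>1\<close> exceeds \<open>1/a, 1/a\<^sup>2, \<dots>\<close>.  Over each \<open>A\<^sub>j\<close>
take the layer of those \<open>Z\<close> whose distance to \<open>\<partial>\<Omega> - A\<^sub>j\<close> is comparable to \<open>\<delta>(Z)\<close>.  The indicator of the union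
of \<open>N\<close> layers satisfies the Carleson condition for \<open>\<nu>\<^sub>1\<close> with a constant independent of \<open>N\<close>, because seen from
a fixed ball the level sets decay geometrically (\<open>level_decay\<close>, \<open>Carleson_G\<close>).  Every point of \<open>U\<close> lies below all
\<open>N\<close> layers, so the integral of the area functional against \<open>\<nu>\<^sub>0\<close> is at least a constant times \<open>N \<nu>\<^sub>0(E)\<close>
(\<open>energy_lower_bound\<close>).  A weighted sum of such functions satisfies the condition for \<open>\<nu>\<^sub>1\<close> and violates it
for \<open>\<nu>\<^sub>0\<close>.\<close>

section \<open>Covering by balls and distance to the boundary\<close>

lemma ennreal_divide_mult_cancel:
  fixes a b :: ennreal
  assumes "b \<noteq> 0" "b \<noteq> \<top>"
  shows "a / b * b = a"
  using assms by (subst ennreal_divide_times) (simp add: ennreal_divide_self less_top)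

lemma ennreal_one_divide_antimono:
  fixes a b :: ennreal
  assumes "a \<le> b" "a \<noteq> 0" "a \<noteq> \<top>" "b \<noteq> 0" "b \<noteq> \<top>"
  shows "1 / b \<le> 1 / a"
proof -
  have "1 / b = (a / a) / b" using assms by (simp add: ennreal_divide_self less_top)
  also have "\<dots> = (a / b) / a" by (simp add: divide_ennreal_def ac_simps)
  also have "\<dots> \<le> (b / b) / a" using assms(1) by (intro divide_right_mono_ennreal)
  also have "\<dots> = 1 / a" using assms by (simp add: ennreal_divide_self less_top)
  finally show ?thesis .
qed

text \<open>Countable subadditivity in the shape of \<open>emeasure_UN_countable\<close>, which gives the matching equality for the
disjoint balls in the next proof.\<close>

lemma emeasure_UN_le_count_space:
  assumes J: "countable J" and sets: "\<And>i. i \<in> J \<Longrightarrow> A i \<in> sets M"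
  shows "emeasure M (\<Union>i\<in>J. A i) \<le> (\<integral>\<^sup>+i. emeasure M (A i) \<partial>count_space J)"
proof -
  have UN: "(\<Union>i\<in>J. A i) \<in> sets M" using assms by (intro sets.countable_UN') auto
  have "emeasure M (\<Union>i\<in>J. A i) = (\<integral>\<^sup>+x. indicator (\<Union>i\<in>J. A i) x \<partial>M)"
    using UN by simp
  also have "\<dots> \<le> (\<integral>\<^sup>+x. (\<integral>\<^sup>+i. indicator (A i) x \<partial>count_space J) \<partial>M)"
  proof (rule nn_integral_mono)
    fix x
    show "indicator (\<Union>i\<in>J. A i) x \<le> (\<integral>\<^sup>+i. indicator (A i) x \<partial>count_space J)"
    proof (cases "x \<in> (\<Union>i\<in>J. A i)")
      case True
      then obtain i where i: "i \<in> J" "x \<in> A i" by auto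
      have "indicator (A i) x \<le> (\<integral>\<^sup>+i. indicator (A i) x \<partial>count_space J)"
        using i by (intro nn_integral_ge_point) auto
      with True i show ?thesis by simp
    qed auto
  qed
  also have "\<dots> = (\<integral>\<^sup>+i. (\<integral>\<^sup>+x. indicator (A i) x \<partial>M) \<partial>count_space J)"
    using assms by (intro nn_integral_count_space_nn_integral) auto
  also have "\<dots> = (\<integral>\<^sup>+i. emeasure M (A i) \<partial>count_space J)"
    using sets by (intro nn_integral_cong) auto
  finally show ?thesis .
qed

text \<open>A doubling-type comparison of \<open>\<mu>\<close> with \<open>\<eta>\<close> on the single balls of a cover passes to the covered set, since
Vitali's lemma extracts disjoint balls whose fivefold enlargements still cover.  The two measures may live on
different sets: a measure on \<open>\<Omega>\<close> is compared with one on \<open>\<partial>\<Omega>\<close> below.\<close>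

lemma vitali_measure_comparison:
  fixes a :: "'i \<Rightarrow> 'b::euclidean_space"
  assumes sets: "sets \<mu> = sets borel" "sets \<eta> = sets borel"
    and cover: "S \<subseteq> (\<Union>i\<in>I. ball (a i) (r i))"
    and radii: "\<And>i. i \<in> I \<Longrightarrow> 0 < r i \<and> r i \<le> R"
    and inside: "\<And>i. i \<in> I \<Longrightarrow> ball (a i) (r i) \<subseteq> T"
    and T: "T \<in> sets borel"
    and compare: "\<And>i. i \<in> I \<Longrightarrow> emeasure \<mu> (ball (a i) (5 * r i)) \<le> D * emeasure \<eta> (ball (a i) (r i))"
  shows "emeasure \<mu> S \<le> D * emeasure \<eta> T"
proof -
  obtain J where J: "countable J" "J \<subseteq> I"
    "pairwise (\<lambda>i j. disjnt (ball (a i) (r i)) (ball (a j) (r j))) J"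
    "S \<subseteq> (\<Union>i\<in>J. ball (a i) (5 * r i))"
    by (rule Vitali_covering_lemma_balls[OF cover radii]) auto
  have "emeasure \<mu> S \<le> emeasure \<mu> (\<Union>i\<in>J. ball (a i) (5 * r i))"
    by (rule emeasure_mono) (use J sets in auto)
  also have "\<dots> \<le> (\<integral>\<^sup>+i. emeasure \<mu> (ball (a i) (5 * r i)) \<partial>count_space J)"
    using J sets by (intro emeasure_UN_le_count_space) auto
  also have "\<dots> \<le> (\<integral>\<^sup>+i. D * emeasure \<eta> (ball (a i) (r i)) \<partial>count_space J)"
    using J compare by (intro nn_integral_mono) auto
  also have "\<dots> = D * (\<integral>\<^sup>+i. emeasure \<eta> (ball (a i) (r i)) \<partial>count_space J)"
    by (rule nn_integral_cmult) auto
  also have "(\<integral>\<^sup>+i. emeasure \<eta> (ball (a i) (r i)) \<partial>count_space J) = emeasure \<eta> (\<Union>i\<in>J. ball (a i) (r i))"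
    by (rule emeasure_UN_countable[symmetric])
      (use J sets in \<open>auto simp: disjoint_family_on_def pairwise_def disjnt_def\<close>)
  also have "\<dots> \<le> emeasure \<eta> T"
    using J inside T sets by (intro emeasure_mono) auto
  finally show ?thesis by (simp add: mult_left_mono)
qed

lemma exists_foot:
  assumes "frontier \<Omega> \<noteq> {}"
  obtains z where "z \<in> frontier \<Omega>" "dist z Z = bdist \<Omega> Z"
  using infdist_attains_inf[of "frontier \<Omega>" Z] assms unfolding bdist_def
  by (metis dist_commute frontier_closed)

lemma bdist_le: "z \<in> frontier \<Omega> \<Longrightarrow> bdist \<Omega> Z \<le> dist Z z"
  by (simp add: bdist_def infdist_le)

lemma bdist_nonneg [simp]: "0 \<le> bdist \<Omega> Z"
  by (simp add: bdist_def infdist_nonneg)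

lemma bdist_pos:
  assumes "open \<Omega>" "frontier \<Omega> \<noteq> {}" "Z \<in> \<Omega>"
  shows "0 < bdist \<Omega> Z"
  unfolding bdist_def
  using assms infdist_pos_not_in_closed[of "frontier \<Omega>" Z] frontier_disjoint_eq[of \<Omega>] by auto

lemma bdist_lipschitz: "\<bar>bdist \<Omega> Z - bdist \<Omega> Z'\<bar> \<le> dist Z Z'"
  unfolding bdist_def by (rule infdist_triangle_abs)

lemma ball_bdist_subset:
  assumes "Z \<in> \<Omega>"
  shows "ball Z (bdist \<Omega> Z) \<subseteq> \<Omega>"
proof (cases "bdist \<Omega> Z > 0")
  case True
  have "ball Z (bdist \<Omega> Z) \<inter> frontier \<Omega> = {}"
    using bdist_le[of _ \<Omega> Z] by (auto simp: not_less[symmetric])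
  moreover have "ball Z (bdist \<Omega> Z) \<inter> \<Omega> \<noteq> {}"
    using True assms by (metis IntI centre_in_ball empty_iff)
  ultimately show ?thesis
    using connected_Int_frontier[of "ball Z (bdist \<Omega> Z)" \<Omega>] by blast
qed (simp add: ball_empty)

section \<open>Families of measures on the boundary\<close>

locale corkscrew_domain =
  fixes \<Omega> :: "(real ^ 'n) set" and c :: real
  assumes open_domain: "open \<Omega>"
    and corkscrew: "corkscrew_condition c \<Omega>"
    and c_pos: "0 < c"
begin

lemma dist_frontier_pos: "X \<in> \<Omega> \<Longrightarrow> x \<in> frontier \<Omega> \<Longrightarrow> 0 < dist X x"
  using open_domain frontier_disjoint_eq[of \<Omega>] by auto

lemma domain_not_narrow:
  assumes "x \<in> frontier \<Omega>" "X \<in> \<Omega>" "r < dist X x" "bounded \<Omega>"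
  shows "r < diameter \<Omega>"
proof -
  have "dist X x \<le> diameter (closure \<Omega>)"
    using assms closure_subset by (intro diameter_bounded_bound) (auto simp: frontier_def)
  then show ?thesis using assms by (simp add: diameter_closure)
qed

lemma exists_corkscrew_ball:
  assumes "x \<in> frontier \<Omega>" "0 < r" "X \<in> \<Omega>" "r < dist X x"
  obtains A where "ball A (c * r) \<subseteq> ball x r \<inter> \<Omega>" "A \<in> \<Omega>" "dist A x < r" "c * r \<le> bdist \<Omega> A"
proof -
  obtain A where A: "ball A (c * r) \<subseteq> ball x r \<inter> \<Omega>"
    using corkscrew assms domain_not_narrow[OF assms(1,3,4)] unfolding corkscrew_condition_def by metis
  have "A \<in> ball A (c * r)" using c_pos assms by simp
  with A have A': "A \<in> \<Omega>" "dist A x < r" by (auto simp: dist_commute subset_iff)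
  have "c * r \<le> bdist \<Omega> A"
    unfolding bdist_def
  proof (subst infdist_notempty)
    show "frontier \<Omega> \<noteq> {}" using assms by auto
    show "c * r \<le> (INF a\<in>frontier \<Omega>. dist A a)"
    proof (rule cINF_greatest)
      show "frontier \<Omega> \<noteq> {}" using assms by auto
      fix a assume a: "a \<in> frontier \<Omega>"
      then have "a \<notin> ball A (c * r)"
        using A open_domain frontier_disjoint_eq[of \<Omega>] by blast
      then show "c * r \<le> dist A a" by simp
    qed
  qed
  with A A' show thesis using that by blast
qed

lemma corkscrew_pointI:
  assumes "A \<in> \<Omega>" "c * r / 100 \<le> bdist \<Omega> A" "dist A x \<le> 100 * r" "x \<in> frontier \<Omega>"
  shows "corkscrew_point c \<Omega> x r A"
  using assms bdist_le[of x \<Omega> A] by (simp add: corkscrew_point_def)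

lemma exists_corkscrew_point:
  assumes "x \<in> frontier \<Omega>" "0 < r" "X \<in> \<Omega>" "r < dist X x"
  obtains A where "corkscrew_point c \<Omega> x r A" "A \<in> \<Omega>"
proof -
  obtain A where A: "A \<in> \<Omega>" "dist A x < r" "c * r \<le> bdist \<Omega> A"
    using exists_corkscrew_ball[OF assms] by metis
  have "c * r / 100 \<le> bdist \<Omega> A" using A(3) bdist_nonneg[of \<Omega> A] by linarith
  with A assms show thesis
    by (intro that[of A] corkscrew_pointI) auto
qed

end

text \<open>The measures are defined on all Borel sets and carried by the boundary, so that balls of the space can replace
boundary balls.  The constant is an extended real because all estimates compare values of \<open>emeasure\<close>.\<close>

locale elliptic_family = corkscrew_domain \<Omega> c
  for \<Omega> :: "(real ^ 'n) set" and c :: real +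
  fixes \<nu> :: "real ^ 'n \<Rightarrow> (real ^ 'n) measure" and C :: ennreal
  assumes C_ge: "1 \<le> C" and C_finite: "C < \<infinity>"
    and sets_nu: "X \<in> \<Omega> \<Longrightarrow> sets (\<nu> X) = sets borel"
    and prob_nu: "X \<in> \<Omega> \<Longrightarrow> prob_space (\<nu> X)"
    and nu_support: "X \<in> \<Omega> \<Longrightarrow> emeasure (\<nu> X) (- frontier \<Omega>) = 0"
    and nu_pos: "X \<in> \<Omega> \<Longrightarrow> x \<in> frontier \<Omega> \<Longrightarrow> 0 < r \<Longrightarrow> 0 < emeasure (\<nu> X) (ball x r)"
    and doubling: "x \<in> frontier \<Omega> \<Longrightarrow> 0 < r \<Longrightarrow> X \<in> \<Omega> \<Longrightarrow> 3 * r \<le> dist X x \<Longrightarrow>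
      emeasure (\<nu> X) (ball x (2 * r)) \<le> C * emeasure (\<nu> X) (ball x r)"
    and pole_le: "x \<in> frontier \<Omega> \<Longrightarrow> 0 < r \<Longrightarrow> corkscrew_point c \<Omega> x r A \<Longrightarrow> E \<in> sets borel \<Longrightarrow>
      E \<subseteq> ball x r \<Longrightarrow> Y \<in> \<Omega> \<Longrightarrow> 2 * r \<le> dist Y x \<Longrightarrow>
      emeasure (\<nu> Y) E \<le> C * emeasure (\<nu> A) E * emeasure (\<nu> Y) (ball x r)"
    and pole_ge: "x \<in> frontier \<Omega> \<Longrightarrow> 0 < r \<Longrightarrow> corkscrew_point c \<Omega> x r A \<Longrightarrow> E \<in> sets borel \<Longrightarrow>
      E \<subseteq> ball x r \<Longrightarrow> Y \<in> \<Omega> \<Longrightarrow> 2 * r \<le> dist Y x \<Longrightarrow>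
      emeasure (\<nu> A) E * emeasure (\<nu> Y) (ball x r) \<le> C * emeasure (\<nu> Y) E"
begin

lemma C_power_ge: "1 \<le> C ^ k"
  using C_ge by (rule one_le_power)

lemma C_power_mono: "i \<le> j \<Longrightarrow> C ^ i \<le> C ^ j"
  using C_ge by (rule power_increasing[rotated])

lemma C_power_finite: "C ^ k < \<infinity>"
  using C_finite by (simp add: power_less_top_ennreal)

lemma nu_finite: "X \<in> \<Omega> \<Longrightarrow> emeasure (\<nu> X) E < \<infinity>"
  using prob_nu[of X] by (simp add: prob_space.emeasure_le_1 le_less_trans[OF _ ennreal_one_less_top])

lemma nu_mono: "X \<in> \<Omega> \<Longrightarrow> E \<subseteq> F \<Longrightarrow> F \<in> sets borel \<Longrightarrow> emeasure (\<nu> X) E \<le> emeasure (\<nu> X) F"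
  using sets_nu[of X] by (intro emeasure_mono) auto

lemma borel_measurable_nu: "X \<in> \<Omega> \<Longrightarrow> h \<in> borel_measurable borel \<Longrightarrow> h \<in> borel_measurable (\<nu> X)"
  by (simp add: measurable_cong_sets[OF sets_nu refl])

lemma emeasure_restricted_nu:
  assumes "X \<in> \<Omega>" "U \<in> sets borel" "E \<in> sets borel"
  shows "emeasure (density (\<nu> X) (indicator U)) E = emeasure (\<nu> X) (E \<inter> U)"
proof -
  have U: "U \<in> sets (\<nu> X)" and E: "E \<in> sets (\<nu> X)" using assms sets_nu by simp_all
  have "emeasure (density (\<nu> X) (indicator U)) E = (\<integral>\<^sup>+y. indicator U y * indicator E y \<partial>\<nu> X)"
    by (rule emeasure_density[OF borel_measurable_indicator[OF U] E])
  also have "\<dots> = (\<integral>\<^sup>+y. indicator (E \<inter> U) y \<partial>\<nu> X)"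
    by (intro nn_integral_cong) (simp only: indicator_inter_arith mult.commute)
  also have "\<dots> = emeasure (\<nu> X) (E \<inter> U)"
    using E U by (intro nn_integral_indicator) auto
  finally show ?thesis .
qed

lemma nu_AE_frontier: "X \<in> \<Omega> \<Longrightarrow> AE y in \<nu> X. y \<in> frontier \<Omega>"
  using nu_support[of X] sets_nu[of X]
  by (intro AE_I[of _ _ "- frontier \<Omega>"]) (auto intro: borel_closed borel_comp)

lemma nu_Int_frontier:
  assumes "X \<in> \<Omega>" "E \<in> sets borel"
  shows "emeasure (\<nu> X) (E \<inter> frontier \<Omega>) = emeasure (\<nu> X) E"
  using nu_AE_frontier[OF assms(1)] sets_nu[OF assms(1)] assms(2)
  by (intro emeasure_eq_AE) (auto intro: borel_closed)

lemma doubling_iterated: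
  assumes "x \<in> frontier \<Omega>" "0 < r" "X \<in> \<Omega>" "2 * (2 ^ k * r) \<le> dist X x"
  shows "emeasure (\<nu> X) (ball x (2 ^ k * r)) \<le> C ^ k * emeasure (\<nu> X) (ball x r)"
  using assms(4)
proof (induction k)
  case 0 then show ?case by simp
next
  case (Suc k)
  have pos: "0 < 2 ^ k * r" using assms(2) by simp
  have dist: "4 * (2 ^ k * r) \<le> dist X x" using Suc.prems by (simp add: mult.assoc)
  have "emeasure (\<nu> X) (ball x (2 ^ Suc k * r)) \<le> C * emeasure (\<nu> X) (ball x (2 ^ k * r))"
    using doubling[OF assms(1) pos assms(3)] dist pos by (simp add: mult.assoc del: zero_less_mult_iff)
  also have "\<dots> \<le> C * (C ^ k * emeasure (\<nu> X) (ball x r))"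
  proof (rule mult_left_mono[OF Suc.IH])
    show "2 * (2 ^ k * r) \<le> dist X x" using dist pos by linarith
  qed simp
  finally show ?case by (simp add: mult.assoc)
qed

text \<open>The form in which doubling is used: the premise on the pole covers every intermediate radius.\<close>

lemma ball_comparison:
  assumes "x \<in> frontier \<Omega>" "0 < r" "X \<in> \<Omega>" "2 * (2 ^ k * r) \<le> dist X x"
    and "E \<subseteq> ball x (2 ^ k * r)"
  shows "emeasure (\<nu> X) E \<le> C ^ k * emeasure (\<nu> X) (ball x r)"
  using nu_mono[OF assms(3,5)] doubling_iterated[OF assms(1-4)] by simp

text \<open>The estimates on small balls centred in \<open>ball x r\<close> add up, because the disjoint balls of a Vitali cover stay in
\<open>ball x (4 r / 3)\<close>.  The pole is only assumed to be at distance \<open>2 r\<close>; doubling from \<open>2 r / 3\<close> to \<open>4 r / 3\<close>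
is exactly what this distance allows.\<close>

lemma local_to_global:
  assumes x: "x \<in> frontier \<Omega>" and r: "0 < r" and Y: "Y \<in> \<Omega>" "2 * r \<le> dist Y x"
    and rho: "0 < \<rho>" "3 * \<rho> \<le> r"
    and h[measurable]: "h \<in> borel_measurable borel"
    and local: "\<And>y. y \<in> frontier \<Omega> \<Longrightarrow> dist y x < r \<Longrightarrow>
      (\<integral>\<^sup>+z\<in>ball y \<rho>. h z \<partial>\<nu> Y) \<le> M * emeasure (\<nu> Y) (ball y \<rho>)"
  shows "(\<integral>\<^sup>+z\<in>ball x r. h z \<partial>\<nu> Y) \<le> M * C ^ 4 * emeasure (\<nu> Y) (ball x r)"
proof -
  note [measurable_cong] = sets_nu[OF Y(1)]
  let ?\<mu> = "density (\<nu> Y) h"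
  have mu: "emeasure ?\<mu> E = (\<integral>\<^sup>+z\<in>E. h z \<partial>\<nu> Y)" if "E \<in> sets borel" for E
    using that by (subst emeasure_density) auto
  have five: "emeasure ?\<mu> (ball y (5 * (\<rho> / 5))) \<le> (M * C ^ 3) * emeasure (\<nu> Y) (ball y (\<rho> / 5))"
    if y: "y \<in> frontier \<Omega>" "dist y x < r" for y
  proof -
    have d: "r \<le> dist Y y" using Y(2) y(2) dist_triangle[of Y x y] by linarith
    have "emeasure ?\<mu> (ball y (5 * (\<rho> / 5))) \<le> M * emeasure (\<nu> Y) (ball y \<rho>)"
      using local[OF y] mu by simp
    also have "emeasure (\<nu> Y) (ball y \<rho>) \<le> C ^ 3 * emeasure (\<nu> Y) (ball y (\<rho> / 5))"
    proof (rule order_trans)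
      show "emeasure (\<nu> Y) (ball y \<rho>) \<le> emeasure (\<nu> Y) (ball y (2 ^ 3 * (\<rho> / 5)))"
        using rho Y by (intro nu_mono) auto
      \<comment> \<open>doubling is used up to the radius \<open>8 \<rho> / 5 \<le> 8 r / 15\<close>, and the pole is at distance at least \<open>r\<close> from \<open>y\<close>\<close>
      show "\<dots> \<le> C ^ 3 * emeasure (\<nu> Y) (ball y (\<rho> / 5))"
      proof -
        have "emeasure (\<nu> Y) (ball y (2 * (4 * (\<rho> / 5)))) \<le> C * emeasure (\<nu> Y) (ball y (4 * (\<rho> / 5)))"
          using rho d y Y by (intro doubling) auto
        also have "emeasure (\<nu> Y) (ball y (4 * (\<rho> / 5))) \<le> C ^ 2 * emeasure (\<nu> Y) (ball y (\<rho> / 5))"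
          using rho d y Y by (intro ball_comparison) auto
        finally show ?thesis by (simp add: mult_left_mono power3_eq_cube power2_eq_square mult.assoc)
      qed
    qed
    finally show ?thesis by (simp add: mult_left_mono mult.assoc)
  qed
  have "(\<integral>\<^sup>+z\<in>ball x r. h z \<partial>\<nu> Y) = (\<integral>\<^sup>+z\<in>ball x r \<inter> frontier \<Omega>. h z \<partial>\<nu> Y)"
    using nu_AE_frontier[OF Y(1)] by (intro nn_integral_cong_AE) (auto simp: indicator_def)
  also have "\<dots> = emeasure ?\<mu> (ball x r \<inter> frontier \<Omega>)"
    by (intro mu[symmetric]) (auto intro: borel_closed)
  also have "\<dots> \<le> (M * C ^ 3) * emeasure (\<nu> Y) (ball x (4 / 3 * r))"
  proof (rule vitali_measure_comparison[where a = "\<lambda>y. y" and r = "\<lambda>_. \<rho> / 5" and R = "\<rho>"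
        and I = "ball x r \<inter> frontier \<Omega>"])
    show "ball y (\<rho> / 5) \<subseteq> ball x (4 / 3 * r)" if "y \<in> ball x r \<inter> frontier \<Omega>" for y
      using that rho by (intro ball_subset_ball_iff[THEN iffD2] disjI1) (auto simp: dist_commute)
  qed (use rho five sets_nu[OF Y(1)] in \<open>auto simp: dist_commute\<close>)
  also have "emeasure (\<nu> Y) (ball x (4 / 3 * r)) \<le> C * emeasure (\<nu> Y) (ball x r)"
  proof -
    have "emeasure (\<nu> Y) (ball x (2 * (2 / 3 * r))) \<le> C * emeasure (\<nu> Y) (ball x (2 / 3 * r))"
      using x r Y by (intro doubling) auto
    also have "emeasure (\<nu> Y) (ball x (2 / 3 * r)) \<le> emeasure (\<nu> Y) (ball x r)"
      using r Y by (intro nu_mono) auto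
    finally show ?thesis by (simp add: mult_left_mono)
  qed
  finally show ?thesis
    by (simp add: mult_left_mono mult.assoc power_numeral_reduce)
qed

text \<open>A corkscrew point for the ball serves as an intermediate pole between \<open>X\<close> and \<open>Y\<close>.\<close>

lemma pole_comparison:
  assumes x: "x \<in> frontier \<Omega>" "0 < r" and X: "X \<in> \<Omega>" "2 * r \<le> dist X x"
    and Y: "Y \<in> \<Omega>" "2 * r \<le> dist Y x" and E: "E \<in> sets borel" "E \<subseteq> ball x r"
  shows "emeasure (\<nu> Y) E * emeasure (\<nu> X) (ball x r)
      \<le> C ^ 2 * emeasure (\<nu> Y) (ball x r) * emeasure (\<nu> X) E"
proof -
  obtain A where A: "corkscrew_point c \<Omega> x r A"
    using exists_corkscrew_point[OF x X(1)] x X by auto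
  have "emeasure (\<nu> Y) E * emeasure (\<nu> X) (ball x r)
      \<le> (C * emeasure (\<nu> A) E * emeasure (\<nu> Y) (ball x r)) * emeasure (\<nu> X) (ball x r)"
    using pole_le[OF x A E Y] by (rule mult_right_mono) simp
  also have "\<dots> = C * emeasure (\<nu> Y) (ball x r) * (emeasure (\<nu> A) E * emeasure (\<nu> X) (ball x r))"
    by (simp add: ac_simps)
  also have "\<dots> \<le> C * emeasure (\<nu> Y) (ball x r) * (C * emeasure (\<nu> X) E)"
    using pole_ge[OF x A E X] by (rule mult_left_mono) simp
  finally show ?thesis by (simp add: ac_simps power2_eq_square)
qed

text \<open>The change of pole formula for the ball itself: the normalised measure seen from \<open>Y\<close> is \<open>1\<close>.  The existence
of a remote pole \<open>Y\<close> is what makes the formula applicable.\<close>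

lemma bourgain_estimate:
  assumes x: "x \<in> frontier \<Omega>" "0 < r" and A: "corkscrew_point c \<Omega> x r A"
    and Y: "Y \<in> \<Omega>" "2 * r \<le> dist Y x"
  shows "1 \<le> C * emeasure (\<nu> A) (ball x r)"
proof -
  let ?b = "emeasure (\<nu> Y) (ball x r)"
  have "?b \<le> (C * emeasure (\<nu> A) (ball x r)) * ?b"
    using pole_le[OF x A _ _ Y, of "ball x r"] by simp
  then have "1 * ?b \<le> (C * emeasure (\<nu> A) (ball x r)) * ?b" by simp
  then show ?thesis
    using nu_pos[OF Y(1) x] nu_finite[OF Y(1), of "ball x r"]
    by (subst (asm) ennreal_mult_le_mult_iff[of ?b, unfolded mult.commute[of ?b]]) auto
qed

text \<open>A boundary ball is not heavier than a much smaller ball centred at any of its points, although the pole may be as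
close as \<open>r\<close> to the centre \<open>y\<close> of the smaller ball.  If \<open>y\<close> is at distance less than \<open>r / 2\<close> from \<open>x\<close>, doubling
suffices.  Otherwise neither ball may be enlarged enough to contain the other; then a corkscrew point \<open>A\<close> close to
\<open>x\<close> lies far from \<open>y\<close> and gives the small ball a mass bounded below.  The comparison is made on the
intersection \<open>F\<close> of the two balls, where both changes of pole apply, and the mass of \<open>F\<close> cancels.\<close>

lemma relocation:
  assumes x: "x \<in> frontier \<Omega>" "0 < r" and X: "X \<in> \<Omega>" "2 * r \<le> dist X x"
    and y: "y \<in> frontier \<Omega>" "dist y x < r" and k: "4 \<le> k"
  shows "emeasure (\<nu> X) (ball x r) \<le> C ^ (k + 4) * emeasure (\<nu> X) (ball y (r / 2 ^ k))"
proof -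
  define \<rho> where "\<rho> = r / 2 ^ k"
  have "2 ^ 4 \<le> (2::real) ^ k" using k by (intro power_increasing) auto
  then have rho: "0 < \<rho>" "16 * \<rho> \<le> r" using x unfolding \<rho>_def
    by (auto simp: field_simps)
  have Xy: "r \<le> dist X y" using X(2) y(2) dist_triangle[of X x y] by linarith
  show ?thesis
  proof (cases "dist y x < r / 2")
    case True
    have d: "3 / 2 * r \<le> dist X y" using X(2) True dist_triangle[of X x y] by linarith
    have "emeasure (\<nu> X) (ball x r) \<le> C * emeasure (\<nu> X) (ball x (r / 2))"
      using doubling[OF x(1), of "r / 2" X] x X by simp
    also have "emeasure (\<nu> X) (ball x (r / 2)) \<le> emeasure (\<nu> X) (ball y r)"
      using X(1) True by (intro nu_mono ball_subset_ball_iff[THEN iffD2] disjI1) (auto simp: dist_commute)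
    also have "\<dots> \<le> C * emeasure (\<nu> X) (ball y (r / 2))"
      using doubling[OF y(1), of "r / 2" X] x X d by simp
    also have "emeasure (\<nu> X) (ball y (r / 2)) \<le> C ^ (k - 1) * emeasure (\<nu> X) (ball y \<rho>)"
    proof (rule ball_comparison[OF y(1) rho(1) X(1)])
      have eq: "2 ^ (k - 1) * \<rho> = r / 2"
        unfolding \<rho>_def using k by (simp add: power_diff)
      show "2 * (2 ^ (k - 1) * \<rho>) \<le> dist X y" "ball y (r / 2) \<subseteq> ball y (2 ^ (k - 1) * \<rho>)"
        unfolding eq using Xy by auto
    qed
    finally have "emeasure (\<nu> X) (ball x r) \<le> C ^ (k + 1) * emeasure (\<nu> X) (ball y \<rho>)"
      using k by (cases k) (auto simp: mult_left_mono mult.assoc)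
    also have "\<dots> \<le> C ^ (k + 4) * emeasure (\<nu> X) (ball y \<rho>)"
      by (intro mult_right_mono C_power_mono) auto
    finally show ?thesis by (simp add: \<rho>_def)
  next
    case False
    obtain A where A: "A \<in> \<Omega>" "dist A x < r / 10" "c * (r / 10) \<le> bdist \<Omega> A"
      by (rule exists_corkscrew_ball[OF x(1) _ X(1), of "r / 10"]) (use x X in auto)
    have cr: "0 < c * r" using c_pos x by simp
    have Ay: "2 / 5 * r \<le> dist A y" "dist A y \<le> 11 / 10 * r"
      using A(2) False y(2) dist_triangle[of y x A] dist_triangle[of A y x] dist_triangle[of y A x]
      by (auto simp: dist_commute)
    have Ax: "corkscrew_point c \<Omega> x r A"
      using A x cr by (intro corkscrew_pointI) auto
    have A8: "corkscrew_point c \<Omega> y (r / 8) A"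
      using A x y cr Ay by (intro corkscrew_pointI) auto
    define F where "F = ball x r \<inter> ball y \<rho>"
    have F: "F \<in> sets borel" "F \<subseteq> ball x r" "F \<subseteq> ball y \<rho>" by (auto simp: F_def)
    have "1 \<le> C * emeasure (\<nu> A) (ball y (r / 8))"
      using x y X Xy by (intro bourgain_estimate[OF y(1) _ A8 X(1)]) auto
    also have "emeasure (\<nu> A) (ball y (r / 8)) \<le> C ^ k * emeasure (\<nu> A) (ball y \<rho>)"
    proof -
      have eq: "2 ^ (k - 3) * \<rho> = r / 8"
        unfolding \<rho>_def using k by (simp add: power_diff)
      have "emeasure (\<nu> A) (ball y (r / 8)) \<le> C ^ (k - 3) * emeasure (\<nu> A) (ball y \<rho>)"
        by (rule ball_comparison[OF y(1) rho(1) A(1)]) (use eq Ay x in auto)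
      also have "\<dots> \<le> C ^ k * emeasure (\<nu> A) (ball y \<rho>)"
        by (intro mult_right_mono C_power_mono) auto
      finally show ?thesis .
    qed
    finally have one: "1 \<le> C ^ (k + 1) * emeasure (\<nu> A) (ball y \<rho>)"
      by (simp add: mult_left_mono mult.assoc)
    let ?BX = "emeasure (\<nu> X) (ball x r)" and ?By = "emeasure (\<nu> X) (ball y \<rho>)"
    let ?Ay = "emeasure (\<nu> A) (ball y \<rho>)"
    have 1: "emeasure (\<nu> A) F * ?BX \<le> C * emeasure (\<nu> X) F"
      by (rule pole_ge[OF x Ax F(1,2) X])
    have 2: "emeasure (\<nu> X) F * ?Ay \<le> C ^ 2 * ?By * emeasure (\<nu> A) F"
      using F rho Ay Xy by (intro pole_comparison[OF y(1) rho(1) A(1) _ X(1)]) auto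
    have "emeasure (\<nu> X) F * ?BX \<le> (C ^ (k + 1) * ?Ay) * (emeasure (\<nu> X) F * ?BX)"
      using mult_right_mono[OF one, of "emeasure (\<nu> X) F * ?BX"] by simp
    also have "\<dots> = C ^ (k + 1) * ?BX * (emeasure (\<nu> X) F * ?Ay)" by (simp add: ac_simps)
    also have "\<dots> \<le> C ^ (k + 1) * ?BX * (C ^ 2 * ?By * emeasure (\<nu> A) F)"
      using 2 by (rule mult_left_mono) simp
    also have "\<dots> = C ^ (k + 3) * ?By * (emeasure (\<nu> A) F * ?BX)"
      by (simp add: ac_simps power_add power_numeral_reduce)
    also have "\<dots> \<le> C ^ (k + 3) * ?By * (C * emeasure (\<nu> X) F)"
      using 1 by (rule mult_left_mono) simp
    also have "\<dots> = emeasure (\<nu> X) F * (C ^ (k + 4) * ?By)"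
      by (simp add: ac_simps power_add power_numeral_reduce)
    finally have "emeasure (\<nu> X) F * ?BX \<le> emeasure (\<nu> X) F * (C ^ (k + 4) * ?By)" .
    moreover have "0 < emeasure (\<nu> X) F"
    proof -
      have "open F" "y \<in> F" using y rho by (auto simp: F_def dist_commute)
      then obtain e where e: "e > 0" "ball y e \<subseteq> F" by (meson open_contains_ball)
      have "0 < emeasure (\<nu> X) (ball y e)" using nu_pos[OF X(1) y(1) e(1)] .
      also have "\<dots> \<le> emeasure (\<nu> X) F" using nu_mono[OF X(1) e(2) F(1)] .
      finally show ?thesis .
    qed
    ultimately show ?thesis
      using nu_finite[OF X(1), of F] by (simp add: ennreal_mult_le_mult_iff \<rho>_def)
  qed
qed

end

section \<open>The weighted measure and the area functional\<close>

definition area :: "(real ^ 'n) set \<Rightarrow> (real ^ 'n) measure \<Rightarrow> (real ^ 'n \<Rightarrow> ennreal) \<Rightarrow> real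
    \<Rightarrow> real ^ 'n \<Rightarrow> ennreal" where
  "area \<Omega> m G r y = (\<integral>\<^sup>+Z\<in>cone \<Omega> r y. G Z \<partial>m)"

text \<open>The Carleson condition for a density \<open>G\<close>, which plays the role of \<open>f\<^sup>2 / m(B\<^sub>Z)\<close>.\<close>

definition Carleson :: "(real ^ 'n) set \<Rightarrow> (real ^ 'n) measure \<Rightarrow> (real ^ 'n \<Rightarrow> (real ^ 'n) measure)
    \<Rightarrow> (real ^ 'n \<Rightarrow> ennreal) \<Rightarrow> ennreal \<Rightarrow> bool" where
  "Carleson \<Omega> m \<nu> G M \<longleftrightarrow> (\<forall>x\<in>frontier \<Omega>. \<forall>r>0. \<forall>X\<in>\<Omega>. 2 * r \<le> dist X x \<longrightarrow>
     (\<integral>\<^sup>+y\<in>ball x r. area \<Omega> m G r y \<partial>\<nu> X) \<le> M * emeasure (\<nu> X) (ball x r))"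

definition whitney_mass :: "(real ^ 'n) set \<Rightarrow> (real ^ 'n) measure \<Rightarrow> real ^ 'n \<Rightarrow> ennreal" where
  "whitney_mass \<Omega> m Z = emeasure m (ball Z (bdist \<Omega> Z / 4))"

lemma continuous_bdist: "continuous_on UNIV (bdist \<Omega>)"
  unfolding bdist_def[abs_def] by (intro continuous_intros)

lemma measurable_bdist [measurable]: "bdist \<Omega> \<in> borel_measurable borel"
  by (intro borel_measurable_continuous_onI continuous_bdist)

text \<open>Positivity and finiteness of the balls are part of the setting; they follow from doubling once \<open>m\<close> is known to be
nonzero and finite near one point.\<close>

locale weighted_domain =
  fixes \<Omega> :: "(real ^ 'n) set" and m :: "(real ^ 'n) measure" and Cm :: ennreal
  assumes open_Omega: "open \<Omega>"
    and sets_m: "sets m = sets (lebesgue_on \<Omega>)"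
    and Cm_ge: "1 \<le> Cm" and Cm_finite: "Cm < \<infinity>"
    and m_doubling: "X \<in> closure \<Omega> \<Longrightarrow> 0 < r \<Longrightarrow>
      emeasure m (ball X (2 * r) \<inter> \<Omega>) \<le> Cm * emeasure m (ball X r \<inter> \<Omega>)"
    and m_ball_finite: "emeasure m (ball X r \<inter> \<Omega>) < \<infinity>"
    and m_ball_pos: "X \<in> closure \<Omega> \<Longrightarrow> 0 < r \<Longrightarrow> 0 < emeasure m (ball X r \<inter> \<Omega>)"
begin

lemma space_m: "space m = \<Omega>"
  using sets_eq_imp_space_eq[OF sets_m] by (simp add: space_restrict_space)

lemma borel_Int_sets_m: "S \<in> sets borel \<Longrightarrow> S \<inter> \<Omega> \<in> sets m"
  unfolding sets_m sets_restrict_space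
  by (rule image_eqI[of _ _ S]) (auto intro: sets_completionI_sets)

lemma measurable_id_m: "(\<lambda>Z. Z) \<in> measurable m borel"
  by (rule measurableI) (simp_all add: space_m borel_Int_sets_m)

lemma sigma_finite_m: "sigma_finite_measure m"
proof
  show "\<exists>A. countable A \<and> A \<subseteq> sets m \<and> \<Union> A = space m \<and> (\<forall>a\<in>A. emeasure m a \<noteq> \<infinity>)"
  proof (intro exI[of _ "range (\<lambda>n::nat. ball 0 (real n) \<inter> \<Omega>)"] conjI)
    show "\<Union> (range (\<lambda>n::nat. ball 0 (real n) \<inter> \<Omega>)) = space m"
      using reals_Archimedean2 by (fastforce simp: space_m)
  qed (use m_ball_finite borel_Int_sets_m in \<open>auto simp: less_top\<close>)
qed

lemma measurable_m_of_borel: "f \<in> measurable borel N \<Longrightarrow> f \<in> measurable m N"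
  by (rule measurable_compose[OF measurable_id_m])

lemma nn_integral_cong_m: "(\<And>Z. Z \<in> \<Omega> \<Longrightarrow> f Z = g Z) \<Longrightarrow> integral\<^sup>N m f = integral\<^sup>N m g"
  by (intro nn_integral_cong) (simp add: space_m)

lemma nn_integral_mono_m: "(\<And>Z. Z \<in> \<Omega> \<Longrightarrow> f Z \<le> g Z) \<Longrightarrow> integral\<^sup>N m f \<le> integral\<^sup>N m g"
  by (intro nn_integral_mono) (simp add: space_m)

lemma emeasure_image_measure:
  assumes h: "h \<in> borel_measurable m" and F: "F \<in> sets borel"
  shows "emeasure (distr (density m h) borel (\<lambda>Z. Z)) F = (\<integral>\<^sup>+Z\<in>F. h Z \<partial>m)"
proof -
  have "emeasure (distr (density m h) borel (\<lambda>Z. Z)) F = emeasure (density m h) (F \<inter> \<Omega>)"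
    using F measurable_id_m by (subst emeasure_distr) (auto simp: space_m)
  also have "\<dots> = (\<integral>\<^sup>+Z\<in>F \<inter> \<Omega>. h Z \<partial>m)"
    by (rule emeasure_density[OF h borel_Int_sets_m[OF F]])
  also have "\<dots> = (\<integral>\<^sup>+Z\<in>F. h Z \<partial>m)"
    by (intro nn_integral_cong_m) (auto simp: indicator_def)
  finally show ?thesis .
qed

lemma m_mono: "E \<subseteq> F \<Longrightarrow> F \<in> sets borel \<Longrightarrow> emeasure m (E \<inter> \<Omega>) \<le> emeasure m (F \<inter> \<Omega>)"
  by (intro emeasure_mono borel_Int_sets_m) auto

lemma m_doubling_iterated:
  assumes "X \<in> closure \<Omega>" "0 < r"
  shows "emeasure m (ball X (2 ^ k * r) \<inter> \<Omega>) \<le> Cm ^ k * emeasure m (ball X r \<inter> \<Omega>)"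
proof (induction k)
  case (Suc k)
  have "emeasure m (ball X (2 * (2 ^ k * r)) \<inter> \<Omega>) \<le> Cm * emeasure m (ball X (2 ^ k * r) \<inter> \<Omega>)"
    using assms by (intro m_doubling) auto
  also have "\<dots> \<le> Cm * (Cm ^ k * emeasure m (ball X r \<inter> \<Omega>))"
    by (intro mult_left_mono Suc.IH) auto
  finally show ?case by (simp add: mult.assoc)
qed simp

lemma whitney_ball_subset: "Z \<in> \<Omega> \<Longrightarrow> ball Z (bdist \<Omega> Z / 4) \<subseteq> \<Omega>"
  using ball_bdist_subset[of Z \<Omega>] subset_ball[of "bdist \<Omega> Z / 4" "bdist \<Omega> Z" Z] by auto

lemma whitney_mass_eq: "Z \<in> \<Omega> \<Longrightarrow> whitney_mass \<Omega> m Z = emeasure m (ball Z (bdist \<Omega> Z / 4) \<inter> \<Omega>)"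
  using whitney_ball_subset[of Z] by (simp add: whitney_mass_def Int_absorb2)

lemma measurable_emeasure_section:
  fixes P :: "real ^ 'n \<Rightarrow> real ^ 'n \<Rightarrow> bool"
  assumes "sigma_finite_measure N" "sets N = sets borel" "Measurable.pred (borel \<Otimes>\<^sub>M borel) (\<lambda>(Z, y). P Z y)"
  shows "(\<lambda>Z. emeasure N {y. P Z y}) \<in> borel_measurable borel"
proof -
  interpret sigma_finite_measure N by fact
  have sp: "space N = UNIV" using sets_eq_imp_space_eq[OF assms(2)] by simp
  have [measurable]: "Measurable.pred (borel \<Otimes>\<^sub>M N) (\<lambda>(Z, y). P Z y)"
    using assms(3) by (subst measurable_cong_sets[OF sets_pair_measure_cong[OF refl assms(2)] refl])
  have "{(Z, y). P Z y} \<in> sets (borel \<Otimes>\<^sub>M N)"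
  proof -
    have "{p \<in> space (borel \<Otimes>\<^sub>M N). case p of (Z, y) \<Rightarrow> P Z y} \<in> sets (borel \<Otimes>\<^sub>M N)" by measurable
    then show ?thesis by (simp add: space_pair_measure sp)
  qed
  from measurable_emeasure_Pair[OF this] show ?thesis by (simp add: vimage_def)
qed

lemma measurable_whitney_mass: "whitney_mass \<Omega> m \<in> borel_measurable m"
proof -
  interpret sigma_finite_measure m by (rule sigma_finite_m)
  note [measurable] = measurable_id_m measurable_m_of_borel[OF measurable_bdist]
  have "{p \<in> space (m \<Otimes>\<^sub>M m). dist (fst p) (snd p) < bdist \<Omega> (fst p) / 4} \<in> sets (m \<Otimes>\<^sub>M m)"
    by measurable
  from measurable_emeasure_Pair[OF this]
  have "(\<lambda>Z. emeasure m (Pair Z -` {p \<in> space (m \<Otimes>\<^sub>M m). dist (fst p) (snd p) < bdist \<Omega> (fst p) / 4}))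
    \<in> borel_measurable m" .
  moreover have "Pair Z -` {p \<in> space (m \<Otimes>\<^sub>M m). dist (fst p) (snd p) < bdist \<Omega> (fst p) / 4}
      = ball Z (bdist \<Omega> Z / 4)" if "Z \<in> \<Omega>" for Z
    using that whitney_ball_subset[OF that] by (auto simp: space_pair_measure space_m subset_iff)
  ultimately show ?thesis
    by (subst (asm) measurable_cong) (auto simp: space_m whitney_mass_def[abs_def])
qed

lemma measurable_cone_indicator:
  assumes "sets N = sets borel"
  shows "(\<lambda>(y, Z). indicator (cone \<Omega> r y) Z :: ennreal) \<in> borel_measurable (N \<Otimes>\<^sub>M m)"
proof -
  note [measurable_cong] = assms
  note [measurable] = measurable_id_m measurable_m_of_borel[OF measurable_bdist]
  have "(\<lambda>p. indicator {p. dist (snd p) (fst p) \<le> 2 * bdist \<Omega> (snd p) \<and> bdist \<Omega> (snd p) \<le> r} p :: ennreal)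
      \<in> borel_measurable (N \<Otimes>\<^sub>M m)"
    by measurable
  then show ?thesis
    by (rule measurable_cong[THEN iffD1, rotated])
      (auto simp: space_pair_measure space_m cone_def indicator_def)
qed

lemma cone_sets_m: "cone \<Omega> r y \<in> sets m"
proof -
  have "{Z. dist Z y \<le> 2 * bdist \<Omega> Z \<and> 2 * bdist \<Omega> Z \<le> 2 * r} \<inter> \<Omega> \<in> sets m"
    by (rule borel_Int_sets_m) measurable
  moreover have "{Z. dist Z y \<le> 2 * bdist \<Omega> Z \<and> 2 * bdist \<Omega> Z \<le> 2 * r} \<inter> \<Omega> = cone \<Omega> r y"
    by (auto simp: cone_def)
  ultimately show ?thesis by simp
qed

lemma measurable_area:
  assumes [measurable]: "G \<in> borel_measurable m"
  shows "area \<Omega> m G r \<in> borel_measurable borel"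
proof -
  interpret sigma_finite_measure m by (rule sigma_finite_m)
  note [measurable] = measurable_cone_indicator[OF refl]
  have "(\<lambda>(y, Z). G Z * indicator (cone \<Omega> r y) Z) \<in> borel_measurable (borel \<Otimes>\<^sub>M m)"
    by measurable
  from borel_measurable_nn_integral[OF this] show ?thesis by (simp add: area_def[abs_def])
qed

text \<open>Tonelli: \<open>Z\<close> belongs to the cone at \<open>y\<close> iff \<open>y\<close> belongs to the closed ball around \<open>Z\<close> of radius \<open>2 \<delta>(Z)\<close>.\<close>

lemma area_fubini:
  assumes G[measurable]: "G \<in> borel_measurable m" and N: "sigma_finite_measure N" "sets N = sets borel"
    and F: "F \<in> sets borel"
  shows "(\<integral>\<^sup>+y\<in>F. area \<Omega> m G r y \<partial>N)
    = (\<integral>\<^sup>+Z. G Z * indicator {Z. bdist \<Omega> Z \<le> r} Z * emeasure N (F \<inter> cball Z (2 * bdist \<Omega> Z)) \<partial>m)"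
proof -
  interpret m: sigma_finite_measure m by (rule sigma_finite_m)
  interpret N: sigma_finite_measure N by fact
  interpret pair_sigma_finite N m ..
  note [measurable_cong] = N(2)
  note [measurable] = F measurable_cone_indicator[OF N(2)] measurable_id_m measurable_m_of_borel[OF measurable_bdist]
  have meas: "(\<lambda>(y, Z). G Z * indicator (cone \<Omega> r y) Z * indicator F y) \<in> borel_measurable (N \<Otimes>\<^sub>M m)"
    by measurable
  have "(\<integral>\<^sup>+y\<in>F. area \<Omega> m G r y \<partial>N) = (\<integral>\<^sup>+y. (\<integral>\<^sup>+Z. G Z * indicator (cone \<Omega> r y) Z * indicator F y \<partial>m) \<partial>N)"
    unfolding area_def
    using cone_sets_m by (intro nn_integral_cong nn_integral_multc[symmetric]) auto
  also have "\<dots> = (\<integral>\<^sup>+Z. (\<integral>\<^sup>+y. G Z * indicator (cone \<Omega> r y) Z * indicator F y \<partial>N) \<partial>m)"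
    using Fubini'[OF meas] by simp
  also have "\<dots> = (\<integral>\<^sup>+Z. G Z * indicator {Z. bdist \<Omega> Z \<le> r} Z * emeasure N (F \<inter> cball Z (2 * bdist \<Omega> Z)) \<partial>m)"
  proof (rule nn_integral_cong_m)
    fix Z assume Z: "Z \<in> \<Omega>"
    have "(\<integral>\<^sup>+y. G Z * indicator (cone \<Omega> r y) Z * indicator F y \<partial>N)
       = (\<integral>\<^sup>+y. G Z * indicator {Z. bdist \<Omega> Z \<le> r} Z * indicator (F \<inter> cball Z (2 * bdist \<Omega> Z)) y \<partial>N)"
      using Z by (intro nn_integral_cong) (auto simp: cone_def indicator_def)
    also have "\<dots> = G Z * indicator {Z. bdist \<Omega> Z \<le> r} Z * emeasure N (F \<inter> cball Z (2 * bdist \<Omega> Z))"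
      using N(2) F by (subst nn_integral_cmult_indicator) auto
    finally show "(\<integral>\<^sup>+y. G Z * indicator (cone \<Omega> r y) Z * indicator F y \<partial>N)
       = G Z * indicator {Z. bdist \<Omega> Z \<le> r} Z * emeasure N (F \<inter> cball Z (2 * bdist \<Omega> Z))" .
  qed
  finally show ?thesis .
qed

end

section \<open>Carleson conditions for remote poles\<close>

text \<open>The left hand side of the Carleson condition after an application of Tonelli; here \<open>F\<close> is the part of the boundary over
which the area functional is integrated.\<close>

definition tent_integral :: "(real ^ 'n) set \<Rightarrow> (real ^ 'n) measure \<Rightarrow> (real ^ 'n) measure
    \<Rightarrow> (real ^ 'n) set \<Rightarrow> real \<Rightarrow> (real ^ 'n \<Rightarrow> ennreal) \<Rightarrow> ennreal" where
  "tent_integral \<Omega> m N F r G =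
    (\<integral>\<^sup>+Z. G Z * indicator {Z. bdist \<Omega> Z \<le> r} Z * emeasure N (F \<inter> cball Z (2 * bdist \<Omega> Z)) \<partial>m)"

context weighted_domain
begin

lemma measurable_shadow_mass:
  assumes "sigma_finite_measure N" "sets N = sets borel" "F \<in> sets borel"
  shows "(\<lambda>Z. emeasure N (F \<inter> cball Z (2 * bdist \<Omega> Z))) \<in> borel_measurable borel"
proof -
  note [measurable] = assms(3)
  have "(\<lambda>Z. emeasure N {y. y \<in> F \<and> dist Z y \<le> 2 * bdist \<Omega> Z}) \<in> borel_measurable borel"
    by (rule measurable_emeasure_section[OF assms(1,2)]) measurable
  moreover have "{y. y \<in> F \<and> dist Z y \<le> 2 * bdist \<Omega> Z} = F \<inter> cball Z (2 * bdist \<Omega> Z)" for Z by auto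
  ultimately show ?thesis by simp
qed

text \<open>For an integrable \<open>G\<close> the Carleson condition holds with the total mass of \<open>G\<close> as its constant.  This is the a
priori bound that the absorption argument needs.\<close>

lemma tent_integral_le_mass:
  assumes "sets N = sets borel" "F \<in> sets borel" "G \<in> borel_measurable m"
  shows "tent_integral \<Omega> m N F r G \<le> integral\<^sup>N m G * emeasure N F"
proof -
  have "tent_integral \<Omega> m N F r G \<le> (\<integral>\<^sup>+Z. G Z * emeasure N F \<partial>m)"
    unfolding tent_integral_def
  proof (rule nn_integral_mono_m)
    fix Z
    have "emeasure N (F \<inter> cball Z (2 * bdist \<Omega> Z)) \<le> emeasure N F"
      using assms by (intro emeasure_mono) auto
    then show "G Z * indicator {Z. bdist \<Omega> Z \<le> r} Z * emeasure N (F \<inter> cball Z (2 * bdist \<Omega> Z))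
       \<le> G Z * emeasure N F"
      by (auto simp: indicator_def intro: mult_left_mono)
  qed
  also have "\<dots> = integral\<^sup>N m G * emeasure N F"
    using assms by (intro nn_integral_multc) auto
  finally show ?thesis .
qed

lemma tent_integral_truncation_limit:
  assumes G: "G \<in> borel_measurable m" and N: "sigma_finite_measure N" "sets N = sets borel"
    and F: "F \<in> sets borel"
    and bound: "\<And>j::nat. tent_integral \<Omega> m N F r
      (\<lambda>Z. min (G Z) (of_nat j) * indicator (ball 0 (real j)) Z) \<le> b"
  shows "tent_integral \<Omega> m N F r G \<le> b"
proof -
  let ?T = "\<lambda>j Z. min (G Z) (of_nat j) * indicator (ball 0 (real j)) Z"
  let ?W = "\<lambda>Z. indicator {Z. bdist \<Omega> Z \<le> r} Z * emeasure N (F \<inter> cball Z (2 * bdist \<Omega> Z))"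
  note [measurable] = G measurable_m_of_borel[OF measurable_shadow_mass[OF N F]]
    measurable_m_of_borel[OF measurable_bdist] measurable_id_m
  have T_meas: "?T j \<in> borel_measurable m" for j
    by (intro borel_measurable_times_ennreal borel_measurable_min G borel_measurable_const
        measurable_m_of_borel[OF borel_measurable_indicator]) auto
  have W_meas: "?W \<in> borel_measurable m"
    by (rule borel_measurable_times_ennreal[OF _ measurable_m_of_borel[OF measurable_shadow_mass[OF N F]]])
      measurable
  have SUP: "(SUP j. ?T j Z * ?W Z) = G Z * ?W Z" for Z
  proof -
    have inc: "incseq (\<lambda>j. ?T j Z)"
      by (intro incseq_SucI mult_mono min.mono) (auto simp: indicator_def)
    have "(\<lambda>j. ?T j Z) \<longlonglongrightarrow> G Z"
    proof -
      have "(\<lambda>j. min (G Z) (of_nat j)) \<longlonglongrightarrow> min (G Z) \<infinity>"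
        by (intro tendsto_min tendsto_const of_nat_tendsto_top_ennreal[unfolded infinity_ennreal_def[symmetric]])
      moreover have "eventually (\<lambda>j. min (G Z) (of_nat j) = ?T j Z) sequentially"
      proof -
        have "eventually (\<lambda>j. norm Z < real j) sequentially"
          by (rule eventually_compose_filterlim[OF eventually_gt_at_top filterlim_real_sequentially])
        then show ?thesis by eventually_elim simp
      qed
      ultimately show ?thesis
        by (simp add: tendsto_cong)
    qed
    then have "G Z = (SUP j. ?T j Z)"
      using LIMSEQ_unique[OF _ LIMSEQ_SUP[OF inc]] by blast
    moreover have "(SUP j. ?T j Z * ?W Z) = (SUP j. ?T j Z) * ?W Z"
      by (rule SUP_mult_right_ennreal[symmetric])
    ultimately show ?thesis by simp
  qed
  have "tent_integral \<Omega> m N F r G = (\<integral>\<^sup>+Z. (SUP j. ?T j Z * ?W Z) \<partial>m)"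
    unfolding SUP by (simp add: tent_integral_def mult.assoc)
  also have "\<dots> = (SUP j. \<integral>\<^sup>+Z. ?T j Z * ?W Z \<partial>m)"
  proof (rule nn_integral_monotone_convergence_SUP)
    show "incseq (\<lambda>j Z. ?T j Z * ?W Z)"
      by (intro incseq_SucI le_funI mult_right_mono mult_mono min.mono) (auto simp: indicator_def)
    show "(\<lambda>Z. ?T j Z * ?W Z) \<in> borel_measurable m" for j
      by (intro borel_measurable_times_ennreal[OF T_meas W_meas])
  qed
  also have "\<dots> \<le> b"
    using bound by (intro SUP_least) (simp add: tent_integral_def mult.assoc)
  finally show ?thesis .
qed

lemma truncation_integral_finite:
  "(\<integral>\<^sup>+Z. min (G Z) (of_nat j) * indicator (ball 0 (real j)) Z \<partial>m) < \<infinity>"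
proof -
  have "(\<integral>\<^sup>+Z. min (G Z) (of_nat j) * indicator (ball 0 (real j)) Z \<partial>m)
     \<le> (\<integral>\<^sup>+Z. of_nat j * indicator (ball 0 (real j) \<inter> \<Omega>) Z \<partial>m)"
    by (intro nn_integral_mono_m) (auto simp: indicator_def)
  also have "\<dots> = of_nat j * emeasure m (ball 0 (real j) \<inter> \<Omega>)"
    by (intro nn_integral_cmult_indicator borel_Int_sets_m) auto
  also have "\<dots> < \<infinity>" using m_ball_finite 
    by (simp add: ennreal_mult_less_top ennreal_of_nat_eq_real_of_nat)
  finally show ?thesis .
qed

lemma Carleson_mono:
  assumes "Carleson \<Omega> m \<nu> H M" "\<And>Z. Z \<in> \<Omega> \<Longrightarrow> G Z \<le> H Z"
  shows "Carleson \<Omega> m \<nu> G M"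
proof -
  have "area \<Omega> m G r y \<le> area \<Omega> m H r y" for r y
    unfolding area_def using assms(2) by (intro nn_integral_mono_m mult_right_mono) auto
  then have "(\<integral>\<^sup>+y\<in>ball x r. area \<Omega> m G r y \<partial>\<nu> X) \<le> (\<integral>\<^sup>+y\<in>ball x r. area \<Omega> m H r y \<partial>\<nu> X)" for x r X
    by (intro nn_integral_mono mult_right_mono) auto
  with assms(1) show ?thesis unfolding Carleson_def by (meson order_trans)
qed

end

locale two_families = weighted_domain \<Omega> m Cm
    + F0: elliptic_family \<Omega> c \<nu>0 C + F1: elliptic_family \<Omega> c \<nu>1 C
  for \<Omega> :: "(real ^ 'n) set" and m Cm c \<nu>0 \<nu>1 C
begin

lemma sigma_finite_nu: "X \<in> \<Omega> \<Longrightarrow> sigma_finite_measure (\<nu>0 X)" "X \<in> \<Omega> \<Longrightarrow> sigma_finite_measure (\<nu>1 X)"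
  using F0.prob_nu[of X] F1.prob_nu[of X] by (auto intro: prob_space_imp_sigma_finite)

text \<open>One step of the absorption argument.  If \<open>t\<close> is a Carleson constant for \<open>\<nu>0\<close> and remote poles, then half of \<open>t\<close>
plus a constant that does not depend on \<open>t\<close> is another one.  The points \<open>Z\<close> below the ball are split into
those at height comparable to \<open>r\<close> (\<open>w1\<close>), where the condition for \<open>\<nu>1\<close> can be used because \<open>\<nu>1\<close> gives their shadows
a fixed share of the ball, those with much of the shadow outside the set \<open>E\<close> of large area functional (\<open>w2\<close>), and the bad
ones (\<open>w3\<close>), to which the constant \<open>t\<close> is applied below balls of small total measure.\<close>

lemma Carleson_improvement:
  assumes G: "G \<in> borel_measurable m"
    and carleson: "Carleson \<Omega> m \<nu>1 G M"
    and K: "0 < K" "K < \<infinity>" "M \<le> \<zeta> * K"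
    and absolutely: "\<And>x r X E. x \<in> frontier \<Omega> \<Longrightarrow> 0 < r \<Longrightarrow> X \<in> \<Omega> \<Longrightarrow> 2 * r \<le> dist X x \<Longrightarrow>
      E \<in> sets borel \<Longrightarrow> E \<subseteq> ball x r \<Longrightarrow> emeasure (\<nu>1 X) E \<le> \<zeta> * emeasure (\<nu>1 X) (ball x r) \<Longrightarrow>
      4 * C ^ 10 * emeasure (\<nu>0 X) E \<le> emeasure (\<nu>0 X) (ball x r)"
    and t: "\<And>x r X. x \<in> frontier \<Omega> \<Longrightarrow> 0 < r \<Longrightarrow> X \<in> \<Omega> \<Longrightarrow> 8192 * r \<le> dist X x \<Longrightarrow>
      tent_integral \<Omega> m (\<nu>0 X) (ball x r) r G \<le> t * emeasure (\<nu>0 X) (ball x r)"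
    and x: "x \<in> frontier \<Omega>" "0 < r" and X: "X \<in> \<Omega>" "8192 * r \<le> dist X x"
  shows "2 * tent_integral \<Omega> m (\<nu>0 X) (ball x r) r G
    \<le> (2 * ((C ^ 11 * M + 2 * K) * C ^ 4) + t) * emeasure (\<nu>0 X) (ball x r)"
proof -
  note sets0[measurable_cong] = F0.sets_nu[OF X(1)] F1.sets_nu[OF X(1)]
  note sf = sigma_finite_nu[OF X(1)]
  let ?\<delta> = "bdist \<Omega>" and ?B = "ball x (10 * r)"
  let ?S = "\<lambda>Z. cball Z (2 * bdist \<Omega> Z)"
  note [measurable] = G measurable_m_of_borel[OF measurable_bdist] measurable_id_m measurable_area[OF G]
  have fne: "frontier \<Omega> \<noteq> {}" using x by auto
  \<comment> \<open>the shadows of all \<open>Z\<close> that matter for \<open>ball x r\<close> are contained in \<open>?B\<close>\<close>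
  define E where "E = {y \<in> ?B. area \<Omega> m G (10 * r) y > K}"
  have E[measurable]: "E \<in> sets borel" unfolding E_def by measurable
  have shadow_meas: "(\<lambda>Z. emeasure (\<nu>0 X) (F \<inter> ?S Z)) \<in> borel_measurable m"
    "(\<lambda>Z. emeasure (\<nu>1 X) (F \<inter> ?S Z)) \<in> borel_measurable m" if "F \<in> sets borel" for F
    using that sf sets0 by (auto intro!: measurable_m_of_borel measurable_shadow_mass)
  have B_le: "emeasure (\<nu>0 X) ?B \<le> C ^ 4 * emeasure (\<nu>0 X) (ball x r)"
    by (rule F0.ball_comparison[OF x X(1)]) (use x X in auto)
  have carl1: "tent_integral \<Omega> m (\<nu>1 X) ?B (10 * r) G \<le> M * emeasure (\<nu>1 X) ?B"
  proof -
    have "tent_integral \<Omega> m (\<nu>1 X) ?B (10 * r) G = (\<integral>\<^sup>+y\<in>?B. area \<Omega> m G (10 * r) y \<partial>\<nu>1 X)"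
      unfolding tent_integral_def using sf sets0 by (subst area_fubini) auto
    also have "\<dots> \<le> M * emeasure (\<nu>1 X) ?B"
      using carleson x X by (auto simp: Carleson_def)
    finally show ?thesis .
  qed
  have E_small: "4 * C ^ 10 * emeasure (\<nu>0 X) E \<le> emeasure (\<nu>0 X) ?B"
  proof (rule absolutely[OF x(1) _ X(1)])
    have "K * emeasure (\<nu>1 X) E = (\<integral>\<^sup>+y. K * indicator E y \<partial>\<nu>1 X)"
      by (subst nn_integral_cmult_indicator) auto
    also have "\<dots> \<le> (\<integral>\<^sup>+y\<in>?B. area \<Omega> m G (10 * r) y \<partial>\<nu>1 X)"
      by (intro nn_integral_mono) (auto simp: E_def indicator_def)
    also have "\<dots> \<le> M * emeasure (\<nu>1 X) ?B"
      using carleson x X by (auto simp: Carleson_def)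
    also have "\<dots> \<le> (\<zeta> * K) * emeasure (\<nu>1 X) ?B" using K by (intro mult_right_mono) auto
    finally have "K * emeasure (\<nu>1 X) E \<le> K * (\<zeta> * emeasure (\<nu>1 X) ?B)" by (simp add: ac_simps)
    then show "emeasure (\<nu>1 X) E \<le> \<zeta> * emeasure (\<nu>1 X) ?B"
      using K by (subst (asm) ennreal_mult_le_mult_iff) auto
  qed (use x X in \<open>auto simp: E_def\<close>)
  define q where "q = emeasure (\<nu>0 X) ?B / emeasure (\<nu>1 X) ?B"
  have q: "q * emeasure (\<nu>1 X) ?B = emeasure (\<nu>0 X) ?B"
  proof -
    have "emeasure (\<nu>1 X) ?B \<noteq> 0" "emeasure (\<nu>1 X) ?B \<noteq> \<top>"
      using F1.nu_pos[OF X(1) x(1), of "10 * r"] F1.nu_finite[OF X(1), of ?B] x by auto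
    then show ?thesis unfolding q_def by (rule ennreal_divide_mult_cancel)
  qed
  have near: "dist Z x < 3 * r" "?S Z \<subseteq> ?B"
    if meets: "?\<delta> Z \<le> r" "ball x r \<inter> ?S Z \<noteq> {}" for Z
  proof -
    obtain y where y: "dist x y < r" "dist Z y \<le> 2 * ?\<delta> Z" using meets(2) by auto
    show *: "dist Z x < 3 * r" using y meets(1) dist_triangle[of Z x y] by (auto simp: dist_commute)
    show "?S Z \<subseteq> ?B"
    proof
      fix w assume "w \<in> ?S Z"
      then show "w \<in> ?B" using * meets(1) x dist_triangle[of x w Z] by (auto simp: dist_commute)
    qed
  qed
  \<comment> \<open>below height \<open>r / 100\<close> the pole is still remote for the balls of radius \<open>48 \<delta>(Z)\<close> to which the constant
    \<open>t\<close> is applied; above it, eleven doublings of the ball around the foot of \<open>Z\<close> cover \<open>?B\<close>\<close>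
  define bad where "bad Z \<longleftrightarrow> ?\<delta> Z \<le> r / 100 \<and> dist Z x < 3 * r \<and>
    \<not> emeasure (\<nu>0 X) (UNIV \<inter> ?S Z) \<le> 2 * emeasure (\<nu>0 X) ((UNIV - E) \<inter> ?S Z)" for Z
  have bad_borel[measurable]: "Measurable.pred borel bad"
    unfolding bad_def
    using measurable_shadow_mass[OF sf(1) sets0(1), of UNIV]
      measurable_shadow_mass[OF sf(1) sets0(1), of "UNIV - E"] by measurable
  have bad_meas[measurable]: "Measurable.pred m bad"
    by (rule measurable_m_of_borel[OF bad_borel])
  have bad_set: "{Z \<in> \<Omega>. bad Z} \<in> sets borel"
  proof -
    have "\<Omega> \<inter> {Z. bad Z} \<in> sets borel" using open_Omega by measurable
    then show ?thesis by (simp add: Int_def)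
  qed
  define w where "w Z = G Z * indicator {Z. ?\<delta> Z \<le> r} Z * emeasure (\<nu>0 X) (ball x r \<inter> ?S Z)" for Z
  define w1 where "w1 Z = q * C ^ 11 * (G Z * indicator {Z. ?\<delta> Z \<le> 10 * r} Z * emeasure (\<nu>1 X) (?B \<inter> ?S Z))" for Z
  define w2 where "w2 Z = 2 * (G Z * indicator {Z. ?\<delta> Z \<le> 10 * r} Z * emeasure (\<nu>0 X) ((?B - E) \<inter> ?S Z))" for Z
  define w3 where "w3 Z = G Z * emeasure (\<nu>0 X) (UNIV \<inter> ?S Z) * indicator {Z. bad Z} Z" for Z
  have ind: "(\<lambda>Z. indicator {Z. ?\<delta> Z \<le> s} Z :: ennreal) \<in> borel_measurable m" for s
    by measurable
  have indbad: "(\<lambda>Z. indicator {Z. bad Z} Z :: ennreal) \<in> borel_measurable m"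
    by measurable
  have meas: "w1 \<in> borel_measurable m" "w2 \<in> borel_measurable m" "w3 \<in> borel_measurable m"
    unfolding w1_def w2_def w3_def
    by (intro borel_measurable_times_ennreal borel_measurable_const G ind indbad shadow_meas; auto)+
  have split: "w Z \<le> w1 Z + w2 Z + w3 Z" if Z: "Z \<in> \<Omega>" for Z
  proof (cases "?\<delta> Z \<le> r \<and> ball x r \<inter> ?S Z \<noteq> {}")
    case False
    then show ?thesis by (auto simp: w_def)
  next
    case True
    note nearZ = near[OF conjunct1[OF True] conjunct2[OF True]]
    have dpos: "0 < ?\<delta> Z" by (rule bdist_pos[OF open_Omega fne Z])
    have le10: "?\<delta> Z \<le> 10 * r" using True x by auto
    show ?thesis
    proof (cases "?\<delta> Z > r / 100")
      case far: True
      obtain z where z: "z \<in> frontier \<Omega>" "dist z Z = ?\<delta> Z" using exists_foot[OF fne] by blast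
      have zx: "dist z x < 4 * r" using z nearZ True dist_triangle[of z x Z] by linarith
      have "emeasure (\<nu>0 X) (ball x r \<inter> ?S Z) \<le> emeasure (\<nu>0 X) ?B"
        using x by (intro F0.nu_mono[OF X(1)]) auto
      also have "\<dots> = q * emeasure (\<nu>1 X) ?B" by (simp add: q)
      also have "emeasure (\<nu>1 X) ?B \<le> C ^ 11 * emeasure (\<nu>1 X) (ball z (?\<delta> Z))"
      proof (rule F1.ball_comparison[OF z(1) dpos X(1)])
        show "2 * (2 ^ 11 * ?\<delta> Z) \<le> dist X z"
          using True X(2) zx dist_triangle[of X x z] x by (auto simp: dist_commute)
        show "?B \<subseteq> ball z (2 ^ 11 * ?\<delta> Z)"
          using far zx x by (intro ball_subset_ball_iff[THEN iffD2] disjI1) (auto simp: dist_commute)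
      qed
      also have "emeasure (\<nu>1 X) (ball z (?\<delta> Z)) \<le> emeasure (\<nu>1 X) (?B \<inter> ?S Z)"
      proof (rule F1.nu_mono[OF X(1)])
        have "ball z (?\<delta> Z) \<subseteq> ?S Z"
        proof
          fix u assume "u \<in> ball z (?\<delta> Z)"
          then show "u \<in> ?S Z" using z(2) dist_triangle[of Z u z] by (auto simp: dist_commute)
        qed
        then show "ball z (?\<delta> Z) \<subseteq> ?B \<inter> ?S Z" using nearZ by auto
      qed auto
      finally have "emeasure (\<nu>0 X) (ball x r \<inter> ?S Z) \<le> q * (C ^ 11 * emeasure (\<nu>1 X) (?B \<inter> ?S Z))"
        by (simp add: mult_left_mono)
      then have "w Z \<le> G Z * (q * (C ^ 11 * emeasure (\<nu>1 X) (?B \<inter> ?S Z)))"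
        using True by (auto simp: w_def intro: mult_left_mono)
      also have "\<dots> = w1 Z" using le10 by (simp add: w1_def ac_simps)
      finally show ?thesis by (simp add: add.assoc add_increasing2)
    next
      case small: False
      show ?thesis
      proof (cases "bad Z")
        case True
        have "emeasure (\<nu>0 X) (ball x r \<inter> ?S Z) \<le> emeasure (\<nu>0 X) (UNIV \<inter> ?S Z)"
          by (intro F0.nu_mono[OF X(1)]) auto
        then have "w Z \<le> w3 Z"
          using True by (auto simp: w_def w3_def indicator_def intro: mult_left_mono)
        then show ?thesis by (simp add: add_increasing)
      next
        case good: False
        have "emeasure (\<nu>0 X) (ball x r \<inter> ?S Z) \<le> emeasure (\<nu>0 X) (UNIV \<inter> ?S Z)"
          by (intro F0.nu_mono[OF X(1)]) auto
        also have "\<dots> \<le> 2 * emeasure (\<nu>0 X) ((UNIV - E) \<inter> ?S Z)"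
          using good small nearZ by (auto simp: bad_def)
        also have "(UNIV - E) \<inter> ?S Z = (?B - E) \<inter> ?S Z" using nearZ by auto
        finally have "w Z \<le> G Z * (2 * emeasure (\<nu>0 X) ((?B - E) \<inter> ?S Z))"
          by (auto simp: w_def indicator_def intro: mult_left_mono)
        also have "\<dots> = w2 Z" using le10 by (simp add: w2_def ac_simps)
        finally show ?thesis by (simp add: add_increasing add_increasing2)
      qed
    qed
  qed
  have "tent_integral \<Omega> m (\<nu>0 X) (ball x r) r G = integral\<^sup>N m w"
    by (simp add: tent_integral_def w_def[abs_def])
  also have "\<dots> \<le> (\<integral>\<^sup>+Z. w1 Z + w2 Z + w3 Z \<partial>m)"
    using split by (rule nn_integral_mono_m)
  also have "\<dots> = integral\<^sup>N m w1 + integral\<^sup>N m w2 + integral\<^sup>N m w3"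
    using meas by (simp add: nn_integral_add)
  finally have total: "tent_integral \<Omega> m (\<nu>0 X) (ball x r) r G
    \<le> integral\<^sup>N m w1 + integral\<^sup>N m w2 + integral\<^sup>N m w3" .
  have I1: "integral\<^sup>N m w1 \<le> C ^ 11 * M * emeasure (\<nu>0 X) ?B"
  proof -
    have "integral\<^sup>N m w1 = q * C ^ 11 * tent_integral \<Omega> m (\<nu>1 X) ?B (10 * r) G"
      unfolding w1_def tent_integral_def 
      by (intro nn_integral_cmult borel_measurable_times_ennreal G ind shadow_meas) auto
    also have "\<dots> \<le> q * C ^ 11 * (M * emeasure (\<nu>1 X) ?B)"
      using carl1 by (rule mult_left_mono) simp
    also have "\<dots> = C ^ 11 * M * (q * emeasure (\<nu>1 X) ?B)" by (simp add: ac_simps)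
    finally show ?thesis by (simp add: q)
  qed
  have I2: "integral\<^sup>N m w2 \<le> 2 * K * emeasure (\<nu>0 X) ?B"
  proof -
    have "integral\<^sup>N m w2 = 2 * tent_integral \<Omega> m (\<nu>0 X) (?B - E) (10 * r) G"
      unfolding w2_def tent_integral_def 
      by (intro nn_integral_cmult borel_measurable_times_ennreal G ind shadow_meas) auto
    also have "tent_integral \<Omega> m (\<nu>0 X) (?B - E) (10 * r) G = (\<integral>\<^sup>+y\<in>?B - E. area \<Omega> m G (10 * r) y \<partial>\<nu>0 X)"
      unfolding tent_integral_def using sf sets0 by (subst area_fubini) auto
    also have "\<dots> \<le> (\<integral>\<^sup>+y. K * indicator ?B y \<partial>\<nu>0 X)"
      by (intro nn_integral_mono) (auto simp: E_def indicator_def)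
    also have "\<dots> = K * emeasure (\<nu>0 X) ?B" by (subst nn_integral_cmult_indicator) auto
    finally show ?thesis by (simp add: mult_left_mono mult.assoc)
  qed
  have I3: "integral\<^sup>N m w3 \<le> (2 * t * C ^ 6) * emeasure (\<nu>0 X) E"
  proof -
    \<comment> \<open>Vitali's lemma compares the mass \<open>\<mu>\<close> of the bad points in \<open>\<Omega>\<close> with the part of \<open>\<nu>0\<close> inside \<open>E\<close>: disjoint
      balls of radius \<open>3 \<delta>(Z)\<close> have disjoint shadows, and \<open>E\<close> fills at least half of each\<close>
    define \<mu> where "\<mu> = distr (density m w3) borel (\<lambda>Z. Z)"
    have mu: "emeasure \<mu> F = (\<integral>\<^sup>+Z\<in>F. w3 Z \<partial>m)" if "F \<in> sets borel" for F
      unfolding \<mu>_def by (rule emeasure_image_measure[OF meas(3) that])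
    define \<eta> where "\<eta> = density (\<nu>0 X) (indicator E)"
    have eta: "emeasure \<eta> F = emeasure (\<nu>0 X) (F \<inter> E)" if "F \<in> sets borel" for F
      unfolding \<eta>_def by (rule F0.emeasure_restricted_nu[OF X(1) E that])
    have "integral\<^sup>N m w3 = (\<integral>\<^sup>+Z\<in>{Z\<in>\<Omega>. bad Z}. w3 Z \<partial>m)"
      by (intro nn_integral_cong_m) (auto simp: w3_def indicator_def)
    also have "\<dots> = emeasure \<mu> {Z\<in>\<Omega>. bad Z}" by (rule mu[OF bad_set, symmetric])
    also have "\<dots> \<le> (2 * t * C ^ 6) * emeasure \<eta> UNIV"
    proof (rule vitali_measure_comparison[where a = "\<lambda>Z. Z" and r = "\<lambda>Z. 3 * ?\<delta> Z" and R = "3 * r"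
          and I = "{Z\<in>\<Omega>. bad Z}"])
      show "{Z \<in> \<Omega>. bad Z} \<subseteq> (\<Union>Z\<in>{Z \<in> \<Omega>. bad Z}. ball Z (3 * ?\<delta> Z))"
        using bdist_pos[OF open_Omega fne] by force
      fix Z assume "Z \<in> {Z\<in>\<Omega>. bad Z}"
      then have Z: "Z \<in> \<Omega>" "bad Z" by auto
      have dpos: "0 < ?\<delta> Z" by (rule bdist_pos[OF open_Omega fne Z(1)])
      have Z': "?\<delta> Z \<le> r / 100" "dist Z x < 3 * r" using Z(2) by (auto simp: bad_def)
      show "0 < 3 * ?\<delta> Z \<and> 3 * ?\<delta> Z \<le> 3 * r" using dpos Z' x by auto
      obtain z where z: "z \<in> frontier \<Omega>" "dist z Z = ?\<delta> Z" using exists_foot[OF fne] by blast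
      have Xz: "8188 * r \<le> dist X z"
        using X(2) Z' z x dist_triangle[of X x z] dist_triangle[of x z Z] by (auto simp: dist_commute)
      have "emeasure \<mu> (ball Z (5 * (3 * ?\<delta> Z))) = (\<integral>\<^sup>+Z'\<in>ball Z (15 * ?\<delta> Z). w3 Z' \<partial>m)"
        by (subst mu) auto
      also have "\<dots> \<le> tent_integral \<Omega> m (\<nu>0 X) (ball z (48 * ?\<delta> Z)) (48 * ?\<delta> Z) G"
        unfolding tent_integral_def
      proof (rule nn_integral_mono_m)
        fix Z' assume "Z' \<in> \<Omega>"
        show "w3 Z' * indicator (ball Z (15 * ?\<delta> Z)) Z'
          \<le> G Z' * indicator {Z'. ?\<delta> Z' \<le> 48 * ?\<delta> Z} Z' * emeasure (\<nu>0 X) (ball z (48 * ?\<delta> Z) \<inter> ?S Z')"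
        proof (cases "dist Z Z' < 15 * ?\<delta> Z")
          case True
          have d: "?\<delta> Z' < 16 * ?\<delta> Z" using True bdist_lipschitz[of \<Omega> Z Z'] by linarith
          have "?S Z' \<subseteq> ball z (48 * ?\<delta> Z)"
          proof
            fix u assume "u \<in> ?S Z'"
            then have "dist Z' u \<le> 2 * ?\<delta> Z'" by simp
            then have "dist z u < 48 * ?\<delta> Z"
              using d True z(2) dist_triangle[of z u Z] dist_triangle[of Z u Z'] by linarith
            then show "u \<in> ball z (48 * ?\<delta> Z)" by simp
          qed
          then have "ball z (48 * ?\<delta> Z) \<inter> ?S Z' = UNIV \<inter> ?S Z'" by auto
          then show ?thesis using True d dpos
            by (auto simp: w3_def indicator_def)
        qed simp
      qed
      also have "\<dots> \<le> t * emeasure (\<nu>0 X) (ball z (48 * ?\<delta> Z))"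
        by (rule t[OF z(1) _ X(1)]) (use dpos Xz Z' x in auto)
      also have "emeasure (\<nu>0 X) (ball z (48 * ?\<delta> Z)) \<le> C ^ 6 * emeasure (\<nu>0 X) (ball z (?\<delta> Z))"
        by (rule F0.ball_comparison[OF z(1) dpos X(1)]) (use dpos Xz Z' x in auto)
      also have "emeasure (\<nu>0 X) (ball z (?\<delta> Z)) \<le> emeasure (\<nu>0 X) (UNIV \<inter> ?S Z)"
      proof (rule F0.nu_mono[OF X(1)])
        show "ball z (?\<delta> Z) \<subseteq> UNIV \<inter> ?S Z"
        proof
          fix u assume "u \<in> ball z (?\<delta> Z)"
          then show "u \<in> UNIV \<inter> ?S Z" using z(2) dist_triangle[of Z u z] by (auto simp: dist_commute)
        qed
      qed auto
      also have "emeasure (\<nu>0 X) (UNIV \<inter> ?S Z) \<le> 2 * emeasure (\<nu>0 X) (?S Z \<inter> E)"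
      proof -
        let ?a = "emeasure (\<nu>0 X) (?S Z \<inter> E)" and ?b = "emeasure (\<nu>0 X) ((UNIV - E) \<inter> ?S Z)"
        have sum: "emeasure (\<nu>0 X) (UNIV \<inter> ?S Z) = ?a + ?b"
          by (subst plus_emeasure) (auto intro!: arg_cong[where f = "emeasure (\<nu>0 X)"])
        have lt: "2 * ?b < ?a + ?b" using Z(2) unfolding bad_def sum not_le by blast
        have "?b \<le> ?a"
        proof (rule ccontr)
          assume "\<not> ?b \<le> ?a"
          then have "?a + ?b \<le> ?b + ?b" by (intro add_right_mono) simp
          with lt show False unfolding mult_2[of ?b] by (simp add: leD)
        qed
        then show ?thesis unfolding sum mult_2[of ?a] by (rule add_left_mono)
      qed
      also have "emeasure (\<nu>0 X) (?S Z \<inter> E) \<le> emeasure \<eta> (ball Z (3 * ?\<delta> Z))"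
        unfolding eta[OF borel_open[OF open_ball]] using dpos by (intro F0.nu_mono[OF X(1)]) auto
      finally have "emeasure \<mu> (ball Z (5 * (3 * ?\<delta> Z)))
          \<le> t * (C ^ 6 * (2 * emeasure \<eta> (ball Z (3 * ?\<delta> Z))))"
        by (simp add: mult_left_mono)
      then show "emeasure \<mu> (ball Z (5 * (3 * ?\<delta> Z))) \<le> (2 * t * C ^ 6) * emeasure \<eta> (ball Z (3 * ?\<delta> Z))"
        by (simp add: ac_simps)
    qed (auto simp: \<mu>_def \<eta>_def sets0)
    also have "emeasure \<eta> UNIV = emeasure (\<nu>0 X) E" using eta[of UNIV] by simp
    finally show ?thesis .
  qed
  let ?b = "emeasure (\<nu>0 X) (ball x r)"
  have I3': "2 * integral\<^sup>N m w3 \<le> t * ?b"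
  proof -
    have "C ^ 4 * (2 * integral\<^sup>N m w3) \<le> C ^ 4 * (2 * ((2 * t * C ^ 6) * emeasure (\<nu>0 X) E))"
      by (intro mult_left_mono I3) auto
    also have "\<dots> = t * (4 * C ^ 10 * emeasure (\<nu>0 X) E)"
      by (simp add: ac_simps power_numeral_reduce)
    also have "\<dots> \<le> t * (C ^ 4 * ?b)"
      using order_trans[OF E_small B_le] by (rule mult_left_mono) simp
    finally have "C ^ 4 * (2 * integral\<^sup>N m w3) \<le> C ^ 4 * (t * ?b)" by (simp add: ac_simps)
    then show ?thesis
      using F0.C_power_ge[of 4] F0.C_power_finite[of 4]
      by (subst (asm) ennreal_mult_le_mult_iff) auto
  qed
  have "2 * tent_integral \<Omega> m (\<nu>0 X) (ball x r) r G
     \<le> 2 * (C ^ 11 * M * emeasure (\<nu>0 X) ?B + 2 * K * emeasure (\<nu>0 X) ?B + integral\<^sup>N m w3)"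
    by (intro mult_left_mono order_trans[OF total] add_mono I1 I2) auto
  also have "\<dots> = 2 * ((C ^ 11 * M + 2 * K) * emeasure (\<nu>0 X) ?B) + 2 * integral\<^sup>N m w3"
    by (simp only: distrib_left distrib_right)
  also have "\<dots> \<le> 2 * ((C ^ 11 * M + 2 * K) * (C ^ 4 * ?b)) + t * ?b"
    by (intro add_mono mult_left_mono B_le I3' order_refl) auto
  also have "\<dots> = (2 * ((C ^ 11 * M + 2 * K) * C ^ 4) + t) * ?b"
    by (simp only: distrib_right mult.assoc)
  finally show ?thesis .
qed

end

text \<open>Closes the iteration of the previous lemma: after finitely many halvings the initial constant \<open>T\<close> falls below \<open>1\<close>.\<close>

lemma ennreal_mult_right_limit_bound:
  assumes "\<And>n::nat. a \<le> (k + ennreal (T / 2 ^ n)) * b" "0 \<le> T"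
  shows "a \<le> (k + 1) * b"
proof -
  obtain n :: nat where "T < 2 ^ n" using real_arch_pow[of 2 T] by auto
  then have "ennreal (T / 2 ^ n) \<le> 1"
    using assms(2) by (simp add: ennreal_le_1 divide_simps)
  then show ?thesis
    using order_trans[OF assms(1)[of n]] by (meson add_left_mono mult_right_mono zero_le)
qed

context two_families
begin

text \<open>The improvement step is iterated for bounded truncations of \<open>G\<close>, for which some constant is available to start
with.  The bound obtained does not depend on the truncation and survives the limit.\<close>

lemma Carleson_remote_pole:
  assumes G: "G \<in> borel_measurable m"
    and carleson: "Carleson \<Omega> m \<nu>1 G M"
    and K: "0 < K" "K < \<infinity>" "M \<le> \<zeta> * K"
    and absolutely: "\<And>x r X E. x \<in> frontier \<Omega> \<Longrightarrow> 0 < r \<Longrightarrow> X \<in> \<Omega> \<Longrightarrow> 2 * r \<le> dist X x \<Longrightarrow>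
      E \<in> sets borel \<Longrightarrow> E \<subseteq> ball x r \<Longrightarrow> emeasure (\<nu>1 X) E \<le> \<zeta> * emeasure (\<nu>1 X) (ball x r) \<Longrightarrow>
      4 * C ^ 10 * emeasure (\<nu>0 X) E \<le> emeasure (\<nu>0 X) (ball x r)"
    and x: "x \<in> frontier \<Omega>" "0 < r" and X: "X \<in> \<Omega>" "8192 * r \<le> dist X x"
  shows "tent_integral \<Omega> m (\<nu>0 X) (ball x r) r G
    \<le> (2 * ((C ^ 11 * M + 2 * K) * C ^ 4) + 1) * emeasure (\<nu>0 X) (ball x r)"
proof (rule tent_integral_truncation_limit[OF G sigma_finite_nu(1)[OF X(1)] F0.sets_nu[OF X(1)]])
  fix j :: nat
  define H where "H = (\<lambda>Z. min (G Z) (of_nat j) * indicator (ball 0 (real j)) Z)"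
  define K1 where "K1 = (C ^ 11 * M + 2 * K) * C ^ 4"
  have H: "H \<in> borel_measurable m"
    unfolding H_def
    by (intro borel_measurable_times_ennreal borel_measurable_min G borel_measurable_const
        measurable_m_of_borel[OF borel_measurable_indicator]) auto
  have HG: "H Z \<le> G Z" for Z by (auto simp: H_def indicator_def)
  define T where "T = enn2real (integral\<^sup>N m H)"
  have T: "integral\<^sup>N m H = ennreal T" "0 \<le> T"
    using truncation_integral_finite[of G j] by (auto simp: T_def H_def ennreal_enn2real_if less_top)
  have "tent_integral \<Omega> m (\<nu>0 X) (ball x r) r H \<le> (2 * K1 + ennreal (T / 2 ^ n)) * emeasure (\<nu>0 X) (ball x r)"
    if "x \<in> frontier \<Omega>" "0 < r" "X \<in> \<Omega>" "8192 * r \<le> dist X x" for n x r X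
    using that
  proof (induction n arbitrary: x r X)
    case 0
    have "tent_integral \<Omega> m (\<nu>0 X) (ball x r) r H \<le> ennreal T * emeasure (\<nu>0 X) (ball x r)"
      using tent_integral_le_mass[OF F0.sets_nu[OF 0(3)] _ H, of "ball x r" r] T by simp
    also have "\<dots> \<le> (2 * K1 + ennreal T) * emeasure (\<nu>0 X) (ball x r)"
      by (intro mult_right_mono) auto
    finally show ?case by simp
  next
    case (Suc n)
    let ?s = "ennreal (T / 2 ^ Suc n)"
    have s2: "ennreal (T / 2 ^ n) = 2 * ?s"
      using T(2) ennreal_mult[of 2 "T / 2 ^ Suc n"] by simp
    have "2 * tent_integral \<Omega> m (\<nu>0 X) (ball x r) r H
      \<le> (2 * K1 + (2 * K1 + ennreal (T / 2 ^ n))) * emeasure (\<nu>0 X) (ball x r)"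
      unfolding K1_def
      by (rule Carleson_improvement[OF H Carleson_mono[OF carleson HG] K absolutely Suc.IH[unfolded K1_def] Suc.prems])
    also have "\<dots> = 2 * ((2 * K1 + ?s) * emeasure (\<nu>0 X) (ball x r))"
      unfolding s2 by (simp only: mult_2 distrib_left distrib_right add.assoc add.commute add.left_commute)
    finally show ?case by (subst (asm) ennreal_mult_le_mult_iff) auto
  qed
  from this[OF x X] show "tent_integral \<Omega> m (\<nu>0 X) (ball x r) r H
      \<le> (2 * K1 + 1) * emeasure (\<nu>0 X) (ball x r)"
    using T(2) by (rule ennreal_mult_right_limit_bound)
qed auto

end

section \<open>Carleson conditions for all poles\<close>

text \<open>Let \<open>z\<close> be a boundary point nearest to \<open>Z\<close> and suppose that \<open>\<Omega>\<close> has no point at distance \<open>2 \<delta>(Z)\<close> from \<open>z\<close>.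
Then the antipode \<open>2 Z - z\<close> is outside \<open>\<Omega>\<close>, hence a boundary point nearest to \<open>Z\<close> as well.  If it admits no
pole either, then \<open>\<Omega>\<close> lies in the intersection of two balls of radius \<open>2 \<delta>(Z)\<close> around antipodal points, and the
parallelogram law places \<open>\<Omega>\<close> inside the shadow ball of \<open>Z\<close>.\<close>

lemma pole_or_whole_boundary_in_shadow:
  fixes \<Omega> :: "(real ^ 'n) set"
  assumes "open \<Omega>" "frontier \<Omega> \<noteq> {}" "Z \<in> \<Omega>"
    and outside: "\<not> frontier \<Omega> \<subseteq> cball Z (2 * bdist \<Omega> Z)"
  obtains z X where "z \<in> frontier \<Omega>" "dist z Z = bdist \<Omega> Z" "X \<in> \<Omega>" "2 * bdist \<Omega> Z \<le> dist X z"
proof -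
  note found = that
  let ?d = "bdist \<Omega> Z"
  have d: "0 < ?d" by (rule bdist_pos[OF assms(1-3)])
  obtain z where z: "z \<in> frontier \<Omega>" "dist z Z = ?d" using exists_foot[OF assms(2)] by blast
  show thesis
  proof (rule ccontr)
    assume contr: "\<not> thesis"
    have in_z: "dist X z < 2 * ?d" if "X \<in> \<Omega>" for X
      using contr z found[OF z that] by (cases "2 * ?d \<le> dist X z") auto
    define z' where "z' = 2 *\<^sub>R Z - z"
    have z'Z: "dist z' Z = ?d" and z'z: "dist z' z = 2 * ?d"
    proof -
      have "z' - Z = Z - z" by (simp add: z'_def scaleR_2)
      then show "dist z' Z = ?d" using z by (simp add: dist_norm norm_minus_commute)
      have "z' - z = 2 *\<^sub>R (Z - z)" by (simp add: z'_def algebra_simps scaleR_2)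
      then have "dist z' z = 2 * norm (Z - z)" by (simp add: dist_norm)
      then show "dist z' z = 2 * ?d" using z by (simp add: dist_norm norm_minus_commute)
    qed
    have "z' \<notin> \<Omega>" using in_z[of z'] z'z by auto
    have "closed_segment Z z' \<inter> frontier \<Omega> \<noteq> {}"
      by (rule connected_Int_frontier) (use \<open>z' \<notin> \<Omega>\<close> assms(3) in auto)
    then obtain u where u: "u \<in> closed_segment Z z'" "u \<in> frontier \<Omega>" by auto
    have "dist Z u + dist u z' = dist Z z'" using u(1) between_mem_segment between by metis
    moreover have "?d \<le> dist Z u" using bdist_le[OF u(2)] .
    ultimately have "dist u z' \<le> 0" using z'Z unfolding dist_commute[of z' Z] by linarith
    then have "u = z'" by simp
    then have z': "z' \<in> frontier \<Omega>" using u by simp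
    have in_z': "dist X z' < 2 * ?d" if "X \<in> \<Omega>" for X
      using contr found[OF z' z'Z that] by (cases "2 * ?d \<le> dist X z'") auto
    have "dist Z X \<le> 2 * ?d" if X: "X \<in> \<Omega>" for X
    proof -
      have "(norm (X - z))\<^sup>2 + (norm (X - z'))\<^sup>2 = 2 * (norm (X - Z))\<^sup>2 + 2 * (norm (Z - z))\<^sup>2"
      proof -
        have par: "(norm (a + b))\<^sup>2 + (norm (a - b))\<^sup>2 = 2 * (norm a)\<^sup>2 + 2 * (norm b)\<^sup>2"
          for a b :: "real ^ 'n"
          by (simp add: power2_norm_eq_inner inner_simps inner_commute)
        have "X - z = (X - Z) + (Z - z)" "X - z' = (X - Z) - (Z - z)"
          by (simp_all add: z'_def scaleR_2)
        then show ?thesis using par[of "X - Z" "Z - z"] by metis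
      qed
      moreover have "(norm (X - z))\<^sup>2 \<le> (2 * ?d)\<^sup>2" "(norm (X - z'))\<^sup>2 \<le> (2 * ?d)\<^sup>2"
        using in_z[OF X] in_z'[OF X] by (intro power_mono; simp add: dist_norm)+
      moreover have "0 \<le> (norm (Z - z))\<^sup>2" by simp
      ultimately have "(norm (X - Z))\<^sup>2 \<le> (2 * ?d)\<^sup>2" by linarith
      then have "norm (X - Z) \<le> 2 * ?d" by (rule power2_le_imp_le) (use d in simp)
      then show ?thesis by (simp add: dist_norm norm_minus_commute)
    qed
    then have "\<Omega> \<subseteq> cball Z (2 * ?d)" by auto
    then have "closure \<Omega> \<subseteq> cball Z (2 * ?d)" by (rule closure_minimal) simp
    then show False using outside by (auto simp: frontier_def)
  qed
qed

text \<open>The supremum of \<open>\<delta>\<close> on \<open>Q\<close> need not be attained, so \<open>Q\<close> is exhausted by sublevel sets.\<close>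

lemma emeasure_le_of_sublevels:
  fixes \<delta> :: "'a \<Rightarrow> real"
  assumes Q: "Q \<in> sets M" and \<delta>: "\<delta> \<in> borel_measurable M" and bdd: "bdd_above (\<delta> ` Q)"
    and bound: "\<And>Z0. Z0 \<in> Q \<Longrightarrow> emeasure M {Z \<in> Q. \<delta> Z \<le> \<delta> Z0} \<le> b"
  shows "emeasure M Q \<le> b"
proof (cases "Q = {}")
  case False
  define s where "s = (SUP Z\<in>Q. \<delta> Z)"
  have le_s: "\<delta> Z \<le> s" if "Z \<in> Q" for Z using that bdd by (auto simp: s_def intro: cSUP_upper)
  show ?thesis
  proof (cases "s \<in> \<delta> ` Q")
    case True
    then obtain Z0 where "Z0 \<in> Q" "\<delta> Z0 = s" by auto
    then show ?thesis using bound[of Z0] le_s by (metis (mono_tags, lifting) Collect_cong Collect_mem_eq)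
  next
    case no_max: False
    define Qn where "Qn n = {Z \<in> Q. \<delta> Z \<le> s - 1 / real (Suc n)}" for n
    have Qn_sets: "Qn n \<in> sets M" for n
    proof -
      have "{Z \<in> space M. \<delta> Z \<le> s - 1 / real (Suc n)} \<in> sets M" using \<delta> by measurable
      moreover have "Qn n = Q \<inter> {Z \<in> space M. \<delta> Z \<le> s - 1 / real (Suc n)}"
        using sets.sets_into_space[OF Q] by (auto simp: Qn_def)
      ultimately show ?thesis using Q by auto
    qed
    have inc: "incseq Qn"
    proof (rule incseq_SucI)
      fix n
      have "1 / real (Suc (Suc n)) \<le> 1 / real (Suc n)" by (simp add: frac_le)
      then show "Qn n \<subseteq> Qn (Suc n)" by (auto simp: Qn_def)
    qed
    have "Q = (\<Union>n. Qn n)"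
    proof (intro equalityI subsetI)
      fix Z assume Z: "Z \<in> Q"
      then have "0 < s - \<delta> Z" using le_s[OF Z] no_max by (metis diff_gt_0_iff_gt image_eqI less_eq_real_def)
      then obtain n where "1 / real (Suc n) < s - \<delta> Z" using nat_approx_posE by metis
      then have "Z \<in> Qn n" using Z by (auto simp: Qn_def)
      then show "Z \<in> (\<Union>n. Qn n)" by auto
    qed (auto simp: Qn_def)
    moreover have "range Qn \<subseteq> sets M" using Qn_sets by auto
    ultimately have "emeasure M Q = (SUP n. emeasure M (Qn n))"
      using SUP_emeasure_incseq[of Qn M] inc by simp
    also have "\<dots> \<le> b"
    proof (rule SUP_least)
      fix n
      have "\<exists>y\<in>\<delta> ` Q. s - 1 / real (Suc n) < y"
        using False bdd unfolding s_def by (subst less_cSUP_iff[symmetric, unfolded image_image, simplified]) auto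
      then obtain Z0 where Z0: "Z0 \<in> Q" "s - 1 / real (Suc n) < \<delta> Z0" by auto
      have "emeasure M (Qn n) \<le> emeasure M {Z \<in> Q. \<delta> Z \<le> \<delta> Z0}"
      proof (rule emeasure_mono)
        have "{Z \<in> space M. \<delta> Z \<le> \<delta> Z0} \<in> sets M" using \<delta> by measurable
        moreover have "{Z \<in> Q. \<delta> Z \<le> \<delta> Z0} = Q \<inter> {Z \<in> space M. \<delta> Z \<le> \<delta> Z0}"
          using sets.sets_into_space[OF Q] by auto
        ultimately show "{Z \<in> Q. \<delta> Z \<le> \<delta> Z0} \<in> sets M" using Q by auto
      qed (use Z0 in \<open>auto simp: Qn_def\<close>)
      also have "\<dots> \<le> b" by (rule bound[OF Z0(1)])
      finally show "emeasure M (Qn n) \<le> b" .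
    qed
    finally show ?thesis .
  qed
qed simp

context two_families
begin

text \<open>The Carleson condition at height \<open>\<delta>(Z0)\<close> controls only the points not higher than \<open>Z0\<close>.  No larger radius can be
used, since the pole supplied by the dichotomy may be at distance exactly \<open>2 \<delta>(Z0)\<close>.  This is why the
bound is shown for sublevel sets first.\<close>

lemma local_mass_bound:
  assumes G: "G \<in> borel_measurable m"
    and carleson: "Carleson \<Omega> m \<nu>1 G M"
    and Z: "Z \<in> \<Omega>" and s: "0 < s"
    and \<beta>: "Measurable.pred borel \<beta>"
    and big: "\<And>Z'. \<beta> Z' \<Longrightarrow> 80 * s \<le> bdist \<Omega> Z'"
    and bounded: "\<And>Z'. \<beta> Z' \<Longrightarrow> bdist \<Omega> Z' \<le> R"
    and not_all: "\<And>Z'. \<beta> Z' \<Longrightarrow> \<not> frontier \<Omega> \<subseteq> cball Z' (2 * bdist \<Omega> Z')"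
  shows "(\<integral>\<^sup>+Z'\<in>ball Z (5 * s). G Z' * indicator {Z'. \<beta> Z'} Z' \<partial>m) \<le> C * M"
proof -
  let ?\<delta> = "bdist \<Omega>"
  note [measurable] = \<beta> measurable_id_m
  define Q where "Q = ({Z'. \<beta> Z'} \<inter> ball Z (5 * s)) \<inter> \<Omega>"
  have Q: "Q \<in> sets m" unfolding Q_def by (rule borel_Int_sets_m) measurable
  have "(\<integral>\<^sup>+Z'\<in>ball Z (5 * s). G Z' * indicator {Z'. \<beta> Z'} Z' \<partial>m) = (\<integral>\<^sup>+Z'\<in>Q. G Z' \<partial>m)"
    by (intro nn_integral_cong_m) (auto simp: Q_def indicator_def)
  also have "\<dots> = emeasure (density m G) Q" by (rule emeasure_density[OF G Q, symmetric])
  also have "\<dots> \<le> C * M"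
  proof (rule emeasure_le_of_sublevels[where \<delta> = ?\<delta>])
    show "Q \<in> sets (density m G)" using Q by simp
    show "?\<delta> \<in> borel_measurable (density m G)"
      using measurable_m_of_borel[OF measurable_bdist] by simp
    show "bdd_above (?\<delta> ` Q)" using bounded by (auto simp: bdd_above_def Q_def)
    fix Z0 assume Z0Q: "Z0 \<in> Q"
    then have Z0: "Z0 \<in> \<Omega>" "\<beta> Z0" "dist Z Z0 < 5 * s" by (auto simp: Q_def)
    let ?d = "?\<delta> Z0"
    have fne: "frontier \<Omega> \<noteq> {}" using not_all[OF Z0(2)] by auto
    have d: "0 < ?d" by (rule bdist_pos[OF open_Omega fne Z0(1)])
    obtain z X where z: "z \<in> frontier \<Omega>" "dist z Z0 = ?d" and X: "X \<in> \<Omega>" "2 * ?d \<le> dist X z"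
      using pole_or_whole_boundary_in_shadow[OF open_Omega fne Z0(1) not_all[OF Z0(2)]] by blast
    define Q' where "Q' = {Z' \<in> Q. ?\<delta> Z' \<le> ?d}"
    have Q': "Q' \<in> sets m"
    proof -
      have "Q' = Q \<inter> ({Z'. ?\<delta> Z' \<le> ?d} \<inter> \<Omega>)" by (auto simp: Q'_def Q_def)
      moreover have "{Z'. ?\<delta> Z' \<le> ?d} \<inter> \<Omega> \<in> sets m" by (rule borel_Int_sets_m) measurable
      ultimately show ?thesis using Q by auto
    qed
    let ?b = "emeasure (\<nu>1 X) (ball z (?d / 2))"
    have shadow: "ball z (?d / 2) \<subseteq> ball z ?d \<inter> cball Z' (2 * ?\<delta> Z')" if Z': "Z' \<in> Q'" for Z'
    proof
      have near: "dist Z0 Z' < 10 * s"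
        using Z' Z0(3) dist_triangle[of Z0 Z' Z] by (auto simp: Q'_def Q_def dist_commute)
      have s8: "10 * s \<le> ?d / 8" using big[OF Z0(2)] by simp
      have low: "7 / 8 * ?d \<le> ?\<delta> Z'" using bdist_lipschitz[of \<Omega> Z0 Z'] near s8 by linarith
      fix u assume u: "u \<in> ball z (?d / 2)"
      have "dist Z' u \<le> dist Z0 Z' + dist z Z0 + dist z u"
        using dist_triangle[of Z' u Z0] dist_triangle[of Z0 u z] by (simp add: dist_commute)
      then show "u \<in> ball z ?d \<inter> cball Z' (2 * ?\<delta> Z')" using near s8 low z(2) u d by simp
    qed
    have "emeasure (density m G) Q' * ?b = (\<integral>\<^sup>+Z'\<in>Q'. G Z' \<partial>m) * ?b"
      using emeasure_density[OF G Q'] by simp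
    also have "\<dots> = (\<integral>\<^sup>+Z'. G Z' * indicator Q' Z' * ?b \<partial>m)"
      using G Q' by (intro nn_integral_multc[symmetric]) auto
    also have "\<dots> \<le> tent_integral \<Omega> m (\<nu>1 X) (ball z ?d) ?d G"
      unfolding tent_integral_def
    proof (rule nn_integral_mono_m)
      fix Z'
      show "G Z' * indicator Q' Z' * ?b
        \<le> G Z' * indicator {Z. ?\<delta> Z \<le> ?d} Z' * emeasure (\<nu>1 X) (ball z ?d \<inter> cball Z' (2 * ?\<delta> Z'))"
      proof (cases "Z' \<in> Q'")
        case True
        then have "?b \<le> emeasure (\<nu>1 X) (ball z ?d \<inter> cball Z' (2 * ?\<delta> Z'))"
          by (intro F1.nu_mono[OF X(1)] shadow) auto
        then show ?thesis using True by (simp add: Q'_def mult_left_mono)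
      qed simp
    qed
    also have "\<dots> = (\<integral>\<^sup>+y\<in>ball z ?d. area \<Omega> m G ?d y \<partial>\<nu>1 X)"
      unfolding tent_integral_def
      by (rule area_fubini[OF G sigma_finite_nu(2)[OF X(1)] F1.sets_nu[OF X(1)], symmetric]) simp
    also have "\<dots> \<le> M * emeasure (\<nu>1 X) (ball z ?d)"
      using carleson z X d by (auto simp: Carleson_def)
    also have "emeasure (\<nu>1 X) (ball z ?d) \<le> C * ?b"
      using F1.doubling[OF z(1), of "?d / 2" X] d X by simp
    finally have "emeasure (density m G) Q' * ?b \<le> M * (C * ?b)"
      by (simp add: mult_left_mono)
    then have "?b * emeasure (density m G) Q' \<le> ?b * (C * M)"
      by (simp add: ac_simps)
    then have "emeasure (density m G) Q' \<le> C * M"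
      using F1.nu_pos[OF X(1) z(1), of "?d / 2"] F1.nu_finite[OF X(1), of "ball z (?d / 2)"] d
      by (subst (asm) ennreal_mult_le_mult_iff) auto
    then show "emeasure (density m G) {Z' \<in> Q. ?\<delta> Z' \<le> ?d} \<le> C * M" by (simp add: Q'_def)
  qed
  finally show ?thesis .
qed

text \<open>At heights comparable to \<open>r\<close> the local bounds are summed by Vitali's lemma with \<open>m\<close> as the comparison
measure: all the small balls carry a fixed share of \<open>m(ball x (4 r))\<close>.\<close>

lemma large_scale_mass_bound:
  assumes G: "G \<in> borel_measurable m"
    and carleson: "Carleson \<Omega> m \<nu>1 G M"
    and x: "x \<in> frontier \<Omega>" "0 < r"
    and \<beta>: "Measurable.pred borel \<beta>"
    and at_scale: "\<And>Z. \<beta> Z \<Longrightarrow> r / 2 ^ 13 \<le> bdist \<Omega> Z \<and> bdist \<Omega> Z \<le> r \<and> dist Z x < 3 * r"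
    and not_all: "\<And>Z. \<beta> Z \<Longrightarrow> \<not> frontier \<Omega> \<subseteq> cball Z (2 * bdist \<Omega> Z)"
  shows "(\<integral>\<^sup>+Z. G Z * indicator {Z. \<beta> Z} Z \<partial>m) \<le> C * M * Cm ^ 23"
proof -
  define s where "s = r / 2 ^ 20"
  have s: "0 < s" using x by (simp add: s_def)
  let ?h = "\<lambda>Z. G Z * indicator {Z. \<beta> Z} Z"
  note [measurable] = \<beta> G measurable_id_m measurable_m_of_borel[OF \<beta>]
  have h: "?h \<in> borel_measurable m" by measurable
  let ?mB = "emeasure m (ball x (4 * r) \<inter> \<Omega>)"
  have xcl: "x \<in> closure \<Omega>" using x by (simp add: frontier_def)
  have mB: "?mB \<noteq> 0" "?mB \<noteq> \<top>"
    using m_ball_pos[OF xcl, of "4 * r"] m_ball_finite[of x "4 * r"] x by auto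
  let ?I = "{Z. \<beta> Z} \<inter> \<Omega>"
  have I: "?I \<in> sets borel" using open_Omega by measurable
  have "(\<integral>\<^sup>+Z. ?h Z \<partial>m) = (\<integral>\<^sup>+Z\<in>?I. ?h Z \<partial>m)"
    by (intro nn_integral_cong_m) (auto simp: indicator_def)
  also have "\<dots> = emeasure (distr (density m ?h) borel (\<lambda>Z. Z)) ?I"
    by (rule emeasure_image_measure[OF h I, symmetric])
  also have "\<dots> \<le> (C * M * Cm ^ 23 / ?mB) * emeasure (distr (density m (\<lambda>_. 1)) borel (\<lambda>Z. Z)) (ball x (4 * r))"
  proof (rule vitali_measure_comparison[where a = "\<lambda>Z. Z" and r = "\<lambda>_. s" and R = s and I = ?I])
    show "?I \<subseteq> (\<Union>Z\<in>?I. ball Z s)" using s by auto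
    fix Z assume "Z \<in> ?I"
    then have Z: "Z \<in> \<Omega>" "dist Z x < 3 * r" using at_scale by auto
    show "ball Z s \<subseteq> ball x (4 * r)"
      using Z x by (intro ball_subset_ball_iff[THEN iffD2] disjI1) (simp add: s_def dist_commute)
    have mass: "emeasure (distr (density m (\<lambda>_. 1)) borel (\<lambda>Z. Z)) (ball Z s) = emeasure m (ball Z s \<inter> \<Omega>)"
      using borel_Int_sets_m[of "ball Z s"]
      by (subst emeasure_image_measure) (auto simp: density_1 intro!: nn_integral_indicator[THEN trans[rotated]] nn_integral_cong_m simp: indicator_def)
    have "?mB \<le> emeasure m (ball Z (2 ^ 23 * s) \<inter> \<Omega>)"
      using Z x by (intro m_mono ball_subset_ball_iff[THEN iffD2] disjI1) (auto simp: s_def dist_commute)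
    also have "\<dots> \<le> Cm ^ 23 * emeasure m (ball Z s \<inter> \<Omega>)"
      using Z closure_subset s by (intro m_doubling_iterated) auto
    finally have dm: "?mB \<le> Cm ^ 23 * emeasure m (ball Z s \<inter> \<Omega>)" .
    have "emeasure (distr (density m ?h) borel (\<lambda>Z. Z)) (ball Z (5 * s)) = (\<integral>\<^sup>+Z'\<in>ball Z (5 * s). ?h Z' \<partial>m)"
      by (rule emeasure_image_measure[OF h]) simp
    also have "\<dots> \<le> C * M"
    proof (rule local_mass_bound[OF G carleson Z(1) s \<beta>])
      show "80 * s \<le> bdist \<Omega> Z'" if "\<beta> Z'" for Z'
        using at_scale[OF that] x by (simp add: s_def)
      show "bdist \<Omega> Z' \<le> r" if "\<beta> Z'" for Z' using at_scale[OF that] by simp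
    qed (use not_all in auto)
    also have "\<dots> = C * M * (?mB / ?mB)" using mB by (simp add: ennreal_divide_self less_top)
    also have "\<dots> \<le> C * M * (Cm ^ 23 * emeasure m (ball Z s \<inter> \<Omega>) / ?mB)"
      using dm by (intro mult_left_mono divide_right_mono_ennreal) auto
    also have "\<dots> = (C * M * Cm ^ 23 / ?mB) * emeasure m (ball Z s \<inter> \<Omega>)"
      by (simp add: divide_ennreal_def ac_simps)
    finally show "emeasure (distr (density m ?h) borel (\<lambda>Z. Z)) (ball Z (5 * s))
        \<le> (C * M * Cm ^ 23 / ?mB) * emeasure (distr (density m (\<lambda>_. 1)) borel (\<lambda>Z. Z)) (ball Z s)"
      unfolding mass .
  qed (use s in auto)
  also have "emeasure (distr (density m (\<lambda>_. 1)) borel (\<lambda>Z. Z)) (ball x (4 * r)) = ?mB"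
    using borel_Int_sets_m[of "ball x (4 * r)"]
    by (subst emeasure_image_measure) (auto simp: density_1 intro!: nn_integral_indicator[THEN trans[rotated]] nn_integral_cong_m simp: indicator_def)
  also have "(C * M * Cm ^ 23 / ?mB) * ?mB = C * M * Cm ^ 23"
    by (rule ennreal_divide_mult_cancel[OF mB])
  finally show ?thesis .
qed

text \<open>Here the pole may be at distance \<open>2 r\<close>.  Points below height \<open>\<rho>\<close> (\<open>w1\<close>) are covered by balls of radius \<open>\<rho>\<close>, for
which the pole is remote.  At larger heights, either the shadow of \<open>Z\<close> contains the whole boundary (\<open>w2\<close>) and then
\<open>\<nu>0\<close> and \<open>\<nu>1\<close> both give it the full mass of the ball, or the mass of \<open>G\<close> is bounded by the dichotomy (\<open>w3\<close>).\<close>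

lemma Carleson_transfer:
  assumes G: "G \<in> borel_measurable m"
    and carleson: "Carleson \<Omega> m \<nu>1 G M" and M: "M < \<infinity>"
    and \<zeta>: "0 < \<zeta>" "\<zeta> < \<infinity>"
    and absolutely: "\<And>x r X E. x \<in> frontier \<Omega> \<Longrightarrow> 0 < r \<Longrightarrow> X \<in> \<Omega> \<Longrightarrow> 2 * r \<le> dist X x \<Longrightarrow>
      E \<in> sets borel \<Longrightarrow> E \<subseteq> ball x r \<Longrightarrow> emeasure (\<nu>1 X) E \<le> \<zeta> * emeasure (\<nu>1 X) (ball x r) \<Longrightarrow>
      4 * C ^ 10 * emeasure (\<nu>0 X) E \<le> emeasure (\<nu>0 X) (ball x r)"
  obtains M' where "M' < \<infinity>" "Carleson \<Omega> m \<nu>0 G M'"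
proof -
  let ?\<delta> = "bdist \<Omega>"
  \<comment> \<open>above the threshold \<open>K\<close> the area functional has relative \<open>\<nu>1\<close> measure at most \<open>\<zeta>\<close>; the summand \<open>1\<close> keeps \<open>K\<close> positive\<close>
  define K where "K = M / \<zeta> + 1"
  have K: "0 < K" "K < \<infinity>" "M \<le> \<zeta> * K"
  proof -
    show "0 < K" by (rule order.strict_trans2[of 0 1]) (simp_all add: K_def add_increasing)
    show "K < \<infinity>" using M \<zeta> by (auto simp: K_def less_top[symmetric] ennreal_divide_eq_top_iff)
    have "\<zeta> * (M / \<zeta>) = M" using \<zeta> by (simp add: ennreal_times_divide mult.commute[of \<zeta>] mult_divide_eq_ennreal less_top)
    then show "M \<le> \<zeta> * K" by (simp add: K_def distrib_left)
  qed
  define K' where "K' = 2 * ((C ^ 11 * M + 2 * K) * C ^ 4) + 1"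
  define M' where "M' = K' * C ^ 4 + M + C * M * Cm ^ 23"
  have "M' < \<infinity>"
    using M K F0.C_power_finite F0.C_finite Cm_finite
    by (simp add: M'_def K'_def ennreal_mult_less_top power_less_top_ennreal)
  moreover have "Carleson \<Omega> m \<nu>0 G M'"
    unfolding Carleson_def
  proof (intro ballI allI impI)
    fix x r X assume x: "x \<in> frontier \<Omega>" "0 < r" and X: "X \<in> \<Omega>" "2 * r \<le> dist X x"
    note [measurable] = G measurable_m_of_borel[OF measurable_bdist]
    let ?b0 = "emeasure (\<nu>0 X) (ball x r)" and ?b1 = "emeasure (\<nu>1 X) (ball x r)"
    let ?S = "\<lambda>Z. cball Z (2 * ?\<delta> Z)"
    define \<rho> where "\<rho> = r / 2 ^ 13"
    have rho: "0 < \<rho>" "3 * \<rho> \<le> r" using x by (auto simp: \<rho>_def)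
    define \<alpha> where "\<alpha> Z \<longleftrightarrow> frontier \<Omega> \<subseteq> ?S Z" for Z
    have \<alpha>[measurable]: "Measurable.pred borel \<alpha>"
    proof -
      have "closed {Z. \<alpha> Z}"
      proof -
        have "closed {Z. dist Z y \<le> 2 * ?\<delta> Z}" for y
          by (intro closed_Collect_le continuous_intros continuous_bdist)
        then have "closed (\<Inter>y\<in>frontier \<Omega>. {Z. dist Z y \<le> 2 * ?\<delta> Z})" by auto
        moreover have "{Z. \<alpha> Z} = (\<Inter>y\<in>frontier \<Omega>. {Z. dist Z y \<le> 2 * ?\<delta> Z})"
          by (auto simp: \<alpha>_def)
        ultimately show ?thesis by simp
      qed
      then have "{Z. \<alpha> Z} \<in> sets borel" by (rule borel_closed)
      then show ?thesis by (simp add: pred_def)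
    qed
    define \<beta> where "\<beta> Z \<longleftrightarrow> \<not> \<alpha> Z \<and> \<rho> \<le> ?\<delta> Z \<and> ?\<delta> Z \<le> r \<and> dist Z x < 3 * r" for Z
    have \<beta>[measurable]: "Measurable.pred borel \<beta>" unfolding \<beta>_def by measurable
    have \<alpha>m[measurable]: "Measurable.pred m \<alpha>" and \<beta>m[measurable]: "Measurable.pred m \<beta>"
      using measurable_m_of_borel[OF \<alpha>] measurable_m_of_borel[OF \<beta>] .
    have S0: "(\<lambda>Z. emeasure (\<nu>0 X) (ball x r \<inter> ?S Z)) \<in> borel_measurable m"
      and S1: "(\<lambda>Z. emeasure (\<nu>1 X) (ball x r \<inter> ?S Z)) \<in> borel_measurable m"
      by (intro measurable_m_of_borel measurable_shadow_mass sigma_finite_nu X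
          F0.sets_nu F1.sets_nu; simp)+
    define q where "q = ?b0 / ?b1"
    have q: "q * ?b1 = ?b0"
    proof -
      have "?b1 \<noteq> 0" "?b1 \<noteq> \<top>"
        using F1.nu_pos[OF X(1) x] F1.nu_finite[OF X(1), of "ball x r"] by auto
      then show ?thesis unfolding q_def by (rule ennreal_divide_mult_cancel)
    qed
    define w where "w Z = G Z * indicator {Z. ?\<delta> Z \<le> r} Z * emeasure (\<nu>0 X) (ball x r \<inter> ?S Z)" for Z
    define w1 where "w1 Z = G Z * indicator {Z. ?\<delta> Z \<le> \<rho>} Z * emeasure (\<nu>0 X) (ball x r \<inter> ?S Z)" for Z
    define w2 where "w2 Z = q * (G Z * indicator {Z. ?\<delta> Z \<le> r} Z * emeasure (\<nu>1 X) (ball x r \<inter> ?S Z))" for Z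
    define w3 where "w3 Z = (G Z * indicator {Z. \<beta> Z} Z) * ?b0" for Z
    have ind: "(\<lambda>Z. indicator {Z. ?\<delta> Z \<le> s} Z :: ennreal) \<in> borel_measurable m" for s
      by measurable
    have ind\<beta>: "(\<lambda>Z. indicator {Z. \<beta> Z} Z :: ennreal) \<in> borel_measurable m" by measurable
    have meas: "w1 \<in> borel_measurable m" "w2 \<in> borel_measurable m" "w3 \<in> borel_measurable m"
      unfolding w1_def w2_def w3_def
      by (intro borel_measurable_times_ennreal borel_measurable_const G ind ind\<beta> S0 S1)+
    have split: "w Z \<le> w1 Z + w2 Z + w3 Z" if Z: "Z \<in> \<Omega>" for Z
    proof (cases "?\<delta> Z \<le> r \<and> ball x r \<inter> ?S Z \<noteq> {}")
      case False
      then show ?thesis by (auto simp: w_def)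
    next
      case True
      then obtain y where y: "dist x y < r" "dist Z y \<le> 2 * ?\<delta> Z" by auto
      have near: "dist Z x < 3 * r" using y True dist_triangle[of Z x y] by (auto simp: dist_commute)
      have le: "emeasure (\<nu>0 X) (ball x r \<inter> ?S Z) \<le> ?b0" by (intro F0.nu_mono[OF X(1)]) auto
      show ?thesis
      proof (cases "?\<delta> Z \<le> \<rho>")
        case small: True
        then have "w Z = w1 Z" using True by (simp add: w_def w1_def)
        then show ?thesis by (simp add: add.assoc)
      next
        case large: False
        show ?thesis
        proof (cases "\<alpha> Z")
          case al: True
          have "emeasure (\<nu>1 X) (ball x r \<inter> ?S Z) = ?b1"
          proof -
            have "emeasure (\<nu>1 X) (ball x r \<inter> ?S Z) = emeasure (\<nu>1 X) ((ball x r \<inter> ?S Z) \<inter> frontier \<Omega>)"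
              by (rule F1.nu_Int_frontier[OF X(1), symmetric]) auto
            also have "(ball x r \<inter> ?S Z) \<inter> frontier \<Omega> = ball x r \<inter> frontier \<Omega>"
              using al by (auto simp: \<alpha>_def)
            also have "emeasure (\<nu>1 X) \<dots> = ?b1" by (rule F1.nu_Int_frontier[OF X(1)]) auto
            finally show ?thesis .
          qed
          then have "w2 Z = G Z * ?b0"
            using True by (simp add: w2_def q[symmetric] ac_simps)
          then have "w Z \<le> w2 Z" using le True by (simp add: w_def mult_left_mono)
          then show ?thesis by (simp add: add_increasing add_increasing2)
        next
          case False
          then have "\<beta> Z" using large near True by (simp add: \<beta>_def)
          then have "w Z \<le> w3 Z" using le True by (simp add: w_def w3_def mult_left_mono)
          then show ?thesis by (simp add: add_increasing)
        qed
      qed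
    qed
    have "(\<integral>\<^sup>+y\<in>ball x r. area \<Omega> m G r y \<partial>\<nu>0 X) = integral\<^sup>N m w"
      unfolding w_def
      by (rule area_fubini[OF G sigma_finite_nu(1)[OF X(1)] F0.sets_nu[OF X(1)]]) simp
    also have "\<dots> \<le> (\<integral>\<^sup>+Z. w1 Z + w2 Z + w3 Z \<partial>m)"
      using split by (rule nn_integral_mono_m)
    also have "\<dots> = integral\<^sup>N m w1 + integral\<^sup>N m w2 + integral\<^sup>N m w3"
      using meas by (simp add: nn_integral_add)
    also have "\<dots> \<le> K' * C ^ 4 * ?b0 + M * ?b0 + C * M * Cm ^ 23 * ?b0"
    proof (intro add_mono)
      have "integral\<^sup>N m w1 = (\<integral>\<^sup>+y\<in>ball x r. area \<Omega> m G \<rho> y \<partial>\<nu>0 X)"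
        unfolding w1_def
        by (rule area_fubini[OF G sigma_finite_nu(1)[OF X(1)] F0.sets_nu[OF X(1)], symmetric]) simp
      also have "\<dots> \<le> K' * C ^ 4 * ?b0"
      proof (rule F0.local_to_global[OF x X rho measurable_area[OF G]])
        fix y assume y: "y \<in> frontier \<Omega>" "dist y x < r"
        have far: "8192 * \<rho> \<le> dist X y"
          using X(2) y(2) dist_triangle[of X x y] by (simp add: \<rho>_def)
        have "(\<integral>\<^sup>+z\<in>ball y \<rho>. area \<Omega> m G \<rho> z \<partial>\<nu>0 X) = tent_integral \<Omega> m (\<nu>0 X) (ball y \<rho>) \<rho> G"
          unfolding tent_integral_def
          by (rule area_fubini[OF G sigma_finite_nu(1)[OF X(1)] F0.sets_nu[OF X(1)]]) simp
        also have "\<dots> \<le> K' * emeasure (\<nu>0 X) (ball y \<rho>)"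
          unfolding K'_def by (rule Carleson_remote_pole[OF G carleson K absolutely y(1) rho(1) X(1) far])
        finally show "(\<integral>\<^sup>+z\<in>ball y \<rho>. area \<Omega> m G \<rho> z \<partial>\<nu>0 X) \<le> K' * emeasure (\<nu>0 X) (ball y \<rho>)" .
      qed
      finally show "integral\<^sup>N m w1 \<le> K' * C ^ 4 * ?b0" .
      have "integral\<^sup>N m w2 = q * tent_integral \<Omega> m (\<nu>1 X) (ball x r) r G"
        unfolding w2_def tent_integral_def
        by (intro nn_integral_cmult borel_measurable_times_ennreal G ind S1)
      also have "tent_integral \<Omega> m (\<nu>1 X) (ball x r) r G = (\<integral>\<^sup>+y\<in>ball x r. area \<Omega> m G r y \<partial>\<nu>1 X)"
        unfolding tent_integral_def
        by (rule area_fubini[OF G sigma_finite_nu(2)[OF X(1)] F1.sets_nu[OF X(1)], symmetric]) simp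
      also have "\<dots> \<le> M * ?b1" using carleson x X by (auto simp: Carleson_def)
      finally have "integral\<^sup>N m w2 \<le> M * (q * ?b1)" by (simp add: mult_left_mono mult.left_commute)
      then show "integral\<^sup>N m w2 \<le> M * ?b0" by (simp add: q)
      have "integral\<^sup>N m w3 = (\<integral>\<^sup>+Z. G Z * indicator {Z. \<beta> Z} Z \<partial>m) * ?b0"
        unfolding w3_def by (intro nn_integral_multc borel_measurable_times_ennreal G ind\<beta>)
      also have "\<dots> \<le> (C * M * Cm ^ 23) * ?b0"
      proof (rule mult_right_mono[OF large_scale_mass_bound[OF G carleson x \<beta>]])
        show "r / 2 ^ 13 \<le> ?\<delta> Z \<and> ?\<delta> Z \<le> r \<and> dist Z x < 3 * r" if "\<beta> Z" for Z
          using that by (simp add: \<beta>_def \<rho>_def)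
        show "\<not> frontier \<Omega> \<subseteq> ?S Z" if "\<beta> Z" for Z
          using that by (simp add: \<beta>_def \<alpha>_def)
      qed simp
      finally show "integral\<^sup>N m w3 \<le> C * M * Cm ^ 23 * ?b0" .
    qed
    also have "\<dots> = M' * ?b0" by (simp add: M'_def distrib_right)
    finally show "(\<integral>\<^sup>+y\<in>ball x r. area \<Omega> m G r y \<partial>\<nu>0 X) \<le> M' * ?b0" .
  qed
  ultimately show thesis by (rule that)
qed

end

section \<open>Level sets of a maximal function\<close>

text \<open>The set where the uncentred maximal function of the indicator of \<open>U\<close> with respect to \<open>N\<close>, restricted to balls of
radius at most \<open>R\<close> with centre on the boundary, exceeds \<open>t\<close>.  The uncentred version makes it open.\<close>

definition level_set :: "(real ^ 'n) set \<Rightarrow> (real ^ 'n) measure \<Rightarrow> (real ^ 'n) set \<Rightarrow> real \<Rightarrow> ennreal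
    \<Rightarrow> (real ^ 'n) set" where
  "level_set \<Omega> N U R t = (\<Union>(y, s) \<in> {(y, s). y \<in> frontier \<Omega> \<and> 0 < s \<and> s \<le> R \<and>
     t * emeasure N (ball y s) < emeasure N (ball y s \<inter> U)}. ball y s)"

lemma level_set_eq:
  "level_set \<Omega> N U R t = (\<Union>i \<in> {(y, s). y \<in> frontier \<Omega> \<and> 0 < s \<and> s \<le> R \<and>
     t * emeasure N (ball y s) < emeasure N (ball y s \<inter> U)}. ball (fst i) (snd i))"
  unfolding level_set_def by (rule SUP_cong) auto

lemma open_level_set [simp]: "open (level_set \<Omega> N U R t)"
  unfolding level_set_def by auto

lemma not_level_setD:
  assumes "w \<notin> level_set \<Omega> N U R t" "y \<in> frontier \<Omega>" "0 < s" "s \<le> R" "dist y w < s"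
  shows "emeasure N (ball y s \<inter> U) \<le> t * emeasure N (ball y s)"
  using assms unfolding level_set_def by (force simp: not_less)

context elliptic_family
begin

text \<open>The comparison of two poles on Borel subsets of a ball extends to integrals over the ball.\<close>

lemma nn_integral_change_pole:
  assumes x: "x \<in> frontier \<Omega>" "0 < r" and X: "X \<in> \<Omega>" "2 * r \<le> dist X x"
    and Y: "Y \<in> \<Omega>" "2 * r \<le> dist Y x" and h: "h \<in> borel_measurable borel"
    and bound: "(\<integral>\<^sup>+y\<in>ball x r. h y \<partial>\<nu> X) \<le> M * emeasure (\<nu> X) (ball x r)"
  shows "(\<integral>\<^sup>+y\<in>ball x r. h y \<partial>\<nu> Y) \<le> C ^ 2 * M * emeasure (\<nu> Y) (ball x r)"
proof -
  let ?B = "ball x r"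
  let ?bX = "emeasure (\<nu> X) ?B" and ?bY = "emeasure (\<nu> Y) ?B"
  note [measurable_cong] = sets_nu[OF X(1)] sets_nu[OF Y(1)]
  note [measurable] = h
  let ?\<mu>Y = "density (\<nu> Y) (\<lambda>y. ?bX * indicator ?B y)"
  let ?\<mu>X = "density (\<nu> X) (\<lambda>y. C ^ 2 * ?bY * indicator ?B y)"
  have em: "emeasure (density N (\<lambda>y. k * indicator ?B y)) E = k * emeasure N (?B \<inter> E)"
    if "sets N = sets borel" "E \<in> sets borel" for N :: "(real ^ 'n) measure" and k :: ennreal and E
  proof -
    have B: "?B \<in> sets N" and E: "E \<in> sets N" using that by simp_all
    have "(\<lambda>y. k * indicator ?B y) \<in> borel_measurable N"
      by (intro borel_measurable_times_ennreal borel_measurable_const borel_measurable_indicator B)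
    from emeasure_density[OF this E]
    have "emeasure (density N (\<lambda>y. k * indicator ?B y)) E = (\<integral>\<^sup>+y. k * indicator (?B \<inter> E) y \<partial>N)"
      by (simp add: indicator_inter_arith mult.assoc)
    also have "\<dots> = k * emeasure N (?B \<inter> E)" using B E by (intro nn_integral_cmult_indicator) auto
    finally show ?thesis .
  qed
  have le: "?\<mu>Y \<le> ?\<mu>X"
  proof (subst le_measure)
    show "sets ?\<mu>Y = sets ?\<mu>X" using sets_nu X Y by simp
    show "\<forall>E\<in>sets ?\<mu>Y. emeasure ?\<mu>Y E \<le> emeasure ?\<mu>X E"
    proof
      fix E assume "E \<in> sets ?\<mu>Y"
      then have E: "E \<in> sets borel" using sets_nu Y by simp
      have "emeasure (\<nu> Y) (?B \<inter> E) * ?bX \<le> C ^ 2 * ?bY * emeasure (\<nu> X) (?B \<inter> E)"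
        using E by (intro pole_comparison[OF x X Y]) auto
      then show "emeasure ?\<mu>Y E \<le> emeasure ?\<mu>X E"
        unfolding em[OF sets_nu[OF X(1)] E] em[OF sets_nu[OF Y(1)] E] by (simp only: mult.commute[of ?bX])
    qed
  qed
  have int: "(\<integral>\<^sup>+y. h y \<partial>density N (\<lambda>y. k * indicator ?B y)) = k * (\<integral>\<^sup>+y\<in>?B. h y \<partial>N)"
    if "sets N = sets borel" for N :: "(real ^ 'n) measure" and k :: ennreal
  proof -
    note [measurable_cong] = that
    have hN: "h \<in> borel_measurable N" by measurable
    have "(\<lambda>y. k * indicator ?B y) \<in> borel_measurable N"
      using that by (intro borel_measurable_times_ennreal borel_measurable_const borel_measurable_indicator) simp
    from nn_integral_density[OF this hN]
    have "(\<integral>\<^sup>+y. h y \<partial>density N (\<lambda>y. k * indicator ?B y)) = (\<integral>\<^sup>+y. k * (h y * indicator ?B y) \<partial>N)"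
      by (simp add: ac_simps)
    also have "\<dots> = k * (\<integral>\<^sup>+y\<in>?B. h y \<partial>N)"
      using that by (intro nn_integral_cmult borel_measurable_times_ennreal hN borel_measurable_indicator) simp
    finally show ?thesis .
  qed
  have "?bX * (\<integral>\<^sup>+y\<in>?B. h y \<partial>\<nu> Y) = (\<integral>\<^sup>+y. h y \<partial>?\<mu>Y)" by (simp add: int sets_nu Y)
  also have "\<dots> \<le> (\<integral>\<^sup>+y. h y \<partial>?\<mu>X)"
    using le sets_nu X Y by (intro nn_integral_mono_measure) auto
  also have "\<dots> = C ^ 2 * ?bY * (\<integral>\<^sup>+y\<in>?B. h y \<partial>\<nu> X)" by (simp add: int sets_nu X)
  also have "\<dots> \<le> C ^ 2 * ?bY * (M * ?bX)" using bound by (rule mult_left_mono) simp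
  finally have "?bX * (\<integral>\<^sup>+y\<in>?B. h y \<partial>\<nu> Y) \<le> ?bX * (C ^ 2 * M * ?bY)" by (simp add: ac_simps)
  then show ?thesis
    using nu_pos[OF X(1) x] nu_finite[OF X(1), of ?B] by (subst (asm) ennreal_mult_le_mult_iff) auto
qed

end

text \<open>The relative measure of \<open>U\<close> in \<open>ball x r\<close> is so small compared with the lowest level \<open>\<tau>\<close> in use that the level sets
stay near the ball and consist of balls of radius below \<open>r / (16 * 2 ^ q)\<close>.  No boundary effect occurs then.\<close>

locale small_open_set = elliptic_family \<Omega> c \<nu> C
  for \<Omega> :: "(real ^ 'n) set" and c \<nu> C +
  fixes X x :: "real ^ 'n" and r :: real and U :: "(real ^ 'n) set" and q :: nat and \<tau> :: ennreal
  assumes X: "X \<in> \<Omega>" "200 * r \<le> dist X x" and x: "x \<in> frontier \<Omega>" "0 < r"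
    and U: "open U" "U \<subseteq> ball x r"
    and q: "2 \<le> q"
    and small: "C ^ (q + 9) * emeasure (\<nu> X) U < \<tau> * emeasure (\<nu> X) (ball x r)"
begin

abbreviation "level t \<equiv> level_set \<Omega> (\<nu> X) U r t"

lemma pow_q: "4 \<le> (2::real) ^ q"
  using power_increasing[OF q, of "2::real"] by simp

lemma meets_U_near:
  assumes "t * emeasure (\<nu> X) (ball y s) < emeasure (\<nu> X) (ball y s \<inter> U)"
  shows "dist y x < r + s"
proof -
  have "ball y s \<inter> U \<noteq> {}" using assms by (metis emeasure_empty not_less_zero)
  then obtain u where "dist y u < s" "u \<in> U" by auto
  then show ?thesis using U dist_triangle[of y x u] by (force simp: dist_commute)
qed

lemma U_small_at_scale:
  assumes z: "z \<in> frontier \<Omega>" "dist z x \<le> 3 * r"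
  shows "C ^ 3 * emeasure (\<nu> X) U < \<tau> * emeasure (\<nu> X) (ball z (r / (16 * 2 ^ q)))"
proof -
  let ?s = "r / (16 * 2 ^ q)"
  have s: "0 < ?s" using x by simp
  have eq: "2 ^ (q + 6) * ?s = 4 * r" by (simp add: power_add)
  have "r \<le> dist X z" "197 * r \<le> dist X z"
    using X(2) z(2) x dist_triangle[of X x z] by linarith+
  then have "emeasure (\<nu> X) (ball x r) \<le> C ^ (q + 6) * emeasure (\<nu> X) (ball z ?s)"
    unfolding eq using x z(2) eq
    by (intro ball_comparison[OF z(1) s X(1)])
      (auto simp: eq dist_commute simp del: times_divide_eq_right intro!: ball_subset_ball_iff[THEN iffD2])
  then have "\<tau> * emeasure (\<nu> X) (ball x r) \<le> \<tau> * (C ^ (q + 6) * emeasure (\<nu> X) (ball z ?s))"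
    by (rule mult_left_mono) simp
  with small have "C ^ (q + 6) * (C ^ 3 * emeasure (\<nu> X) U) < C ^ (q + 6) * (\<tau> * emeasure (\<nu> X) (ball z ?s))"
    by (simp add: power_add ac_simps power_numeral_reduce)
  then show ?thesis
    by (metis linorder_not_le mult_left_mono zero_le)
qed

lemma level_radius_small:
  assumes y: "y \<in> frontier \<Omega>" "0 < s" "s \<le> r" and t: "\<tau> \<le> t"
    and dense: "t * emeasure (\<nu> X) (ball y s) < emeasure (\<nu> X) (ball y s \<inter> U)"
  shows "16 * 2 ^ q * s < r"
proof (rule ccontr)
  assume "\<not> 16 * 2 ^ q * s < r"
  then have s: "r / (16 * 2 ^ q) \<le> s" by (simp add: field_simps)
  have near: "dist y x \<le> 3 * r" using meets_U_near[OF dense] y by linarith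
  have "emeasure (\<nu> X) U \<le> C ^ 3 * emeasure (\<nu> X) U"
    using mult_right_mono[OF C_power_ge[of 3]] by simp
  also have "\<dots> < \<tau> * emeasure (\<nu> X) (ball y (r / (16 * 2 ^ q)))"
    by (rule U_small_at_scale[OF y(1) near])
  also have "\<dots> \<le> t * emeasure (\<nu> X) (ball y s)"
    using t s by (intro mult_mono nu_mono X) auto
  also have "\<dots> < emeasure (\<nu> X) (ball y s \<inter> U)" by (rule dense)
  also have "\<dots> \<le> emeasure (\<nu> X) U" using U by (intro nu_mono X) auto
  finally show False by simp
qed

lemma level_near:
  assumes "w \<in> level t" "\<tau> \<le> t"
  shows "dist w x < 2 * r"
proof -
  obtain y s where y: "y \<in> frontier \<Omega>" "0 < s" "s \<le> r" "dist y w < s"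
    and dense: "t * emeasure (\<nu> X) (ball y s) < emeasure (\<nu> X) (ball y s \<inter> U)"
    using assms(1) by (auto simp: level_set_def)
  have "16 * 2 ^ q * s < r" by (rule level_radius_small[OF y(1-3) assms(2) dense])
  moreover have "16 * 4 * s \<le> 16 * 2 ^ q * s" using pow_q y by (intro mult_right_mono) auto
  ultimately show ?thesis
    using y meets_U_near[OF dense] dist_triangle[of w x y] unfolding dist_commute[of w y] by linarith
qed

lemma expanded_ball_le:
  assumes y: "y \<in> frontier \<Omega>" "0 < s" "s \<le> r" and t: "\<tau> \<le> t"
    and dense: "t * emeasure (\<nu> X) (ball y s) < emeasure (\<nu> X) (ball y s \<inter> U)"
  shows "t * emeasure (\<nu> X) (ball y (5 * s)) \<le> C ^ 3 * emeasure (\<nu> X) (ball y s \<inter> U)"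
proof -
  have "dist y x < 2 * r" using meets_U_near[OF dense] y by linarith
  then have "198 * r \<le> dist X y" using X(2) dist_triangle[of X x y] by linarith
  then have "emeasure (\<nu> X) (ball y (5 * s)) \<le> C ^ 3 * emeasure (\<nu> X) (ball y s)"
    using y by (intro ball_comparison[OF y(1,2) X(1)]) auto
  then have "t * emeasure (\<nu> X) (ball y (5 * s)) \<le> C ^ 3 * (t * emeasure (\<nu> X) (ball y s))"
    by (metis mult.left_commute mult_left_mono zero_le)
  also have "\<dots> \<le> C ^ 3 * emeasure (\<nu> X) (ball y s \<inter> U)"
    using dense by (intro mult_left_mono) auto
  finally show ?thesis .
qed

text \<open>Level sets contain no boundary ball of radius \<open>r / (16 * 2 ^ q)\<close>: by the weak type estimate for the maximal
function they are too small in measure.\<close>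

lemma level_complement_near:
  assumes z: "z \<in> frontier \<Omega>" "dist z x \<le> 3 * r" and t: "\<tau> \<le> t"
  obtains y where "y \<in> frontier \<Omega>" "y \<notin> level t" "dist y z < r / (16 * 2 ^ q)"
proof -
  let ?s = "r / (16 * 2 ^ q)"
  have "\<not> frontier \<Omega> \<inter> ball z ?s \<subseteq> level t"
  proof
    assume engulfed: "frontier \<Omega> \<inter> ball z ?s \<subseteq> level t"
    let ?I = "{(y, s). y \<in> frontier \<Omega> \<and> 0 < s \<and> s \<le> r \<and>
      t * emeasure (\<nu> X) (ball y s) < emeasure (\<nu> X) (ball y s \<inter> U)}"
    have "emeasure (scale_measure t (\<nu> X)) (frontier \<Omega> \<inter> ball z ?s)
        \<le> C ^ 3 * emeasure (density (\<nu> X) (indicator U)) UNIV"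
    proof (rule vitali_measure_comparison[where a = fst and r = snd and R = r and I = ?I])
      show "frontier \<Omega> \<inter> ball z ?s \<subseteq> (\<Union>i\<in>?I. ball (fst i) (snd i))"
        using engulfed unfolding level_set_eq .
      fix i assume "i \<in> ?I"
      then show "emeasure (scale_measure t (\<nu> X)) (ball (fst i) (5 * snd i))
          \<le> C ^ 3 * emeasure (density (\<nu> X) (indicator U)) (ball (fst i) (snd i))"
        using expanded_ball_le[OF _ _ _ t] U X by (auto simp: emeasure_restricted_nu)
    qed (use sets_nu[OF X(1)] in auto)
    also have "\<dots> = C ^ 3 * emeasure (\<nu> X) U" using U X by (simp add: emeasure_restricted_nu)
    also have "\<dots> < \<tau> * emeasure (\<nu> X) (ball z ?s)" by (rule U_small_at_scale[OF z])
    also have "\<dots> \<le> t * emeasure (\<nu> X) (ball z ?s)" using t by (rule mult_right_mono) simp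
    also have "\<dots> = emeasure (scale_measure t (\<nu> X)) (frontier \<Omega> \<inter> ball z ?s)"
      using nu_Int_frontier[OF X(1), of "ball z ?s"] by (simp add: Int_commute)
    finally show False by simp
  qed
  then obtain y where "y \<in> frontier \<Omega> \<inter> ball z ?s" "y \<notin> level t" by blast
  then show thesis by (intro that[of y]) (auto simp: dist_commute)
qed

text \<open>The geometric decay of level sets seen from one ball.  If some point \<open>y'\<close> close to \<open>ball x' \<rho>\<close> is outside the level
set of \<open>t'\<close>, then \<open>U\<close> has density at most \<open>t'\<close>, up to a constant, at scale \<open>\<rho>\<close>.  So a ball that reaches density
\<open>t\<close> has radius below \<open>\<rho>\<close>, unless \<open>t\<close> and \<open>t'\<close> are comparable, and the weak type estimate inside
\<open>ball x' (3 \<rho>)\<close> gives the ratio \<open>t' / t\<close>.\<close>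

lemma level_decay:
  assumes t: "\<tau> \<le> t'" "t' \<le> t"
    and x': "x' \<in> frontier \<Omega>" "dist x' x \<le> 10 * r" and \<rho>: "0 < \<rho>" "8 * 2 ^ q * \<rho> \<le> r"
    and y': "y' \<in> frontier \<Omega>" "y' \<notin> level t'" "dist y' x' \<le> 2 * 2 ^ q * \<rho>"
  shows "t * emeasure (\<nu> X) (level t \<inter> ball x' \<rho>) \<le> t' * (C ^ (q + 6) * emeasure (\<nu> X) (ball x' \<rho>))"
proof -
  let ?I = "{(y, s). y \<in> frontier \<Omega> \<and> 0 < s \<and> s \<le> r \<and> ball y s \<inter> ball x' \<rho> \<noteq> {} \<and>
      t * emeasure (\<nu> X) (ball y s) < emeasure (\<nu> X) (ball y s \<inter> U)}"
  have t2: "\<tau> \<le> t" using t by simp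
  have K\<rho>: "4 * \<rho> \<le> 2 ^ q * \<rho>" using pow_q \<rho> by (intro mult_right_mono) auto
  show ?thesis
  proof (cases "\<exists>(y, s)\<in>?I. \<rho> \<le> s")
    case True
    then obtain y s where y: "y \<in> frontier \<Omega>" "0 < s" "s \<le> r" "\<rho> \<le> s" "ball y s \<inter> ball x' \<rho> \<noteq> {}"
      and dense: "t * emeasure (\<nu> X) (ball y s) < emeasure (\<nu> X) (ball y s \<inter> U)" by auto
    have s: "16 * 2 ^ q * s < r" by (rule level_radius_small[OF y(1-3) t2 dense])
    have Ks: "4 * s \<le> 2 ^ q * s" using pow_q y by (intro mult_right_mono) auto
    have K\<rho>s: "2 ^ q * \<rho> \<le> 2 ^ q * s" using y by simp
    obtain u where "dist y u < s" "dist x' u < \<rho>" using y(5) by auto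
    then have "dist y x' < s + \<rho>" using dist_triangle[of y x' u] by (simp add: dist_commute)
    then have yy': "dist y y' < 4 * 2 ^ q * s"
      using y'(3) dist_triangle[of y y' x'] K\<rho>s Ks y(2,4) unfolding dist_commute[of x' y'] by linarith
    have far: "198 * r \<le> dist X y"
      using X(2) dist_triangle[of X x y] meets_U_near[OF dense] y(3) by linarith
    have "t * emeasure (\<nu> X) (ball y s) \<le> emeasure (\<nu> X) (ball y s \<inter> U)" using dense by simp
    also have "\<dots> \<le> emeasure (\<nu> X) (ball y (4 * 2 ^ q * s) \<inter> U)"
      using Ks U y(2) by (intro nu_mono X Int_mono subset_ball) auto
    also have "\<dots> \<le> t' * emeasure (\<nu> X) (ball y (4 * 2 ^ q * s))"
      using s Ks y by (intro not_level_setD[OF y'(2) y(1)] yy') auto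
    also have "emeasure (\<nu> X) (ball y (4 * 2 ^ q * s)) \<le> C ^ (q + 2) * emeasure (\<nu> X) (ball y s)"
      using far s x y(2) by (intro ball_comparison[OF y(1,2) X(1)]) (auto simp: power_add)
    finally have "t * emeasure (\<nu> X) (ball y s) \<le> t' * (C ^ (q + 2) * emeasure (\<nu> X) (ball y s))"
      by (simp add: mult_left_mono)
    then have "emeasure (\<nu> X) (ball y s) * t \<le> emeasure (\<nu> X) (ball y s) * (t' * C ^ (q + 2))"
      by (simp only: ac_simps)
    then have "t \<le> t' * C ^ (q + 2)"
      using nu_pos[OF X(1) y(1,2)] nu_finite[OF X(1), of "ball y s"]
      by (subst (asm) ennreal_mult_le_mult_iff) auto
    also have "\<dots> \<le> t' * C ^ (q + 6)" by (intro mult_left_mono C_power_mono) auto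
    finally have "t * emeasure (\<nu> X) (level t \<inter> ball x' \<rho>) \<le> (t' * C ^ (q + 6)) * emeasure (\<nu> X) (ball x' \<rho>)"
      by (intro mult_mono nu_mono X) auto
    then show ?thesis by (simp add: mult.assoc)
  next
    case False
    have "t * emeasure (\<nu> X) (level t \<inter> ball x' \<rho>) = emeasure (scale_measure t (\<nu> X)) (level t \<inter> ball x' \<rho>)"
      by simp
    also have "\<dots> \<le> C ^ 3 * emeasure (density (\<nu> X) (indicator U)) (ball x' (3 * \<rho>))"
    proof (rule vitali_measure_comparison[where a = fst and r = snd and R = \<rho> and I = ?I])
      show "level t \<inter> ball x' \<rho> \<subseteq> (\<Union>i\<in>?I. ball (fst i) (snd i))"
        unfolding level_set_eq by force
      fix i assume i: "i \<in> ?I"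
      then have s: "snd i < \<rho>" using False by force
      show "0 < snd i \<and> snd i \<le> \<rho>" using i s by auto
      obtain u where u: "dist (fst i) u < snd i" "dist x' u < \<rho>" using i by auto
      show "ball (fst i) (snd i) \<subseteq> ball x' (3 * \<rho>)"
      proof
        fix w assume "w \<in> ball (fst i) (snd i)"
        then show "w \<in> ball x' (3 * \<rho>)"
          using u s dist_triangle[of x' w u] dist_triangle[of u w "fst i"] by (simp add: dist_commute)
      qed
      show "emeasure (scale_measure t (\<nu> X)) (ball (fst i) (5 * snd i))
          \<le> C ^ 3 * emeasure (density (\<nu> X) (indicator U)) (ball (fst i) (snd i))"
        using i expanded_ball_le[OF _ _ _ t2] U X by (auto simp: emeasure_restricted_nu)
    qed (use sets_nu[OF X(1)] in auto)
    also have "\<dots> = C ^ 3 * emeasure (\<nu> X) (ball x' (3 * \<rho>) \<inter> U)"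
      using U X by (simp add: emeasure_restricted_nu)
    also have "emeasure (\<nu> X) (ball x' (3 * \<rho>) \<inter> U) \<le> emeasure (\<nu> X) (ball y' (4 * 2 ^ q * \<rho>) \<inter> U)"
    proof (intro nu_mono X Int_mono ball_subset_ball_iff[THEN iffD2] disjI1)
      show "dist x' y' + 3 * \<rho> \<le> 4 * 2 ^ q * \<rho>"
        using y'(3) K\<rho> \<rho>(1) unfolding dist_commute[of x' y'] by linarith
    qed (use U in auto)
    also have "\<dots> \<le> t' * emeasure (\<nu> X) (ball y' (4 * 2 ^ q * \<rho>))"
    proof (rule not_level_setD[OF y'(2,1)])
      show "4 * 2 ^ q * \<rho> \<le> r" using \<rho> K\<rho> by linarith
    qed (use \<rho> in auto)
    also have "emeasure (\<nu> X) (ball y' (4 * 2 ^ q * \<rho>)) \<le> C ^ (q + 3) * emeasure (\<nu> X) (ball x' \<rho>)"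
    proof (rule ball_comparison[OF x'(1) \<rho>(1) X(1)])
      show "2 * (2 ^ (q + 3) * \<rho>) \<le> dist X x'"
        using X(2) x'(2) x(2) \<rho> dist_triangle[of X x x'] by (simp add: power_add dist_commute)
      show "ball y' (4 * 2 ^ q * \<rho>) \<subseteq> ball x' (2 ^ (q + 3) * \<rho>)"
      proof (intro ball_subset_ball_iff[THEN iffD2] disjI1)
        have "2 ^ (q + 3) * \<rho> = 8 * 2 ^ q * \<rho>" by (simp add: power_add)
        then show "dist y' x' + 4 * 2 ^ q * \<rho> \<le> 2 ^ (q + 3) * \<rho>"
          using y'(3) K\<rho> \<rho>(1) by linarith
      qed
    qed
    finally have "t * emeasure (\<nu> X) (level t \<inter> ball x' \<rho>)
        \<le> C ^ 3 * (t' * (C ^ (q + 3) * emeasure (\<nu> X) (ball x' \<rho>)))"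
      by (simp add: mult_left_mono)
    then show ?thesis by (simp add: power_add power_numeral_reduce ac_simps)
  qed
qed

end

section \<open>Layers over the level sets\<close>

text \<open>A Whitney region of the set \<open>L\<close>: the points whose height is comparable to the distance to the rest of the boundary.
The factor \<open>3\<close> exceeds the aperture \<open>2\<close> of the cones, so such a point is only in cones with vertex in \<open>L\<close>.\<close>

definition layer :: "(real ^ 'n) set \<Rightarrow> nat \<Rightarrow> (real ^ 'n) set \<Rightarrow> (real ^ 'n) set" where
  "layer \<Omega> q L = {Z \<in> \<Omega>. 3 * bdist \<Omega> Z < infdist Z (frontier \<Omega> - L) \<and>
     infdist Z (frontier \<Omega> - L) \<le> 2 ^ q * bdist \<Omega> Z}"

lemma layer_borel:
  assumes "open \<Omega>"
  shows "layer \<Omega> q L \<in> sets borel"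
proof -
  have [measurable]: "(\<lambda>Z. infdist Z (frontier \<Omega> - L)) \<in> borel_measurable borel"
    by (intro borel_measurable_continuous_onI continuous_intros)
  have "\<Omega> \<inter> {Z. 3 * bdist \<Omega> Z < infdist Z (frontier \<Omega> - L) \<and>
     infdist Z (frontier \<Omega> - L) \<le> 2 ^ q * bdist \<Omega> Z} \<in> sets borel"
    using assms by measurable
  then show ?thesis by (simp add: layer_def Int_def)
qed

context weighted_domain
begin

lemma whitney_mass_pos:
  assumes "frontier \<Omega> \<noteq> {}" "Z \<in> \<Omega>"
  shows "whitney_mass \<Omega> m Z \<noteq> 0" "whitney_mass \<Omega> m Z \<noteq> \<top>"
  using m_ball_pos[of Z "bdist \<Omega> Z / 4"] m_ball_finite[of Z "bdist \<Omega> Z / 4"]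
    subsetD[OF closure_subset assms(2)] bdist_pos[OF open_Omega assms] assms(2)
  by (auto simp: whitney_mass_eq)

lemma measurable_layer_density:
  "(\<lambda>Z. indicator (layer \<Omega> q L) Z / whitney_mass \<Omega> m Z) \<in> borel_measurable m"
  by (intro borel_measurable_divide_ennreal measurable_whitney_mass measurable_m_of_borel[OF borel_measurable_indicator]
      layer_borel open_Omega)

lemma area_eq_0: "(\<And>Z. Z \<in> cone \<Omega> r y \<Longrightarrow> G Z = 0) \<Longrightarrow> area \<Omega> m G r y = 0"
  unfolding area_def by (subst nn_integral_cong[where v = "\<lambda>_. 0"]) (auto simp: indicator_def)

text \<open>All points of the layer in the cone at \<open>y\<close> have height comparable to the distance \<open>d\<close> of \<open>y\<close> to the rest of the
boundary, so the integrand is comparable to the constant \<open>1 / m(ball y (2 d))\<close> on a subset of that ball.\<close>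

lemma area_layer_le:
  assumes y: "y \<in> frontier \<Omega>" and L: "open L" "frontier \<Omega> - L \<noteq> {}" and q: "2 \<le> q"
  shows "area \<Omega> m (\<lambda>Z. indicator (layer \<Omega> q L) Z / whitney_mass \<Omega> m Z) r y \<le> Cm ^ (q + 5) * indicator L y"
proof -
  let ?\<delta> = "bdist \<Omega>" and ?A = "frontier \<Omega> - L"
  define d where "d = infdist y ?A"
  have fne: "frontier \<Omega> \<noteq> {}" using y by auto
  have q4: "4 \<le> (2::real) ^ q" using power_increasing[OF q, of "2::real"] by simp
  have bounds: "0 < ?\<delta> Z" "?\<delta> Z < d" "d \<le> (2 ^ q + 2) * ?\<delta> Z" "dist Z y \<le> 2 * ?\<delta> Z"
    if Z: "Z \<in> cone \<Omega> r y" "Z \<in> layer \<Omega> q L" for Z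
  proof -
    show "0 < ?\<delta> Z" using Z bdist_pos[OF open_Omega fne] by (auto simp: layer_def)
    show zy: "dist Z y \<le> 2 * ?\<delta> Z" using Z by (simp add: cone_def)
    show "?\<delta> Z < d"
      using zy Z(2) infdist_triangle[of Z ?A y] by (auto simp: layer_def d_def)
    have "d \<le> infdist Z ?A + dist Z y"
      using infdist_triangle[of y ?A Z] by (simp add: d_def dist_commute)
    moreover have "infdist Z ?A \<le> 2 ^ q * ?\<delta> Z" using Z(2) by (simp add: layer_def)
    ultimately show "d \<le> (2 ^ q + 2) * ?\<delta> Z" using zy by (simp add: algebra_simps)
  qed
  show ?thesis
  proof (cases "\<exists>Z. Z \<in> cone \<Omega> r y \<and> Z \<in> layer \<Omega> q L")
    case False
    then show ?thesis by (subst area_eq_0) auto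
  next
    case True
    then have dpos: "0 < d" using bounds by (meson less_trans)
    then have yL: "y \<in> L" using y infdist_zero[of y ?A] unfolding d_def by fastforce
    let ?B = "ball y (2 * d)"
    let ?mB = "emeasure m (?B \<inter> \<Omega>)"
    have mB: "?mB \<noteq> 0" "?mB \<noteq> \<top>"
      using m_ball_pos[of y "2 * d"] m_ball_finite[of y "2 * d"] y dpos by (auto simp: frontier_def)
    have pointwise: "indicator (layer \<Omega> q L) Z / whitney_mass \<Omega> m Z * indicator (cone \<Omega> r y) Z
        \<le> (Cm ^ (q + 5) / ?mB) * indicator (?B \<inter> \<Omega>) Z" if Z: "Z \<in> \<Omega>" for Z
    proof (cases "Z \<in> cone \<Omega> r y \<and> Z \<in> layer \<Omega> q L")
      case True
      note b = bounds[OF conjunct1[OF True] conjunct2[OF True]]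
      let ?w = "whitney_mass \<Omega> m Z"
      have w: "?w \<noteq> 0" "?w \<noteq> \<top>" using whitney_mass_pos[OF fne Z] .
      have "?mB \<le> emeasure m (ball Z (2 ^ (q + 5) * (?\<delta> Z / 4)) \<inter> \<Omega>)"
      proof (intro m_mono ball_subset_ball_iff[THEN iffD2] disjI1)
        have "4 * ?\<delta> Z \<le> 2 ^ q * ?\<delta> Z" using q4 b(1) by (intro mult_right_mono) auto
        moreover have "2 ^ (q + 5) * (?\<delta> Z / 4) = 8 * (2 ^ q * ?\<delta> Z)" by (simp add: power_add)
        moreover have "d \<le> 2 ^ q * ?\<delta> Z + 2 * ?\<delta> Z" using b(3) by (simp add: algebra_simps)
        ultimately show "dist y Z + 2 * d \<le> 2 ^ (q + 5) * (?\<delta> Z / 4)"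
          using b(1,2,4) unfolding dist_commute[of y Z] by linarith
      qed simp
      also have "\<dots> \<le> Cm ^ (q + 5) * ?w"
        unfolding whitney_mass_eq[OF Z] using Z closure_subset b(1) by (intro m_doubling_iterated) auto
      finally have "?mB / ?mB / ?w \<le> Cm ^ (q + 5) * ?w / ?mB / ?w"
        by (intro divide_right_mono_ennreal)
      also have "Cm ^ (q + 5) * ?w / ?mB / ?w = (Cm ^ (q + 5) / ?mB) * ?w / ?w"
        by (simp add: divide_ennreal_def ac_simps)
      also have "\<dots> = Cm ^ (q + 5) / ?mB" using w by (simp add: mult_divide_eq_ennreal)
      finally have "1 / ?w \<le> Cm ^ (q + 5) / ?mB"
        using mB by (simp add: ennreal_divide_self less_top)
      moreover have "Z \<in> ?B" using b by (simp add: dist_commute)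
      ultimately show ?thesis using True Z by simp
    qed auto
    have "area \<Omega> m (\<lambda>Z. indicator (layer \<Omega> q L) Z / whitney_mass \<Omega> m Z) r y
        \<le> (\<integral>\<^sup>+Z. (Cm ^ (q + 5) / ?mB) * indicator (?B \<inter> \<Omega>) Z \<partial>m)"
      unfolding area_def by (rule nn_integral_mono_m[OF pointwise])
    also have "\<dots> = (Cm ^ (q + 5) / ?mB) * ?mB"
      by (intro nn_integral_cmult_indicator borel_Int_sets_m) simp
    also have "\<dots> = Cm ^ (q + 5)"
      by (rule ennreal_divide_mult_cancel[OF mB])
    finally show ?thesis using yL by simp
  qed
qed

text \<open>Below height \<open>r\<close> a layer is only seen from balls that have points outside the level set at distance comparable to \<open>r\<close>.\<close>

lemma area_layer_eq_0:
  assumes y: "dist y x' < r" and L: "open L" "frontier \<Omega> - L \<noteq> {}" and q: "2 \<le> q"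
    and far: "\<And>y'. y' \<in> frontier \<Omega> - L \<Longrightarrow> 2 * 2 ^ q * r < dist y' x'"
  shows "area \<Omega> m (\<lambda>Z. indicator (layer \<Omega> q L) Z / whitney_mass \<Omega> m Z) r y = 0"
proof (rule area_eq_0)
  fix Z assume Z: "Z \<in> cone \<Omega> r y"
  have "Z \<notin> layer \<Omega> q L"
  proof
    assume "Z \<in> layer \<Omega> q L"
    then have D: "infdist Z (frontier \<Omega> - L) \<le> 2 ^ q * bdist \<Omega> Z" by (simp add: layer_def)
    have cl: "closed (frontier \<Omega> - L)" using L by (intro closed_Diff) auto
    obtain y' where y': "y' \<in> frontier \<Omega> - L" "infdist Z (frontier \<Omega> - L) = dist Z y'"
      using infdist_attains_inf[OF cl L(2), of Z] by metis
    have b: "bdist \<Omega> Z \<le> r" "dist Z y \<le> 2 * bdist \<Omega> Z" using Z by (auto simp: cone_def)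
    have "0 < r" using y by (metis zero_le_dist le_less_trans)
    have q4: "4 \<le> (2::real) ^ q" using power_increasing[OF q, of "2::real"] by simp
    have "2 ^ q * bdist \<Omega> Z \<le> 2 ^ q * r" "4 * r \<le> 2 ^ q * r"
      using b \<open>0 < r\<close> q4 by (auto intro: mult_left_mono mult_right_mono)
    moreover have "dist y' x' \<le> dist Z y' + dist Z y + dist y x'"
      using dist_triangle[of y' x' Z] dist_triangle[of Z x' y] by (simp add: dist_commute)
    ultimately show False using far[OF y'(1)] D y'(2) b y \<open>0 < r\<close> by linarith
  qed
  then show "indicator (layer \<Omega> q L) Z / whitney_mass \<Omega> m Z = 0" by simp
qed

end

lemma sum_half_powers_le: "(\<Sum>j\<le>n. (1 / 2 :: real) ^ (n - j)) \<le> 2"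
proof (induction n)
  case (Suc n)
  have "(\<Sum>j\<le>Suc n. (1 / 2 :: real) ^ (Suc n - j)) = (\<Sum>j\<le>n. (1 / 2) * (1 / 2) ^ (n - j)) + 1"
    by (simp add: Suc_diff_le)
  also have "(\<Sum>j\<le>n. (1 / 2) * (1 / 2) ^ (n - j)) = (1 / 2) * (\<Sum>j\<le>n. (1 / 2 :: real) ^ (n - j))"
    by (rule sum_distrib_left[symmetric])
  finally show ?case using Suc by simp
qed simp

text \<open>The ratio \<open>a\<close> of consecutive levels exceeds the constant of \<open>level_decay\<close>, which separates the layers.  The aperture
\<open>2 ^ q\<close> of the layers is large compared with \<open>1 / c\<close>, so that corkscrew balls fit into them.\<close>

locale sawtooth = weighted_domain \<Omega> m Cm + small_open_set \<Omega> c \<nu> C X x r U q "ennreal (1 / a ^ N)"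
  for \<Omega> :: "(real ^ 'n) set" and m Cm c \<nu> C X x r U q and a :: real and N :: nat +
  assumes a: "2 \<le> a" "C ^ (q + 6) < ennreal a" and cq: "100 \<le> c * 2 ^ q"
begin

definition t :: "nat \<Rightarrow> ennreal" where "t j = ennreal (1 / a ^ Suc j)"
abbreviation "A j \<equiv> level (t j)"
abbreviation "W j \<equiv> layer \<Omega> q (A j)"
abbreviation "density_of j \<equiv> (\<lambda>Z. indicator (W j) Z / whitney_mass \<Omega> m Z)"
definition G :: "real ^ 'n \<Rightarrow> ennreal" where "G Z = (\<Sum>j<N. density_of j Z)"

lemma t_ge: "j < N \<Longrightarrow> ennreal (1 / a ^ N) \<le> t j"
  unfolding t_def using a by (intro ennreal_leI divide_left_mono power_increasing) auto

lemma t_antimono: "i \<le> j \<Longrightarrow> t j \<le> t i"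
  unfolding t_def using a by (intro ennreal_leI divide_left_mono power_increasing) auto

lemma t_ratio: "i \<le> j \<Longrightarrow> t j = t i * ennreal ((1 / a) ^ (j - i))"
  unfolding t_def using a
  by (subst ennreal_mult[symmetric]) (auto simp: power_diff field_simps)

lemma t_pos: "0 < t j" "t j < \<top>" "t j < 1"
proof -
  have "1 < a ^ Suc j" using a by (intro one_less_power) auto
  then show "0 < t j" "t j < \<top>" "t j < 1" unfolding t_def using a by (auto simp: ennreal_less_one_iff)
qed

lemma complement_nonempty: "j < N \<Longrightarrow> frontier \<Omega> - A j \<noteq> {}"
  using level_complement_near[OF x(1) _ t_ge, of j] x by auto

lemma level_decay_geometric:
  assumes ij: "i \<le> j" "j < N" and x': "x' \<in> frontier \<Omega>" "dist x' x \<le> 10 * r"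
    and \<rho>: "0 < \<rho>" "8 * 2 ^ q * \<rho> \<le> r"
    and y': "y' \<in> frontier \<Omega> - A j" "dist y' x' \<le> 2 * 2 ^ q * \<rho>"
  shows "emeasure (\<nu> X) (A i \<inter> ball x' \<rho>)
    \<le> ennreal ((1 / a) ^ (j - i)) * (C ^ (q + 6) * emeasure (\<nu> X) (ball x' \<rho>))"
proof -
  have "t i * emeasure (\<nu> X) (A i \<inter> ball x' \<rho>) \<le> t j * (C ^ (q + 6) * emeasure (\<nu> X) (ball x' \<rho>))"
    using y' by (intro level_decay[OF t_ge[OF ij(2)] t_antimono[OF ij(1)] x' \<rho>]) auto
  also have "\<dots> = t i * (ennreal ((1 / a) ^ (j - i)) * (C ^ (q + 6) * emeasure (\<nu> X) (ball x' \<rho>)))"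
    unfolding t_ratio[OF ij(1)] by (simp add: mult.assoc)
  finally show ?thesis
    using t_pos(1,2)[of i] by (subst (asm) ennreal_mult_le_mult_iff) auto
qed

lemma layer_cases:
  assumes Z: "Z \<in> W j" and j: "j < N"
  obtains z where "z \<in> frontier \<Omega>" "dist z Z = bdist \<Omega> Z" "dist z x < 2 * r" "0 < bdist \<Omega> Z"
    "2 * bdist \<Omega> Z < r / (16 * 2 ^ q)" "frontier \<Omega> \<inter> ball z (2 * bdist \<Omega> Z) \<subseteq> A j"
proof -
  have fne: "frontier \<Omega> \<noteq> {}" using x by auto
  obtain z where z: "z \<in> frontier \<Omega>" "dist z Z = bdist \<Omega> Z" using exists_foot[OF fne] by blast
  have pos: "0 < bdist \<Omega> Z" using Z bdist_pos[OF open_domain fne] by (auto simp: layer_def)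
  have in_A: "w \<in> A j" if "w \<in> frontier \<Omega>" "dist w z < 2 * bdist \<Omega> Z" for w
  proof (rule ccontr)
    assume "w \<notin> A j"
    then have "infdist Z (frontier \<Omega> - A j) \<le> dist Z w" using that by (intro infdist_le) auto
    also have "\<dots> \<le> dist z Z + dist w z" using dist_triangle[of Z w z] by (simp add: dist_commute)
    finally show False using Z that z by (simp add: layer_def)
  qed
  have zx: "dist z x < 2 * r"
    using in_A[OF z(1)] pos t_ge[OF j] by (intro level_near[of _ "t j"]) auto
  obtain y where y: "y \<in> frontier \<Omega>" "y \<notin> A j" "dist y z < r / (16 * 2 ^ q)"
    by (rule level_complement_near[OF z(1) _ t_ge[OF j]]) (use zx x in auto)
  have "2 * bdist \<Omega> Z < r / (16 * 2 ^ q)"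
    using in_A[OF y(1)] y(2,3) by (meson le_less_trans linorder_not_le)
  moreover have "frontier \<Omega> \<inter> ball z (2 * bdist \<Omega> Z) \<subseteq> A j"
    using in_A by (auto simp: dist_commute)
  ultimately show thesis using that z zx pos by blast
qed

text \<open>A common point of the layers \<open>i < j\<close> has above its foot a ball contained in the level set \<open>i\<close>, and close to it a
point outside the level set \<open>j\<close>.  By the decay estimate the measure of that ball would be at most \<open>C ^ (q + 6) / a\<close> times
itself, and this factor is less than \<open>1\<close>.\<close>

lemma layers_disjoint:
  assumes Z: "Z \<in> W i" "Z \<in> W j" and ij: "i < j" "j < N"
  shows False
proof -
  obtain z where z: "z \<in> frontier \<Omega>" "dist z Z = bdist \<Omega> Z" "dist z x < 2 * r" "0 < bdist \<Omega> Z"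
    "2 * bdist \<Omega> Z < r / (16 * 2 ^ q)" "frontier \<Omega> \<inter> ball z (2 * bdist \<Omega> Z) \<subseteq> A i"
    using layer_cases[OF Z(1)] ij by auto
  let ?\<rho> = "2 * bdist \<Omega> Z"
  have cl: "closed (frontier \<Omega> - A j)" by (intro closed_Diff) auto
  obtain y' where y': "y' \<in> frontier \<Omega> - A j" "infdist Z (frontier \<Omega> - A j) = dist Z y'"
    using infdist_attains_inf[OF cl complement_nonempty[OF ij(2)], of Z] by metis
  have Zy': "dist Z y' \<le> 2 ^ q * bdist \<Omega> Z" using Z(2) y' by (simp add: layer_def)
  have "4 * bdist \<Omega> Z \<le> 2 ^ q * bdist \<Omega> Z" using pow_q by (intro mult_right_mono) auto
  then have near: "dist y' z \<le> 2 * 2 ^ q * ?\<rho>"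
    using Zy' z(2,4) dist_triangle[of y' z Z] unfolding dist_commute[of y' Z] dist_commute[of Z z] by linarith
  have "8 * 2 ^ q * ?\<rho> \<le> r" using z(5) x by (simp add: field_simps)
  then have "emeasure (\<nu> X) (A i \<inter> ball z ?\<rho>)
      \<le> ennreal ((1 / a) ^ (j - i)) * (C ^ (q + 6) * emeasure (\<nu> X) (ball z ?\<rho>))"
    using ij z x by (intro level_decay_geometric[OF _ _ _ _ _ _ y'(1) near]) auto
  moreover have "emeasure (\<nu> X) (A i \<inter> ball z ?\<rho>) = emeasure (\<nu> X) (ball z ?\<rho>)"
  proof -
    have "emeasure (\<nu> X) (A i \<inter> ball z ?\<rho>) = emeasure (\<nu> X) ((A i \<inter> ball z ?\<rho>) \<inter> frontier \<Omega>)"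
      by (rule nu_Int_frontier[OF X(1), symmetric]) auto
    also have "(A i \<inter> ball z ?\<rho>) \<inter> frontier \<Omega> = ball z ?\<rho> \<inter> frontier \<Omega>" using z(6) by auto
    also have "emeasure (\<nu> X) \<dots> = emeasure (\<nu> X) (ball z ?\<rho>)" by (rule nu_Int_frontier[OF X(1)]) auto
    finally show ?thesis .
  qed
  ultimately have le: "emeasure (\<nu> X) (ball z ?\<rho>) * 1
      \<le> emeasure (\<nu> X) (ball z ?\<rho>) * (ennreal ((1 / a) ^ (j - i)) * C ^ (q + 6))"
    by (simp add: ac_simps)
  have pos: "0 < emeasure (\<nu> X) (ball z ?\<rho>)" using z by (intro nu_pos X) auto
  have "1 \<le> ennreal ((1 / a) ^ (j - i)) * C ^ (q + 6)"
    using le pos nu_finite[OF X(1), of "ball z ?\<rho>"] by (subst (asm) ennreal_mult_le_mult_iff) auto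
  also have "\<dots> \<le> ennreal (1 / a) * C ^ (q + 6)"
    using a ij power_decreasing[of 1 "j - i" "1 / a"] by (intro mult_right_mono ennreal_leI) auto
  also have "\<dots> < ennreal (1 / a) * ennreal a"
    using a by (intro ennreal_mult_strict_left_mono) auto
  also have "\<dots> = 1" using a by (simp add: ennreal_mult[symmetric])
  finally show False by simp
qed

lemma measurable_G: "G \<in> borel_measurable m"
  unfolding G_def[abs_def] by (intro borel_measurable_sum measurable_layer_density)

lemma area_G: "area \<Omega> m G \<rho> y = (\<Sum>j<N. area \<Omega> m (density_of j) \<rho> y)"
proof -
  have "area \<Omega> m G \<rho> y = (\<integral>\<^sup>+Z. (\<Sum>j<N. density_of j Z * indicator (cone \<Omega> \<rho> y) Z) \<partial>m)"
    by (simp add: area_def G_def sum_distrib_right)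
  also have "\<dots> = (\<Sum>j<N. \<integral>\<^sup>+Z. density_of j Z * indicator (cone \<Omega> \<rho> y) Z \<partial>m)"
    by (intro nn_integral_sum borel_measurable_times_ennreal measurable_layer_density
        borel_measurable_indicator cone_sets_m)
  finally show ?thesis by (simp add: area_def)
qed

lemma area_G_away:
  assumes "y \<in> frontier \<Omega>" "2 * r \<le> dist y x"
  shows "area \<Omega> m G \<rho> y = 0"
  unfolding area_G
proof (rule sum.neutral, rule ballI)
  fix j assume "j \<in> {..<N}"
  then have j: "j < N" by simp
  have "y \<notin> A j" using level_near[OF _ t_ge[OF j], of y] assms(2) by auto
  with area_layer_le[OF assms(1) open_level_set complement_nonempty[OF j] q, of \<rho>]
  show "area \<Omega> m (density_of j) \<rho> y = 0" by simp
qed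

text \<open>Only the layers \<open>j\<close> in \<open>J\<close> are visible from the ball.  For them the area functional is bounded and supported
in the level set \<open>j\<close>, whose share of the ball decays geometrically with the distance of \<open>j\<close> to the largest index in \<open>J\<close>.\<close>

lemma local_Carleson_bound:
  assumes x': "x' \<in> frontier \<Omega>" "dist x' x \<le> 10 * r" and \<rho>: "0 < \<rho>" "8 * 2 ^ q * \<rho> \<le> r"
  shows "(\<integral>\<^sup>+y\<in>ball x' \<rho>. area \<Omega> m G \<rho> y \<partial>\<nu> X)
    \<le> (2 * Cm ^ (q + 5) * C ^ (q + 6)) * emeasure (\<nu> X) (ball x' \<rho>)"
proof -
  note [measurable_cong] = sets_nu[OF X(1)]
  let ?B = "ball x' \<rho>" and ?k = "Cm ^ (q + 5) * (C ^ (q + 6) * emeasure (\<nu> X) (ball x' \<rho>))"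
  define J where "J = {j. j < N \<and> (\<exists>y'\<in>frontier \<Omega> - A j. dist y' x' \<le> 2 * 2 ^ q * \<rho>)}"
  have fin: "finite J" by (simp add: J_def)
  have ar: "(\<lambda>y. area \<Omega> m (density_of j) \<rho> y * indicator ?B y) \<in> borel_measurable (\<nu> X)" for j
    by (intro borel_measurable_times_ennreal borel_measurable_nu[OF X(1)] measurable_area
        measurable_layer_density borel_measurable_indicator) simp
  have "(\<integral>\<^sup>+y\<in>?B. area \<Omega> m G \<rho> y \<partial>\<nu> X) = (\<Sum>j<N. \<integral>\<^sup>+y\<in>?B. area \<Omega> m (density_of j) \<rho> y \<partial>\<nu> X)"
    unfolding area_G sum_distrib_right by (rule nn_integral_sum[OF ar])
  also have "\<dots> = (\<Sum>j\<in>J. \<integral>\<^sup>+y\<in>?B. area \<Omega> m (density_of j) \<rho> y \<partial>\<nu> X)"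
  proof (rule sum.mono_neutral_right)
    show "\<forall>j\<in>{..<N} - J. (\<integral>\<^sup>+y\<in>?B. area \<Omega> m (density_of j) \<rho> y \<partial>\<nu> X) = 0"
    proof
      fix j assume j: "j \<in> {..<N} - J"
      have zero: "area \<Omega> m (density_of j) \<rho> y * indicator ?B y = 0" for y
      proof (cases "dist y x' < \<rho>")
        case True
        have far: "2 * 2 ^ q * \<rho> < dist y' x'" if "y' \<in> frontier \<Omega> - A j" for y'
        proof (rule ccontr)
          assume "\<not> 2 * 2 ^ q * \<rho> < dist y' x'"
          then have "dist y' x' \<le> 2 * 2 ^ q * \<rho>" by simp
          then have "j \<in> J" using that j unfolding J_def by blast
          then show False using j by simp
        qed
        have "area \<Omega> m (density_of j) \<rho> y = 0"
          using j by (intro area_layer_eq_0[OF True open_level_set complement_nonempty q far]) auto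
        then show ?thesis by simp
      qed (simp add: dist_commute)
      show "(\<integral>\<^sup>+y\<in>?B. area \<Omega> m (density_of j) \<rho> y \<partial>\<nu> X) = 0"
        by (simp only: zero nn_integral_const mult_zero_left)
    qed
  qed (auto simp: J_def)
  also have "\<dots> \<le> (\<Sum>j\<in>J. ennreal ((1 / 2) ^ (Max J - j)) * ?k)"
  proof (rule sum_mono)
    fix j assume jJ: "j \<in> J"
    have j: "j < N" using jJ by (simp add: J_def)
    have MJ: "Max J \<in> J" using fin jJ by (intro Max_in) auto
    have jM: "j \<le> Max J" "Max J < N" using fin jJ MJ by (auto simp: J_def)
    obtain y' where y': "y' \<in> frontier \<Omega> - A (Max J)" "dist y' x' \<le> 2 * 2 ^ q * \<rho>"
      using MJ by (auto simp: J_def)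
    have "(\<integral>\<^sup>+y\<in>?B. area \<Omega> m (density_of j) \<rho> y \<partial>\<nu> X) \<le> (\<integral>\<^sup>+y. Cm ^ (q + 5) * indicator (A j \<inter> ?B) y \<partial>\<nu> X)"
    proof (rule nn_integral_mono_AE)
      show "AE y in \<nu> X. area \<Omega> m (density_of j) \<rho> y * indicator ?B y \<le> Cm ^ (q + 5) * indicator (A j \<inter> ?B) y"
        using nu_AE_frontier[OF X(1)]
      proof eventually_elim
        case (elim y)
        show ?case
          using area_layer_le[OF elim open_level_set complement_nonempty[OF j] q, of \<rho>]
          by (auto simp: indicator_def split: if_splits)
      qed
    qed
    also have "\<dots> = Cm ^ (q + 5) * emeasure (\<nu> X) (A j \<inter> ?B)"
      by (intro nn_integral_cmult_indicator) (auto simp: sets_nu[OF X(1)])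
    also have "\<dots> \<le> Cm ^ (q + 5) * (ennreal ((1 / a) ^ (Max J - j)) * (C ^ (q + 6) * emeasure (\<nu> X) ?B))"
      by (intro mult_left_mono level_decay_geometric[OF jM x' \<rho> y']) simp
    also have "\<dots> \<le> Cm ^ (q + 5) * (ennreal ((1 / 2) ^ (Max J - j)) * (C ^ (q + 6) * emeasure (\<nu> X) ?B))"
      using a by (intro mult_left_mono mult_right_mono ennreal_leI power_mono divide_left_mono) auto
    finally show "(\<integral>\<^sup>+y\<in>?B. area \<Omega> m (density_of j) \<rho> y \<partial>\<nu> X) \<le> ennreal ((1 / 2) ^ (Max J - j)) * ?k"
      by (simp only: mult.left_commute)
  qed
  also have "\<dots> = ennreal (\<Sum>j\<in>J. (1 / 2) ^ (Max J - j)) * ?k"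
  proof -
    have "(\<Sum>j\<in>J. ennreal ((1 / 2) ^ (Max J - j))) = ennreal (\<Sum>j\<in>J. (1 / 2) ^ (Max J - j))"
      by (rule sum_ennreal) simp
    then show ?thesis by (simp only: sum_distrib_right[symmetric])
  qed
  also have "\<dots> \<le> ennreal 2 * ?k"
  proof (intro mult_right_mono ennreal_leI)
    have "(\<Sum>j\<in>J. (1 / 2 :: real) ^ (Max J - j)) \<le> (\<Sum>j\<le>Max J. (1 / 2) ^ (Max J - j))"
      using fin by (intro sum_mono2) auto
    also have "\<dots> \<le> 2" by (rule sum_half_powers_le)
    finally show "(\<Sum>j\<in>J. (1 / 2 :: real) ^ (Max J - j)) \<le> 2" .
  qed simp
  finally show ?thesis by (simp add: mult.assoc)
qed

text \<open>All layers are below height \<open>r / (32 * 2 ^ q)\<close>, so larger truncation heights of the cones make no difference.\<close>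

lemma area_G_height:
  assumes "r / (32 * 2 ^ q) \<le> \<rho>" "\<rho> \<le> R"
  shows "area \<Omega> m G R y = area \<Omega> m G \<rho> y"
proof -
  have "G Z * indicator (cone \<Omega> R y) Z = G Z * indicator (cone \<Omega> \<rho> y) Z" for Z
  proof (cases "\<exists>j<N. Z \<in> W j")
    case True
    then obtain j where "j < N" "Z \<in> W j" by auto
    then have "2 * bdist \<Omega> Z < r / (16 * 2 ^ q)" by (metis layer_cases)
    moreover have "r / (32 * 2 ^ q) = r / (16 * 2 ^ q) / 2" by simp
    ultimately have "bdist \<Omega> Z \<le> \<rho>" using assms by linarith
    then show ?thesis using assms by (auto simp: cone_def indicator_def)
  next
    case False
    then have "G Z = 0" by (simp add: G_def)
    then show ?thesis by simp
  qed
  then show ?thesis by (simp add: area_def)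
qed

text \<open>The local bound was obtained for the pole \<open>X\<close>.  On small balls the change of pole formula carries it to an arbitrary
pole; near the support of the layers \<open>X\<close> is remote, and elsewhere the area functional vanishes.  Large balls are
covered by small ones.\<close>

lemma Carleson_G: "Carleson \<Omega> m \<nu> G (2 * Cm ^ (q + 5) * C ^ (q + 12))"
  unfolding Carleson_def
proof (intro ballI allI impI)
  fix x' R Y assume x': "x' \<in> frontier \<Omega>" and R: "0 < R" and Y: "Y \<in> \<Omega>" "2 * R \<le> dist Y x'"
  let ?M = "2 * Cm ^ (q + 5) * C ^ (q + 6)"
  note meas = measurable_area[OF measurable_G]
  have small: "(\<integral>\<^sup>+y\<in>ball z \<rho>. area \<Omega> m G \<rho> y \<partial>\<nu> Y) \<le> (C ^ 2 * ?M) * emeasure (\<nu> Y) (ball z \<rho>)"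
    if z: "z \<in> frontier \<Omega>" and \<rho>: "0 < \<rho>" "8 * 2 ^ q * \<rho> \<le> r" and far: "2 * \<rho> \<le> dist Y z" for z \<rho>
  proof -
    have K\<rho>: "4 * \<rho> \<le> 2 ^ q * \<rho>" using pow_q \<rho> by (intro mult_right_mono) auto
    then have \<rho>r: "\<rho> \<le> r" using \<rho> by linarith
    show ?thesis
    proof (cases "dist z x \<le> 10 * r")
      case True
      have "2 * \<rho> \<le> dist X z"
        using X(2) True \<rho>r x(2) dist_triangle[of X x z] unfolding dist_commute[of z x] by linarith
      from nn_integral_change_pole[OF z \<rho>(1) X(1) this Y(1) far meas local_Carleson_bound[OF z True \<rho>]]
      show ?thesis .
    next
      case False
      have "(\<integral>\<^sup>+y\<in>ball z \<rho>. area \<Omega> m G \<rho> y \<partial>\<nu> Y) = (\<integral>\<^sup>+y. 0 \<partial>\<nu> Y)"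
      proof (rule nn_integral_cong_AE)
        show "AE y in \<nu> Y. area \<Omega> m G \<rho> y * indicator (ball z \<rho>) y = 0"
          using nu_AE_frontier[OF Y(1)]
        proof eventually_elim
          case (elim y)
          have "area \<Omega> m G \<rho> y = 0" if "dist z y < \<rho>"
            using False that \<rho>r x(2) dist_triangle[of z x y] by (intro area_G_away[OF elim]) linarith
          then show ?case by (auto simp: indicator_def)
        qed
      qed
      then show ?thesis by simp
    qed
  qed
  have C26: "C ^ 2 * ?M \<le> 2 * Cm ^ (q + 5) * C ^ (q + 12)"
  proof -
    have "C ^ 2 * ?M = 2 * Cm ^ (q + 5) * C ^ (q + 8)" by (simp add: power_add power_numeral_reduce ac_simps)
    also have "\<dots> \<le> 2 * Cm ^ (q + 5) * C ^ (q + 12)" by (intro mult_left_mono C_power_mono) auto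
    finally show ?thesis .
  qed
  show "(\<integral>\<^sup>+y\<in>ball x' R. area \<Omega> m G R y \<partial>\<nu> Y) \<le> 2 * Cm ^ (q + 5) * C ^ (q + 12) * emeasure (\<nu> Y) (ball x' R)"
  proof (cases "8 * 2 ^ q * R \<le> r")
    case True
    show ?thesis by (rule order_trans[OF small[OF x' R True Y(2)] mult_right_mono[OF C26]]) simp
  next
    case False
    \<comment> \<open>above the top of the layers, at most \<open>R / 3\<close>, and in the range of the bound for small balls\<close>
    define \<rho> where "\<rho> = r / (24 * 2 ^ q)"
    have \<rho>: "0 < \<rho>" "8 * 2 ^ q * \<rho> \<le> r" "3 * \<rho> \<le> R" "r / (32 * 2 ^ q) \<le> \<rho>"
      using False x by (auto simp: \<rho>_def field_simps)
    have "(\<integral>\<^sup>+y\<in>ball x' R. area \<Omega> m G R y \<partial>\<nu> Y) = (\<integral>\<^sup>+y\<in>ball x' R. area \<Omega> m G \<rho> y \<partial>\<nu> Y)"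
      using \<rho> by (subst area_G_height[of \<rho>]) auto
    also have "\<dots> \<le> (C ^ 2 * ?M) * C ^ 4 * emeasure (\<nu> Y) (ball x' R)"
    proof (rule local_to_global[OF x' R Y \<rho>(1,3) meas])
      fix y assume y: "y \<in> frontier \<Omega>" "dist y x' < R"
      have "2 * \<rho> \<le> dist Y y"
        using Y(2) y(2) \<rho>(1,3) dist_triangle[of Y x' y] by linarith
      then show "(\<integral>\<^sup>+z\<in>ball y \<rho>. area \<Omega> m G \<rho> z \<partial>\<nu> Y) \<le> C ^ 2 * ?M * emeasure (\<nu> Y) (ball y \<rho>)"
        by (rule small[OF y(1) \<rho>(1,2)])
    qed
    also have "(C ^ 2 * ?M) * C ^ 4 = 2 * Cm ^ (q + 5) * C ^ (q + 12)"
      by (simp add: power_add power_numeral_reduce ac_simps)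
    finally show ?thesis .
  qed
qed

end

context sawtooth
begin

lemma U_subset_level:
  assumes z: "z \<in> U" "z \<in> frontier \<Omega>"
  shows "z \<in> A j"
proof -
  obtain e where e: "e > 0" "ball z e \<subseteq> U" using U(1) z(1) by (meson open_contains_ball)
  define s where "s = min e r"
  have s: "0 < s" "s \<le> r" "ball z s \<subseteq> U" using e x by (auto simp: s_def)
  have "t j * emeasure (\<nu> X) (ball z s) < 1 * emeasure (\<nu> X) (ball z s)"
    using t_pos(3)[of j] nu_pos[OF X(1) z(2) s(1)] nu_finite[OF X(1), of "ball z s"]
    unfolding mult.commute[of _ "emeasure (\<nu> X) (ball z s)"]
    by (intro ennreal_mult_strict_left_mono) auto
  then have "t j * emeasure (\<nu> X) (ball z s) < emeasure (\<nu> X) (ball z s \<inter> U)"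
    using s(3) by (simp add: Int_absorb2)
  then show ?thesis using z s unfolding level_set_def by force
qed

text \<open>The ball around the corkscrew point \<open>Z0\<close> of radius \<open>\<delta>(Z0) / 8\<close> lies in the layer and in the cone at every
\<open>y\<close> close to the foot \<open>z'\<close> of \<open>Z0\<close>.  The cone at \<open>z\<close> itself may be empty near \<open>z\<close>, since the aperture \<open>2\<close> may be smaller than \<open>1 / c\<close>.\<close>

lemma area_layer_lower_bound:
  assumes Z0: "Z0 \<in> \<Omega>" "c * (d / 20) \<le> bdist \<Omega> Z0" "dist Z0 z < d / 20"
    and z: "z \<in> frontier \<Omega>" "d = infdist z (frontier \<Omega> - A j)" "d \<le> r"
    and foot: "z' \<in> frontier \<Omega>" "dist z' Z0 = bdist \<Omega> Z0" and y: "dist z' y < bdist \<Omega> Z0 / 8"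
  shows "1 \<le> Cm ^ 2 * area \<Omega> m (density_of j) (2 * r) y"
proof -
  let ?\<delta> = "bdist \<Omega>"
  let ?B = "ball Z0 (?\<delta> Z0 / 8)"
  let ?\<mu>0 = "emeasure m (?B \<inter> \<Omega>)"
  have fne: "frontier \<Omega> \<noteq> {}" using z by auto
  have \<delta>0: "0 < ?\<delta> Z0" by (rule bdist_pos[OF open_domain fne Z0(1)])
  have Z0cl: "Z0 \<in> closure \<Omega>" using Z0(1) closure_subset by blast
  have \<delta>d: "?\<delta> Z0 < d / 20" using bdist_le[OF z(1), of Z0] Z0(3) by linarith
  have d: "0 < d" using \<delta>0 \<delta>d by linarith
  have \<mu>0: "?\<mu>0 \<noteq> 0" "?\<mu>0 \<noteq> \<top>"
    using m_ball_pos[OF Z0cl, of "?\<delta> Z0 / 8"] m_ball_finite[of Z0 "?\<delta> Z0 / 8"] \<delta>0 by auto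
  define k where "k = Cm ^ 2 * ?\<mu>0"
  have k: "k \<noteq> 0" "k \<noteq> \<top>"
    using \<mu>0 Cm_ge Cm_finite by (auto simp: k_def ennreal_mult_eq_top_iff power_eq_top_ennreal_iff)
  have pointwise: "(1 / k) * indicator (?B \<inter> \<Omega>) Z \<le> density_of j Z * indicator (cone \<Omega> (2 * r) y) Z"
    if Z: "Z \<in> \<Omega>" for Z
  proof (cases "Z \<in> ?B")
    case True
    then have near: "dist Z0 Z < ?\<delta> Z0 / 8" by simp
    have lo: "7 / 8 * ?\<delta> Z0 \<le> ?\<delta> Z" and hi: "?\<delta> Z \<le> 9 / 8 * ?\<delta> Z0"
      using bdist_lipschitz[of \<Omega> Z0 Z] near by linarith+
    have "dist Z y \<le> dist Z0 Z + dist z' Z0 + dist z' y"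
      using dist_triangle[of Z y Z0] dist_triangle[of Z0 y z'] by (simp add: dist_commute)
    then have "dist Z y \<le> 2 * ?\<delta> Z" using near foot(2) y lo \<delta>0 by linarith
    moreover have "2 * ?\<delta> Z \<le> 2 * (2 * r)" using hi \<delta>d z(3) d by linarith
    ultimately have cone: "Z \<in> cone \<Omega> (2 * r) y" using Z by (simp add: cone_def)
    let ?D = "infdist Z (frontier \<Omega> - A j)"
    have Zz: "dist Z z < d / 20 + d / 160"
      using near \<delta>d Z0(3) dist_triangle[of Z z Z0] unfolding dist_commute[of Z Z0] by linarith
    have "\<bar>?D - d\<bar> \<le> dist Z z" unfolding z(2) by (rule infdist_triangle_abs)
    then have D: "9 / 10 * d \<le> ?D" "?D \<le> 11 / 10 * d" using Zz d by linarith+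
    have "3 * ?\<delta> Z < ?D" using D(1) hi \<delta>d d by linarith
    moreover have "?D \<le> 2 ^ q * ?\<delta> Z"
    proof -
      have "11 / 10 * d \<le> (100 * d) * (7 / 160)" using d by simp
      also have "\<dots> \<le> (c * 2 ^ q * d) * (7 / 160)"
        using cq d by (intro mult_right_mono) auto
      also have "\<dots> = 2 ^ q * (7 / 8 * (c * (d / 20)))" by simp
      also have "\<dots> \<le> 2 ^ q * ?\<delta> Z" using Z0(2) lo by (intro mult_left_mono) auto
      finally show ?thesis using D(2) by linarith
    qed
    ultimately have "Z \<in> W j" using Z by (simp add: layer_def)
    moreover have "1 / k \<le> 1 / whitney_mass \<Omega> m Z"
    proof -
      have "whitney_mass \<Omega> m Z \<le> emeasure m (ball Z0 (2 ^ 2 * (?\<delta> Z0 / 8)) \<inter> \<Omega>)"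
        unfolding whitney_mass_eq[OF Z] using near hi \<delta>0
        by (intro m_mono ball_subset_ball_iff[THEN iffD2] disjI1) (auto simp: dist_commute)
      also have "\<dots> \<le> k" unfolding k_def using \<delta>0 by (intro m_doubling_iterated[OF Z0cl]) auto
      finally show ?thesis using whitney_mass_pos[OF fne Z] k by (intro ennreal_one_divide_antimono)
    qed
    ultimately show ?thesis using True Z cone by simp
  qed simp
  have "(1 / k) * ?\<mu>0 = (\<integral>\<^sup>+Z. (1 / k) * indicator (?B \<inter> \<Omega>) Z \<partial>m)"
    by (intro nn_integral_cmult_indicator[symmetric] borel_Int_sets_m) simp
  also have "\<dots> \<le> area \<Omega> m (density_of j) (2 * r) y"
    unfolding area_def by (rule nn_integral_mono_m[OF pointwise])
  finally have "Cm ^ 2 * ((1 / k) * ?\<mu>0) \<le> Cm ^ 2 * area \<Omega> m (density_of j) (2 * r) y"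
    by (rule mult_left_mono) simp
  moreover have "Cm ^ 2 * ((1 / k) * ?\<mu>0) = k / k"
    unfolding k_def by (simp add: divide_ennreal_def ac_simps)
  moreover have "k / k = 1" using k by (simp add: ennreal_divide_self less_top)
  ultimately show ?thesis by simp
qed

text \<open>The pointwise lower bound holds only near the feet of corkscrew points.  By doubling, the balls around the feet carry a
fixed share of the \<open>\<nu>0\<close> measure of balls that cover \<open>E\<close>, so Vitali's lemma yields the integrated bound.\<close>

lemma layer_energy_lower_bound:
  assumes "elliptic_family \<Omega> c \<nu>0 C" and E: "E \<in> sets borel" "E \<subseteq> U" and j: "j < N"
  shows "emeasure (\<nu>0 X) E
    \<le> (Cm ^ 2 * C ^ (q + 2)) * (\<integral>\<^sup>+y\<in>ball x (2 * r). area \<Omega> m (density_of j) (2 * r) y \<partial>\<nu>0 X)"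
proof -
  interpret F0: elliptic_family \<Omega> c \<nu>0 C by fact
  let ?h = "area \<Omega> m (density_of j) (2 * r)" and ?\<delta> = "bdist \<Omega>"
  let ?A = "frontier \<Omega> - A j"
  define d where "d z = infdist z ?A" for z
  have h: "?h \<in> borel_measurable borel" by (rule measurable_area[OF measurable_layer_density])
  define \<eta> where "\<eta> = density (\<nu>0 X) ?h"
  have eta: "emeasure \<eta> S = (\<integral>\<^sup>+y\<in>S. ?h y \<partial>\<nu>0 X)" if "S \<in> sets borel" for S
    unfolding \<eta>_def using that F0.sets_nu[OF X(1)]
    by (intro emeasure_density F0.borel_measurable_nu[OF X(1) h]) simp
  have d_bounds: "0 < d z" "d z < r / (16 * 2 ^ q)" "dist z x < r" if z: "z \<in> E" "z \<in> frontier \<Omega>" for z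
  proof -
    have zU: "z \<in> U" using z E by auto
    then show zx: "dist z x < r" using U by (auto simp: dist_commute)
    have cl: "closed ?A" by (intro closed_Diff) auto
    have "z \<notin> ?A" using U_subset_level[OF zU z(2)] by simp
    then show "0 < d z"
      unfolding d_def by (rule infdist_pos_not_in_closed[OF cl complement_nonempty[OF j]])
    obtain y where y: "y \<in> frontier \<Omega>" "y \<notin> A j" "dist y z < r / (16 * 2 ^ q)"
      using level_complement_near[OF z(2) _ t_ge[OF j]] zx x by force
    have "d z \<le> dist z y" unfolding d_def using y by (intro infdist_le) auto
    then show "d z < r / (16 * 2 ^ q)" using y by (simp add: dist_commute)
  qed
  have small: "r / (16 * 2 ^ q) \<le> r / 64"
    using pow_q x by (intro divide_left_mono) auto
  have "emeasure (\<nu>0 X) E = emeasure (\<nu>0 X) (E \<inter> frontier \<Omega>)"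
    by (rule F0.nu_Int_frontier[OF X(1) E(1), symmetric])
  also have "\<dots> \<le> (Cm ^ 2 * C ^ (q + 2)) * emeasure \<eta> (ball x (2 * r))"
  proof (rule vitali_measure_comparison[where a = "\<lambda>z. z" and r = "\<lambda>z. d z / 5" and R = r and I = "E \<inter> frontier \<Omega>"])
    show "E \<inter> frontier \<Omega> \<subseteq> (\<Union>z\<in>E \<inter> frontier \<Omega>. ball z (d z / 5))"
      using d_bounds by force
    fix z assume z: "z \<in> E \<inter> frontier \<Omega>"
    note db = d_bounds[of z]
    have zf: "z \<in> frontier \<Omega>" using z by simp
    have d: "0 < d z" "d z < r / (16 * 2 ^ q)" "dist z x < r" "d z < r / 64"
      using db z small by auto
    show "0 < d z / 5 \<and> d z / 5 \<le> r" using d x by auto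
    show "ball z (d z / 5) \<subseteq> ball x (2 * r)"
      using d x by (intro ball_subset_ball_iff[THEN iffD2] disjI1) auto
    have Xz: "199 * r \<le> dist X z" using X(2) d(3) dist_triangle[of X x z] by linarith
    obtain Z0 where Z0: "Z0 \<in> \<Omega>" "dist Z0 z < d z / 20" "c * (d z / 20) \<le> ?\<delta> Z0"
      by (rule exists_corkscrew_ball[OF zf _ X(1), of "d z / 20"]) (use d Xz x in auto)
    have \<delta>0: "0 < ?\<delta> Z0" "?\<delta> Z0 < d z / 20"
      using bdist_pos[OF open_domain _ Z0(1)] zf bdist_le[OF zf, of Z0] Z0(2) by auto
    obtain z' where z': "z' \<in> frontier \<Omega>" "dist z' Z0 = ?\<delta> Z0" using exists_foot[of \<Omega> Z0] zf by blast
    have z'z: "dist z' z < d z / 10"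
      using z'(2) \<delta>0 Z0(2) dist_triangle[of z' z Z0] by linarith
    let ?B = "ball z' (?\<delta> Z0 / 8)"
    have "emeasure (\<nu>0 X) (ball z (5 * (d z / 5))) \<le> C ^ (q + 2) * emeasure (\<nu>0 X) ?B"
    proof (rule F0.ball_comparison[OF z'(1) _ X(1)])
      have eq: "2 ^ (q + 2) * (?\<delta> Z0 / 8) = 2 ^ q * ?\<delta> Z0 / 2" by (simp add: power_add)
      have "2 ^ q * ?\<delta> Z0 \<le> 2 ^ q * (r / (16 * 2 ^ q))"
        using \<delta>0 d by (intro mult_left_mono) auto
      also have "\<dots> = r / 16" by simp
      finally show "2 * (2 ^ (q + 2) * (?\<delta> Z0 / 8)) \<le> dist X z'"
        unfolding eq using Xz z'z d x dist_triangle[of X z z'] by linarith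
      have "5 * d z = (100 * d z) / 20" by simp
      also have "\<dots> \<le> (c * 2 ^ q * d z) / 20"
        using cq d by (intro divide_right_mono mult_right_mono) auto
      also have "\<dots> = 2 ^ q * (c * (d z / 20))" by simp
      also have "\<dots> \<le> 2 ^ q * ?\<delta> Z0" using Z0(3) by (intro mult_left_mono) auto
      finally have "5 * d z \<le> 2 ^ q * ?\<delta> Z0" .
      then show "ball z (5 * (d z / 5)) \<subseteq> ball z' (2 ^ (q + 2) * (?\<delta> Z0 / 8))"
        unfolding eq using z'z d
        by (intro ball_subset_ball_iff[THEN iffD2] disjI1) (simp add: dist_commute)
    qed (use \<delta>0 in simp)
    also have "emeasure (\<nu>0 X) ?B \<le> (\<integral>\<^sup>+y. Cm ^ 2 * (?h y * indicator ?B y) \<partial>\<nu>0 X)"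
    proof -
      have "emeasure (\<nu>0 X) ?B = (\<integral>\<^sup>+y. indicator ?B y \<partial>\<nu>0 X)"
        using F0.sets_nu[OF X(1)] by simp
      also have "\<dots> \<le> (\<integral>\<^sup>+y. Cm ^ 2 * (?h y * indicator ?B y) \<partial>\<nu>0 X)"
      proof (rule nn_integral_mono)
        fix y
        show "indicator ?B y \<le> Cm ^ 2 * (?h y * indicator ?B y)"
        proof (cases "y \<in> ?B")
          case True
          then show ?thesis
            using area_layer_lower_bound[OF Z0(1,3,2) zf d_def _ z'] d x by simp
        qed simp
      qed
      finally show ?thesis .
    qed
    also have "\<dots> = Cm ^ 2 * emeasure \<eta> ?B"
      unfolding eta[OF borel_open[OF open_ball]]
      by (intro nn_integral_cmult borel_measurable_times_ennreal F0.borel_measurable_nu[OF X(1) h]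
          borel_measurable_indicator) (simp add: F0.sets_nu[OF X(1)])
    also have "emeasure \<eta> ?B \<le> emeasure \<eta> (ball z (d z / 5))"
    proof (rule emeasure_mono)
      show "?B \<subseteq> ball z (d z / 5)"
        using z'z \<delta>0 d by (intro ball_subset_ball_iff[THEN iffD2] disjI1) simp
    qed (simp add: \<eta>_def F0.sets_nu[OF X(1)])
    finally have "emeasure (\<nu>0 X) (ball z (5 * (d z / 5)))
        \<le> C ^ (q + 2) * (Cm ^ 2 * emeasure \<eta> (ball z (d z / 5)))"
      by (simp add: mult_left_mono)
    then show "emeasure (\<nu>0 X) (ball z (5 * (d z / 5)))
        \<le> (Cm ^ 2 * C ^ (q + 2)) * emeasure \<eta> (ball z (d z / 5))"
      by (simp only: ac_simps)
  qed (auto simp: \<eta>_def F0.sets_nu[OF X(1)])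
  finally show ?thesis by (simp add: eta)
qed

lemma energy_lower_bound:
  assumes F: "elliptic_family \<Omega> c \<nu>0 C" and E: "E \<in> sets borel" "E \<subseteq> U"
  shows "of_nat N * emeasure (\<nu>0 X) E
    \<le> (Cm ^ 2 * C ^ (q + 2)) * (\<integral>\<^sup>+y\<in>ball x (2 * r). area \<Omega> m G (2 * r) y \<partial>\<nu>0 X)"
proof -
  interpret F0: elliptic_family \<Omega> c \<nu>0 C by fact
  have "of_nat N * emeasure (\<nu>0 X) E = (\<Sum>j<N. emeasure (\<nu>0 X) E)" by simp
  also have "\<dots> \<le> (\<Sum>j<N. (Cm ^ 2 * C ^ (q + 2)) *
      (\<integral>\<^sup>+y\<in>ball x (2 * r). area \<Omega> m (density_of j) (2 * r) y \<partial>\<nu>0 X))"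
    by (intro sum_mono layer_energy_lower_bound[OF F E]) simp
  also have "\<dots> = (Cm ^ 2 * C ^ (q + 2)) *
      (\<Sum>j<N. \<integral>\<^sup>+y\<in>ball x (2 * r). area \<Omega> m (density_of j) (2 * r) y \<partial>\<nu>0 X)"
    by (rule sum_distrib_left[symmetric])
  also have "(\<Sum>j<N. \<integral>\<^sup>+y\<in>ball x (2 * r). area \<Omega> m (density_of j) (2 * r) y \<partial>\<nu>0 X)
      = (\<integral>\<^sup>+y\<in>ball x (2 * r). area \<Omega> m G (2 * r) y \<partial>\<nu>0 X)"
    unfolding area_G sum_distrib_right
    by (intro nn_integral_sum[symmetric] borel_measurable_times_ennreal F0.borel_measurable_nu[OF X(1)]
        measurable_area measurable_layer_density borel_measurable_indicator)
      (simp add: F0.sets_nu[OF X(1)])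
  finally show ?thesis .
qed

end

section \<open>Test functions for absolute continuity\<close>

context weighted_domain
begin

lemma Carleson_suminf:
  fixes G :: "nat \<Rightarrow> real ^ 'n \<Rightarrow> ennreal"
  assumes G: "\<And>k. G k \<in> borel_measurable m" and sets: "\<And>X. X \<in> \<Omega> \<Longrightarrow> sets (\<nu> X) = sets borel"
    and carleson: "\<And>k. Carleson \<Omega> m \<nu> (G k) (M k)"
  shows "Carleson \<Omega> m \<nu> (\<lambda>Z. \<Sum>k. G k Z) (\<Sum>k. M k)"
  unfolding Carleson_def
proof (intro ballI allI impI)
  fix x r X assume x: "x \<in> frontier \<Omega>" "0 < r" and X: "X \<in> \<Omega>" "2 * r \<le> dist X x"
  have area: "area \<Omega> m (\<lambda>Z. \<Sum>k. G k Z) r y = (\<Sum>k. area \<Omega> m (G k) r y)" for y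
  proof -
    have "area \<Omega> m (\<lambda>Z. \<Sum>k. G k Z) r y = (\<integral>\<^sup>+Z. (\<Sum>k. G k Z * indicator (cone \<Omega> r y) Z) \<partial>m)"
      unfolding area_def by (simp add: ennreal_suminf_multc)
    also have "\<dots> = (\<Sum>k. \<integral>\<^sup>+Z. G k Z * indicator (cone \<Omega> r y) Z \<partial>m)"
      by (intro nn_integral_suminf borel_measurable_times_ennreal G borel_measurable_indicator cone_sets_m)
    finally show ?thesis by (simp add: area_def)
  qed
  have meas: "(\<lambda>y. area \<Omega> m (G k) r y * indicator (ball x r) y) \<in> borel_measurable (\<nu> X)" for k
    using measurable_area[OF G, of k r] sets[OF X(1)]
    by (intro borel_measurable_times_ennreal borel_measurable_indicator)
      (simp_all add: measurable_cong_sets[OF sets[OF X(1)] refl])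
  have "(\<integral>\<^sup>+y\<in>ball x r. area \<Omega> m (\<lambda>Z. \<Sum>k. G k Z) r y \<partial>\<nu> X)
      = (\<integral>\<^sup>+y. (\<Sum>k. area \<Omega> m (G k) r y * indicator (ball x r) y) \<partial>\<nu> X)"
    unfolding area by (simp add: ennreal_suminf_multc)
  also have "\<dots> = (\<Sum>k. \<integral>\<^sup>+y\<in>ball x r. area \<Omega> m (G k) r y \<partial>\<nu> X)"
    by (rule nn_integral_suminf[OF meas])
  also have "\<dots> \<le> (\<Sum>k. M k * emeasure (\<nu> X) (ball x r))"
    using carleson x X by (intro suminf_le) (auto simp: Carleson_def)
  also have "\<dots> = (\<Sum>k. M k) * emeasure (\<nu> X) (ball x r)" by simp
  finally show "(\<integral>\<^sup>+y\<in>ball x r. area \<Omega> m (\<lambda>Z. \<Sum>k. G k Z) r y \<partial>\<nu> X)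
      \<le> (\<Sum>k. M k) * emeasure (\<nu> X) (ball x r)" .
qed

lemma measurable_whitney_density:
  assumes "g \<in> borel_measurable borel"
  shows "(\<lambda>Z. ennreal (g Z) / whitney_mass \<Omega> m Z) \<in> borel_measurable m"
  using measurable_m_of_borel[OF assms]
  by (intro borel_measurable_divide_ennreal measurable_whitney_mass measurable_compose[OF _ measurable_ennreal])

lemma Carleson_scale:
  assumes G: "G \<in> borel_measurable m" and sets: "\<And>X. X \<in> \<Omega> \<Longrightarrow> sets (\<nu> X) = sets borel"
    and carleson: "Carleson \<Omega> m \<nu> G M"
  shows "Carleson \<Omega> m \<nu> (\<lambda>Z. k * G Z) (k * M)"
  unfolding Carleson_def
proof (intro ballI allI impI)
  fix x r X assume x: "x \<in> frontier \<Omega>" "0 < r" and X: "X \<in> \<Omega>" "2 * r \<le> dist X x"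
  have area: "area \<Omega> m (\<lambda>Z. k * G Z) r y = k * area \<Omega> m G r y" for y
    unfolding area_def mult.assoc
    by (intro nn_integral_cmult borel_measurable_times_ennreal G borel_measurable_indicator cone_sets_m)
  have "(\<integral>\<^sup>+y\<in>ball x r. area \<Omega> m (\<lambda>Z. k * G Z) r y \<partial>\<nu> X) = k * (\<integral>\<^sup>+y\<in>ball x r. area \<Omega> m G r y \<partial>\<nu> X)"
    unfolding area mult.assoc using measurable_area[OF G, of r] sets[OF X(1)]
    by (intro nn_integral_cmult borel_measurable_times_ennreal borel_measurable_indicator)
      (simp_all add: measurable_cong_sets[OF sets[OF X(1)] refl])
  also have "\<dots> \<le> k * (M * emeasure (\<nu> X) (ball x r))"
    using carleson x X by (intro mult_left_mono) (auto simp: Carleson_def)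
  finally show "(\<integral>\<^sup>+y\<in>ball x r. area \<Omega> m (\<lambda>Z. k * G Z) r y \<partial>\<nu> X) \<le> k * M * emeasure (\<nu> X) (ball x r)"
    by (simp add: mult.assoc)
qed

end

context two_families
begin

text \<open>The test function is the indicator of the union of the layers over an open set \<open>U\<close> containing \<open>E\<close>, which exists by outer
regularity of \<open>\<nu>1 X\<close>.\<close>

lemma sawtooth_test_function:
  assumes q: "2 \<le> q" "100 \<le> c * 2 ^ q" and a: "2 \<le> a" "C ^ (q + 6) < ennreal a"
    and \<zeta>: "C ^ (q + 9) * \<zeta> \<le> ennreal (1 / a ^ N)"
    and x: "x \<in> frontier \<Omega>" "0 < r" and X: "X \<in> \<Omega>" "200 * r \<le> dist X x"
    and E: "E \<in> sets borel" "E \<subseteq> ball x r"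
    and small: "emeasure (\<nu>1 X) E < \<zeta> * emeasure (\<nu>1 X) (ball x r)"
  obtains g :: "real ^ 'n \<Rightarrow> real" where "g \<in> borel_measurable borel" "\<And>Z. 0 \<le> g Z" "\<And>Z. g Z \<le> 1"
    "Carleson \<Omega> m \<nu>1 (\<lambda>Z. ennreal (g Z) / whitney_mass \<Omega> m Z) (2 * Cm ^ (q + 5) * C ^ (q + 12))"
    "of_nat N * emeasure (\<nu>0 X) E \<le> (Cm ^ 2 * C ^ (q + 2)) *
      (\<integral>\<^sup>+y\<in>ball x (2 * r). area \<Omega> m (\<lambda>Z. ennreal (g Z) / whitney_mass \<Omega> m Z) (2 * r) y \<partial>\<nu>0 X)"
proof -
  have "(INF V \<in> {V. E \<subseteq> V \<and> open V}. emeasure (\<nu>1 X) V) < \<zeta> * emeasure (\<nu>1 X) (ball x r)"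
    using small E F1.sets_nu[OF X(1)] F1.nu_finite[OF X(1), of "space (\<nu>1 X)"]
    by (subst outer_regular[symmetric]) auto
  then obtain V where V: "E \<subseteq> V" "open V" "emeasure (\<nu>1 X) V < \<zeta> * emeasure (\<nu>1 X) (ball x r)"
    by (auto simp: INF_less_iff)
  define U where "U = V \<inter> ball x r"
  have U: "open U" "E \<subseteq> U" "U \<subseteq> ball x r" using V E by (auto simp: U_def)
  have "emeasure (\<nu>1 X) U \<le> emeasure (\<nu>1 X) V" using V by (intro F1.nu_mono[OF X(1)]) (auto simp: U_def)
  also have "\<dots> < \<zeta> * emeasure (\<nu>1 X) (ball x r)" by fact
  finally have "C ^ (q + 9) * emeasure (\<nu>1 X) U < C ^ (q + 9) * (\<zeta> * emeasure (\<nu>1 X) (ball x r))"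
    using F1.C_power_ge[of "q + 9"] F1.C_power_finite[of "q + 9"]
    by (intro ennreal_mult_strict_left_mono) (auto simp: order.strict_trans2[OF zero_less_one])
  also have "\<dots> \<le> ennreal (1 / a ^ N) * emeasure (\<nu>1 X) (ball x r)"
    unfolding mult.assoc[symmetric] using \<zeta> by (rule mult_right_mono) simp
  finally have smallU: "C ^ (q + 9) * emeasure (\<nu>1 X) U < ennreal (1 / a ^ N) * emeasure (\<nu>1 X) (ball x r)" .
  interpret S: sawtooth \<Omega> m Cm c \<nu>1 C X x r U q a N
    by unfold_locales (use X x U q a smallU in auto)
  define g where "g Z = (\<Sum>j<N. indicator (S.W j) Z :: real)" for Z
  show thesis
  proof (rule that)
    show "g \<in> borel_measurable borel"
      unfolding g_def[abs_def] by (intro borel_measurable_sum borel_measurable_indicator layer_borel open_Omega)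
    show "0 \<le> g Z" for Z unfolding g_def by (intro sum_nonneg) simp
    show "g Z \<le> 1" for Z
    proof (cases "\<exists>j<N. Z \<in> S.W j")
      case True
      then obtain j where j: "j < N" "Z \<in> S.W j" by auto
      have "Z \<notin> S.W i" if "i < N" "i \<noteq> j" for i
        using S.layers_disjoint[of Z i j] S.layers_disjoint[of Z j i] that j by (meson linorder_neqE_nat)
      then have "g Z = (\<Sum>i<N. if i = j then 1 else 0)"
        unfolding g_def using j by (intro sum.cong) (auto simp: indicator_def)
      then show ?thesis using j by simp
    next
      case False
      then show ?thesis by (simp add: g_def)
    qed
    have G: "ennreal (g Z) / whitney_mass \<Omega> m Z = S.G Z" for Z
    proof -
      have "ennreal (g Z) = (\<Sum>j<N. indicator (S.W j) Z)"
        unfolding g_def by (subst sum_ennreal[symmetric]) (auto simp: ennreal_indicator)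
      then show ?thesis by (simp add: S.G_def divide_ennreal_def sum_distrib_right)
    qed
    show "Carleson \<Omega> m \<nu>1 (\<lambda>Z. ennreal (g Z) / whitney_mass \<Omega> m Z) (2 * Cm ^ (q + 5) * C ^ (q + 12))"
      unfolding G by (rule S.Carleson_G)
    show "of_nat N * emeasure (\<nu>0 X) E \<le> (Cm ^ 2 * C ^ (q + 2)) *
      (\<integral>\<^sup>+y\<in>ball x (2 * r). area \<Omega> m (\<lambda>Z. ennreal (g Z) / whitney_mass \<Omega> m Z) (2 * r) y \<partial>\<nu>0 X)"
      unfolding G by (rule S.energy_lower_bound[OF F0.elliptic_family_axioms E(1) U(2)])
  qed
qed

text \<open>Passing to a smaller ball makes the pole remote.  Some small ball around a point of \<open>ball x r\<close> inherits the \<open>\<nu>0\<close> density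
of \<open>E\<close>, since otherwise the local bounds would add up to a contradiction; its \<open>\<nu>1\<close> measure is comparable to that of
\<open>ball x r\<close>, so \<open>E\<close> is \<open>\<nu>1\<close>-small in it as well.\<close>

lemma relocate_bad_set:
  assumes x: "x \<in> frontier \<Omega>" "0 < r" and X: "X \<in> \<Omega>" "2 * r \<le> dist X x"
    and E: "E \<in> sets borel" "E \<subseteq> ball x r"
    and small: "emeasure (\<nu>1 X) E < \<zeta> * emeasure (\<nu>1 X) (ball x r)"
    and large: "\<xi> * C ^ 4 * emeasure (\<nu>0 X) (ball x r) < emeasure (\<nu>0 X) E"
  obtains y where "y \<in> frontier \<Omega>" "200 * (r / 2 ^ 8) \<le> dist X y"
    "emeasure (\<nu>1 X) (E \<inter> ball y (r / 2 ^ 8)) < \<zeta> * C ^ 12 * emeasure (\<nu>1 X) (ball y (r / 2 ^ 8))"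
    "\<xi> * emeasure (\<nu>0 X) (ball y (r / 2 ^ 8)) \<le> emeasure (\<nu>0 X) (E \<inter> ball y (r / 2 ^ 8))"
proof -
  let ?\<rho> = "r / 2 ^ 8"
  have int: "(\<integral>\<^sup>+z\<in>ball y s. indicator E z \<partial>\<nu>0 X) = emeasure (\<nu>0 X) (E \<inter> ball y s)" for y s
  proof -
    have "(\<integral>\<^sup>+z\<in>ball y s. indicator E z \<partial>\<nu>0 X) = (\<integral>\<^sup>+z. indicator (E \<inter> ball y s) z \<partial>\<nu>0 X)"
      by (simp only: indicator_inter_arith)
    also have "\<dots> = emeasure (\<nu>0 X) (E \<inter> ball y s)"
      using E F0.sets_nu[OF X(1)] by (intro nn_integral_indicator) auto
    finally show ?thesis .
  qed
  have "\<exists>y\<in>frontier \<Omega>. dist y x < r \<and> \<xi> * emeasure (\<nu>0 X) (ball y ?\<rho>) < emeasure (\<nu>0 X) (E \<inter> ball y ?\<rho>)"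
  proof (rule ccontr)
    assume none: "\<not> (\<exists>y\<in>frontier \<Omega>. dist y x < r \<and> \<xi> * emeasure (\<nu>0 X) (ball y ?\<rho>) < emeasure (\<nu>0 X) (E \<inter> ball y ?\<rho>))"
    have "(\<integral>\<^sup>+z\<in>ball x r. indicator E z \<partial>\<nu>0 X) \<le> \<xi> * C ^ 4 * emeasure (\<nu>0 X) (ball x r)"
    proof (rule F0.local_to_global[OF x X])
      show "(\<integral>\<^sup>+z\<in>ball y ?\<rho>. indicator E z \<partial>\<nu>0 X) \<le> \<xi> * emeasure (\<nu>0 X) (ball y ?\<rho>)"
        if "y \<in> frontier \<Omega>" "dist y x < r" for y
        unfolding int using none that by (auto simp: not_less)
    qed (use x E in auto)
    then show False using large E(2) unfolding int by (simp add: Int_absorb2)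
  qed
  then obtain y where y: "y \<in> frontier \<Omega>" "dist y x < r"
    and dense: "\<xi> * emeasure (\<nu>0 X) (ball y ?\<rho>) < emeasure (\<nu>0 X) (E \<inter> ball y ?\<rho>)" by auto
  have "emeasure (\<nu>1 X) (E \<inter> ball y ?\<rho>) \<le> emeasure (\<nu>1 X) E"
    using E by (intro F1.nu_mono[OF X(1)]) auto
  also have "\<dots> < \<zeta> * emeasure (\<nu>1 X) (ball x r)" by fact
  also have "\<dots> \<le> \<zeta> * (C ^ (8 + 4) * emeasure (\<nu>1 X) (ball y ?\<rho>))"
    by (intro mult_left_mono F1.relocation[OF x X y]) auto
  finally have "emeasure (\<nu>1 X) (E \<inter> ball y ?\<rho>) < \<zeta> * C ^ 12 * emeasure (\<nu>1 X) (ball y ?\<rho>)"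
    by (simp add: mult.assoc)
  moreover have "200 * ?\<rho> \<le> dist X y"
    using X(2) y(2) x dist_triangle[of X x y] by simp
  ultimately show thesis using y dense by (intro that[of y]) auto
qed

text \<open>If the conclusion fails for \<open>\<xi>\<close>, there are test functions \<open>g k\<close> with \<open>4 ^ k\<close> layers and a common Carleson constant for
\<open>\<nu>1\<close>.  Their sum with weights \<open>2 ^ - k\<close> inherits the condition for \<open>\<nu>1\<close>, hence satisfies it for \<open>\<nu>0\<close> with some
constant \<open>M0\<close>.  The term \<open>k\<close> forces \<open>2 ^ k * \<xi>\<close> to be bounded by a multiple of \<open>M0\<close>.\<close>

lemma absolute_continuity_from_Carleson_transfer:
  assumes transfer: "\<forall>g :: real ^ 'n \<Rightarrow> real. g \<in> borel_measurable borel \<longrightarrow> (\<forall>Z. 0 \<le> g Z \<and> g Z \<le> 2) \<longrightarrow>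
      (\<exists>M<\<infinity>. Carleson \<Omega> m \<nu>1 (\<lambda>Z. ennreal (g Z) / whitney_mass \<Omega> m Z) M) \<longrightarrow>
      (\<exists>M<\<infinity>. Carleson \<Omega> m \<nu>0 (\<lambda>Z. ennreal (g Z) / whitney_mass \<Omega> m Z) M)"
    and \<xi>: "0 < \<xi>"
  obtains \<zeta> :: ennreal where "0 < \<zeta>" "\<zeta> < \<infinity>"
    "\<And>x r X E. x \<in> frontier \<Omega> \<Longrightarrow> 0 < r \<Longrightarrow> X \<in> \<Omega> \<Longrightarrow> 2 * r \<le> dist X x \<Longrightarrow> E \<in> sets borel \<Longrightarrow>
      E \<subseteq> ball x r \<Longrightarrow> emeasure (\<nu>1 X) E < \<zeta> * emeasure (\<nu>1 X) (ball x r) \<Longrightarrow>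
      emeasure (\<nu>0 X) E \<le> \<xi> * C ^ 4 * emeasure (\<nu>0 X) (ball x r)"
proof (rule ccontr)
  note found = that
  assume contr: "\<not> thesis"
  define q where "q = Suc (Suc (nat \<lceil>100 / c\<rceil>))"
  have q: "2 \<le> q" by (simp add: q_def)
  have cq: "100 \<le> c * 2 ^ q"
  proof -
    have "100 / c \<le> real q" unfolding q_def by linarith
    also have "\<dots> \<le> 2 ^ q" using of_nat_less_two_power[of q, where 'a = real] by linarith
    finally show ?thesis using F0.c_pos by (simp add: field_simps)
  qed
  define a where "a = enn2real (C ^ (q + 6)) + 2"
  have a: "2 \<le> a" "C ^ (q + 6) < ennreal a"
  proof -
    show "2 \<le> a" by (simp add: a_def)
    have "C ^ (q + 6) = ennreal (enn2real (C ^ (q + 6)))"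
      using F0.C_power_finite[of "q + 6"] by simp
    also have "\<dots> < ennreal a" unfolding a_def by (intro ennreal_lessI add_nonneg_pos) auto
    finally show "C ^ (q + 6) < ennreal a" .
  qed
  define M1 where "M1 = 2 * Cm ^ (q + 5) * C ^ (q + 12)"
  define K0 where "K0 = Cm ^ 2 * C ^ (q + 2)"
  let ?D = "\<lambda>g Z. ennreal (g Z) / whitney_mass \<Omega> m Z"
  define witness where "witness k g y \<rho> X \<longleftrightarrow> g \<in> borel_measurable borel \<and> (\<forall>Z. 0 \<le> g Z \<and> g Z \<le> 1) \<and>
      Carleson \<Omega> m \<nu>1 (?D g) M1 \<and> y \<in> frontier \<Omega> \<and> 0 < \<rho> \<and> X \<in> \<Omega> \<and> 200 * \<rho> \<le> dist X y \<and>
      of_nat (4 ^ k) * (\<xi> * emeasure (\<nu>0 X) (ball y \<rho>))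
        \<le> K0 * (\<integral>\<^sup>+z\<in>ball y (2 * \<rho>). area \<Omega> m (?D g) (2 * \<rho>) z \<partial>\<nu>0 X)" for k g y \<rho> X
  have "\<exists>g y \<rho> X. witness k g y \<rho> X" for k
  proof -
    let ?N = "4 ^ k :: nat"
    define \<zeta> where "\<zeta> = ennreal (1 / a ^ ?N) / C ^ (q + 9)"
    define \<zeta>' where "\<zeta>' = \<zeta> / C ^ 12"
    have Cne: "C ^ i \<noteq> 0" "C ^ i \<noteq> \<top>" for i
      using F0.C_power_ge[of i] F0.C_power_finite[of i] by (metis not_one_le_zero, simp add: less_top)
    have \<zeta>: "C ^ (q + 9) * \<zeta> = ennreal (1 / a ^ ?N)" "\<zeta>' * C ^ 12 = \<zeta>"
      unfolding \<zeta>_def \<zeta>'_def mult.commute[of "C ^ (q + 9)"]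
      by (rule ennreal_divide_mult_cancel[OF Cne])+
    have "0 < \<zeta>" "\<zeta> < \<infinity>" unfolding \<zeta>_def using Cne a
      by (auto simp: ennreal_zero_less_divide less_top[symmetric] ennreal_divide_eq_top_iff)
    then have "0 < \<zeta>'" "\<zeta>' < \<infinity>" unfolding \<zeta>'_def using Cne
      by (auto simp: ennreal_zero_less_divide less_top[symmetric] ennreal_divide_eq_top_iff)
    with contr obtain x r X E where x: "x \<in> frontier \<Omega>" "0 < r" and X: "X \<in> \<Omega>" "2 * r \<le> dist X x"
      and E: "E \<in> sets borel" "E \<subseteq> ball x r"
      and small: "emeasure (\<nu>1 X) E < \<zeta>' * emeasure (\<nu>1 X) (ball x r)"
      and large: "\<not> emeasure (\<nu>0 X) E \<le> \<xi> * C ^ 4 * emeasure (\<nu>0 X) (ball x r)"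
      using found[of \<zeta>'] by blast
    let ?\<rho> = "r / 2 ^ 8"
    obtain y where y: "y \<in> frontier \<Omega>" "200 * ?\<rho> \<le> dist X y"
      and small': "emeasure (\<nu>1 X) (E \<inter> ball y ?\<rho>) < \<zeta>' * C ^ 12 * emeasure (\<nu>1 X) (ball y ?\<rho>)"
      and large': "\<xi> * emeasure (\<nu>0 X) (ball y ?\<rho>) \<le> emeasure (\<nu>0 X) (E \<inter> ball y ?\<rho>)"
      using relocate_bad_set[OF x X E small] large by (metis linorder_not_le)
    obtain g where g: "g \<in> borel_measurable borel" "\<And>Z. 0 \<le> g Z" "\<And>Z. g Z \<le> 1"
      "Carleson \<Omega> m \<nu>1 (?D g) M1"
      and low: "of_nat ?N * emeasure (\<nu>0 X) (E \<inter> ball y ?\<rho>)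
        \<le> K0 * (\<integral>\<^sup>+z\<in>ball y (2 * ?\<rho>). area \<Omega> m (?D g) (2 * ?\<rho>) z \<partial>\<nu>0 X)"
      unfolding M1_def K0_def
      by (rule sawtooth_test_function[OF q cq a _ y(1) _ X(1) y(2) _ _ small', of ?N])
        (use \<zeta> E x in auto)
    have "of_nat ?N * (\<xi> * emeasure (\<nu>0 X) (ball y ?\<rho>)) \<le> of_nat ?N * emeasure (\<nu>0 X) (E \<inter> ball y ?\<rho>)"
      using large' by (rule mult_left_mono) simp
    with low have low': "of_nat ?N * (\<xi> * emeasure (\<nu>0 X) (ball y ?\<rho>))
        \<le> K0 * (\<integral>\<^sup>+z\<in>ball y (2 * ?\<rho>). area \<Omega> m (?D g) (2 * ?\<rho>) z \<partial>\<nu>0 X)"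
      by (rule order_trans[rotated])
    have \<rho>: "0 < ?\<rho>" using x by simp
    have "witness k g y ?\<rho> X" unfolding witness_def by (intro conjI allI g y X(1) \<rho> low')
    then show ?thesis by blast
  qed
  then obtain g y \<rho> X where "\<And>k. witness k (g k) (y k) (\<rho> k) (X k)" by metis
  note P = this[unfolded witness_def]
  define h where "h Z = (\<Sum>k. (1 / 2) ^ k * g k Z)" for Z
  have summand: "0 \<le> (1 / 2) ^ k * g k Z" "(1 / 2) ^ k * g k Z \<le> (1 / 2) ^ k" for k Z
    using P[of k] by (auto simp: mult_left_le)
  have summable: "summable (\<lambda>k. (1 / 2) ^ k * g k Z)" for Z
    using summand by (intro summable_comparison_test'[OF summable_geometric[of "1 / 2 :: real"]]) auto
  have h0: "0 \<le> h Z" for Z unfolding h_def by (rule suminf_nonneg[OF summable summand(1)])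
  have h2: "h Z \<le> 2" for Z
  proof -
    have "h Z \<le> (\<Sum>k. (1 / 2 :: real) ^ k)"
      unfolding h_def by (intro suminf_le summand summable summable_geometric) simp
    also have "\<dots> = 2" by (subst suminf_geometric) auto
    finally show ?thesis .
  qed
  have hm: "h \<in> borel_measurable borel"
    unfolding h_def[abs_def] using P by (intro borel_measurable_suminf borel_measurable_times) auto
  have D: "?D h Z = (\<Sum>k. ennreal ((1 / 2) ^ k) * ?D (g k) Z)" for Z
  proof -
    have "ennreal (h Z) = (\<Sum>k. ennreal ((1 / 2) ^ k * g k Z))"
      unfolding h_def by (rule suminf_ennreal2[OF summand(1) summable, symmetric])
    also have "\<dots> = (\<Sum>k. ennreal ((1 / 2) ^ k) * ennreal (g k Z))"
      using P by (intro suminf_cong ennreal_mult) auto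
    finally show ?thesis by (simp add: divide_ennreal_def ennreal_suminf_multc[symmetric] mult.assoc)
  qed
  have Dm: "?D (g k) \<in> borel_measurable m" for k
    using P by (intro measurable_whitney_density) auto
  have "Carleson \<Omega> m \<nu>1 (?D h) (\<Sum>k. ennreal ((1 / 2) ^ k) * M1)"
    unfolding D using P
    by (intro Carleson_suminf Carleson_scale F1.sets_nu Dm borel_measurable_times_ennreal borel_measurable_const) auto
  moreover have "(\<Sum>k. ennreal ((1 / 2) ^ k) * M1) < \<infinity>"
  proof -
    have "(\<Sum>k. ennreal ((1 / 2) ^ k)) = ennreal (\<Sum>k. (1 / 2) ^ k)"
      by (rule suminf_ennreal2) (auto intro: summable_geometric)
    then have "(\<Sum>k. ennreal ((1 / 2) ^ k) * M1) = ennreal (\<Sum>k. (1 / 2) ^ k) * M1"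
      by simp
    also have "\<dots> < \<infinity>"
      using Cm_finite F0.C_finite by (simp add: M1_def ennreal_mult_less_top power_less_top_ennreal)
    finally show ?thesis .
  qed
  ultimately obtain M0 where M0: "M0 < \<infinity>" "Carleson \<Omega> m \<nu>0 (?D h) M0"
    using transfer[rule_format, of h] hm h0 h2 by blast
  have bound: "2 ^ k * \<xi> \<le> K0 * M0 * C" for k
  proof -
    let ?y = "y k" and ?\<rho> = "\<rho> k" and ?X = "X k"
    have y: "?y \<in> frontier \<Omega>" "0 < ?\<rho>" "?X \<in> \<Omega>" "200 * ?\<rho> \<le> dist ?X ?y"
      and low: "of_nat (4 ^ k) * (\<xi> * emeasure (\<nu>0 ?X) (ball ?y ?\<rho>))
        \<le> K0 * (\<integral>\<^sup>+z\<in>ball ?y (2 * ?\<rho>). area \<Omega> m (?D (g k)) (2 * ?\<rho>) z \<partial>\<nu>0 ?X)"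
      using P[of k] by auto
    let ?b = "emeasure (\<nu>0 ?X) (ball ?y ?\<rho>)"
    let ?I = "\<integral>\<^sup>+z\<in>ball ?y (2 * ?\<rho>). area \<Omega> m (?D (g k)) (2 * ?\<rho>) z \<partial>\<nu>0 ?X"
    have "?D (g k) Z \<le> 2 ^ k * ?D h Z" for Z
    proof -
      have "ennreal ((1 / 2) ^ k) * ?D (g k) Z \<le> ?D h Z"
        unfolding D using sum_le_suminf[of "\<lambda>k. ennreal ((1 / 2) ^ k) * ?D (g k) Z" "{k}"] by simp
      then have "2 ^ k * (ennreal ((1 / 2) ^ k) * ?D (g k) Z) \<le> 2 ^ k * ?D h Z"
        by (rule mult_left_mono) simp
      moreover have "2 ^ k * ennreal ((1 / 2) ^ k) = 1"
      proof -
        have "2 ^ k * ennreal ((1 / 2) ^ k) = ennreal (2 ^ k) * ennreal ((1 / 2) ^ k)"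
          by (simp add: ennreal_power[symmetric])
        also have "\<dots> = ennreal (2 ^ k * (1 / 2) ^ k)" by (simp add: ennreal_mult)
        also have "2 ^ k * (1 / 2 :: real) ^ k = 1" by (simp add: power_mult_distrib[symmetric])
        finally show ?thesis by simp
      qed
      ultimately show ?thesis by (simp add: mult.assoc[symmetric])
    qed
    then have "Carleson \<Omega> m \<nu>0 (?D (g k)) (2 ^ k * M0)"
      by (intro Carleson_mono[OF Carleson_scale[OF measurable_whitney_density[OF hm] F0.sets_nu M0(2)]])
    then have "?I \<le> (2 ^ k * M0) * emeasure (\<nu>0 ?X) (ball ?y (2 * ?\<rho>))"
      using y by (auto simp: Carleson_def)
    also have "emeasure (\<nu>0 ?X) (ball ?y (2 * ?\<rho>)) \<le> C * ?b"
      using y by (intro F0.doubling) auto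
    finally have "?I \<le> 2 ^ k * M0 * (C * ?b)" by (simp add: mult_left_mono)
    then have "K0 * ?I \<le> K0 * (2 ^ k * M0 * (C * ?b))" by (rule mult_left_mono) simp
    with low have "of_nat (4 ^ k) * (\<xi> * ?b) \<le> K0 * (2 ^ k * M0 * (C * ?b))" by (rule order_trans)
    moreover have "of_nat (4 ^ k) = (2 ^ k * 2 ^ k :: ennreal)"
      by (simp add: power_mult_distrib[symmetric])
    ultimately have "(2 ^ k * ?b) * (2 ^ k * \<xi>) \<le> (2 ^ k * ?b) * (K0 * M0 * C)"
      by (simp add: ac_simps)
    moreover have "(0 :: ennreal) < 2 ^ k"
      by (rule order.strict_trans2[OF zero_less_one one_le_power]) simp
    then have "0 < 2 ^ k * ?b" "2 ^ k * ?b < \<infinity>"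
      using F0.nu_pos[OF y(3,1,2)] F0.nu_finite[OF y(3), of "ball ?y ?\<rho>"]
      by (auto simp: ennreal_mult_less_top power_less_top_ennreal ennreal_zero_less_mult_iff)
    ultimately show ?thesis by (subst (asm) ennreal_mult_le_mult_iff) auto
  qed
  have "K0 * M0 * C < \<infinity>"
    using Cm_finite F0.C_finite M0(1) by (simp add: K0_def ennreal_mult_less_top power_less_top_ennreal)
  then obtain B where B: "K0 * M0 * C = ennreal B" "0 \<le> B" by (cases "K0 * M0 * C") auto
  \<comment> \<open>a finite positive number below \<open>\<xi>\<close>, which may be infinite\<close>
  define x0 where "x0 = (if \<xi> = \<top> then 1 else enn2real \<xi>)"
  have x0: "0 < x0" "ennreal x0 \<le> \<xi>"
    using \<xi> by (auto simp: x0_def enn2real_positive_iff less_top)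
  obtain k where k: "B / x0 < 2 ^ k" using real_arch_pow[of 2 "B / x0"] by auto
  have "ennreal (2 ^ k * x0) = 2 ^ k * ennreal x0"
    using x0 by (simp add: ennreal_mult ennreal_power[symmetric])
  also have "\<dots> \<le> 2 ^ k * \<xi>" using x0 by (intro mult_left_mono) auto
  also have "\<dots> \<le> ennreal B" using bound[of k] B by simp
  finally have "2 ^ k * x0 \<le> B" using B x0 by (subst (asm) ennreal_le_iff) auto
  then show False using k x0 by (simp add: field_simps)
qed

end

section \<open>Elliptic measures as families on the whole space\<close>

definition extend_boundary_family :: "(real ^ 'n \<Rightarrow> (real ^ 'n) measure) \<Rightarrow> real ^ 'n \<Rightarrow> (real ^ 'n) measure" where
  "extend_boundary_family \<omega> X = distr (\<omega> X) borel (\<lambda>y. y)"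

locale boundary_family =
  fixes \<Omega> :: "(real ^ 'n) set" and \<omega> :: "real ^ 'n \<Rightarrow> (real ^ 'n) measure"
  assumes prob_omega: "X \<in> \<Omega> \<Longrightarrow> prob_space (\<omega> X)"
    and sets_omega: "X \<in> \<Omega> \<Longrightarrow> sets (\<omega> X) = sets (restrict_space borel (frontier \<Omega>))"
begin

abbreviation "ext \<equiv> extend_boundary_family \<omega>"

lemma space_omega: "X \<in> \<Omega> \<Longrightarrow> space (\<omega> X) = frontier \<Omega>"
  using sets_eq_imp_space_eq[OF sets_omega] by (simp add: space_restrict_space)

lemma Int_frontier_sets: "X \<in> \<Omega> \<Longrightarrow> E \<in> sets borel \<Longrightarrow> E \<inter> frontier \<Omega> \<in> sets (\<omega> X)"
  unfolding sets_omega sets_restrict_space by (rule image_eqI[of _ _ E]) auto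

lemma bball_sets: "X \<in> \<Omega> \<Longrightarrow> bball \<Omega> x r \<in> sets (\<omega> X)"
  unfolding bball_def by (intro Int_frontier_sets) auto

lemma measurable_id_omega: "X \<in> \<Omega> \<Longrightarrow> (\<lambda>y. y) \<in> measurable (\<omega> X) borel"
  by (rule measurableI) (simp_all add: space_omega Int_frontier_sets)

lemma emeasure_ext:
  assumes "X \<in> \<Omega>" "E \<in> sets borel"
  shows "emeasure (ext X) E = emeasure (\<omega> X) (E \<inter> frontier \<Omega>)"
  unfolding extend_boundary_family_def
  using assms measurable_id_omega by (subst emeasure_distr) (auto simp: space_omega)

lemma emeasure_ext_ball: "X \<in> \<Omega> \<Longrightarrow> emeasure (ext X) (ball x r) = emeasure (\<omega> X) (bball \<Omega> x r)"
  by (simp add: emeasure_ext bball_def)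

lemma emeasure_omega: "X \<in> \<Omega> \<Longrightarrow> emeasure (\<omega> X) E = ennreal (measure (\<omega> X) E)"
  using prob_omega[of X] by (simp add: prob_space_def finite_measure.emeasure_eq_measure)

lemma emeasure_ext_measure:
  "X \<in> \<Omega> \<Longrightarrow> E \<in> sets borel \<Longrightarrow> emeasure (ext X) E = ennreal (measure (\<omega> X) (E \<inter> frontier \<Omega>))"
  by (simp add: emeasure_ext emeasure_omega)

lemma nn_integral_ext_ball:
  assumes X: "X \<in> \<Omega>" and h: "h \<in> borel_measurable borel"
  shows "(\<integral>\<^sup>+y\<in>ball x r. h y \<partial>ext X) = (\<integral>\<^sup>+y\<in>bball \<Omega> x r. h y \<partial>\<omega> X)"
proof -
  have "(\<integral>\<^sup>+y\<in>ball x r. h y \<partial>ext X) = (\<integral>\<^sup>+y\<in>ball x r. h y \<partial>\<omega> X)"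
    unfolding extend_boundary_family_def
    by (intro nn_integral_distr[OF measurable_id_omega[OF X]] borel_measurable_times_ennreal
        borel_measurable_indicator) (use h in simp_all)
  also have "\<dots> = (\<integral>\<^sup>+y\<in>bball \<Omega> x r. h y \<partial>\<omega> X)"
    by (intro nn_integral_cong) (auto simp: space_omega[OF X] bball_def indicator_def)
  finally show ?thesis .
qed

end

locale elliptic_estimates = corkscrew_domain \<Omega> c + boundary_family \<Omega> \<omega>
  for \<Omega> :: "(real ^ 'n) set" and c \<omega> +
  fixes K \<gamma> :: real
  assumes K_pos: "0 < K" and \<gamma>_pos: "0 < \<gamma>"
    and em_doubling: "em_doubling \<Omega> K \<omega>"
    and em_change_of_pole: "em_change_of_pole \<Omega> c K \<omega>"
    and em_decay: "em_decay \<Omega> K \<gamma> \<omega>"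
begin

lemma change_of_pole:
  assumes "x \<in> frontier \<Omega>" "0 < r" "corkscrew_point c \<Omega> x r A" "E \<in> sets borel" "E \<subseteq> bball \<Omega> x r"
    "Y \<in> \<Omega>" "2 * r \<le> dist Y x"
  shows "inverse K * measure (\<omega> A) E \<le> measure (\<omega> Y) E / measure (\<omega> Y) (bball \<Omega> x r)"
    "measure (\<omega> Y) E / measure (\<omega> Y) (bball \<Omega> x r) \<le> K * measure (\<omega> A) E"
  using em_change_of_pole assms unfolding em_change_of_pole_def by (auto simp: dist_commute not_less)

lemma bball_borel: "bball \<Omega> x r \<in> sets borel"
  unfolding bball_def by (intro sets.Int borel_open borel_closed) auto

lemma measure_mono_omega:
  "X \<in> \<Omega> \<Longrightarrow> E \<subseteq> F \<Longrightarrow> F \<in> sets (\<omega> X) \<Longrightarrow> measure (\<omega> X) E \<le> measure (\<omega> X) F"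
  using emeasure_mono[of E F "\<omega> X"] by (simp add: emeasure_omega)

text \<open>If \<open>\<omega>\<^sup>Y\<close> does not charge a small ball around \<open>y\<close>, then, by the change of pole formula, neither does \<open>\<omega>\<^sup>A\<close> for a
corkscrew point \<open>A\<close> of that ball, and hence neither does \<open>\<omega>\<^sup>X\<close> once the ball is small compared with the distance of \<open>X\<close>
to \<open>y\<close>: a positive denominator would make the quotient equal to \<open>1\<close>.  Countably many such balls cover.\<close>

lemma null_ball_for_all_poles:
  assumes x: "x \<in> frontier \<Omega>" "0 < r" and Y: "Y \<in> \<Omega>" "2 * r \<le> dist Y x"
    and null: "measure (\<omega> Y) (bball \<Omega> x r) = 0" and X: "X \<in> \<Omega>"
  shows "measure (\<omega> X) (bball \<Omega> x r) = 0"
proof -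
  have local: "\<exists>s>0. measure (\<omega> X) (bball \<Omega> y s) = 0" if y: "y \<in> bball \<Omega> x r" for y
  proof -
    have y: "y \<in> frontier \<Omega>" "dist y x < r" using y by (auto simp: bball_def dist_commute)
    have Xy: "0 < dist X y" using dist_frontier_pos[OF X y(1)] .
    define s where "s = min (r - dist y x) (min (dist X y / 2) (r / 2))"
    have s: "0 < s" "s \<le> r - dist y x" "2 * s \<le> dist X y" "2 * s \<le> r"
      using y x Xy by (auto simp: s_def min_def)
    have Yy: "2 * s \<le> dist Y y" using Y(2) y(2) s(4) dist_triangle[of Y x y] by linarith
    obtain B where B: "corkscrew_point c \<Omega> y s B"
      using exists_corkscrew_point[OF y(1) s(1) X] s Xy by auto
    have "bball \<Omega> y s \<subseteq> bball \<Omega> x r"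
    proof -
      have "ball y s \<subseteq> ball x r"
        using s(2) by (intro ball_subset_ball_iff[THEN iffD2] disjI1) simp
      then show ?thesis by (auto simp: bball_def)
    qed
    then have "measure (\<omega> Y) (bball \<Omega> y s) \<le> 0"
      using measure_mono_omega[OF Y(1) _ bball_sets[OF Y(1)]] null by metis
    then have "measure (\<omega> Y) (bball \<Omega> y s) = 0" using measure_le_0_iff by blast
    then have "inverse K * measure (\<omega> B) (bball \<Omega> y s) \<le> 0"
      using change_of_pole(1)[OF y(1) s(1) B bball_borel order_refl Y(1) Yy] by simp
    then have "measure (\<omega> B) (bball \<Omega> y s) = 0"
      using K_pos by (simp add: mult_le_0_iff not_le[symmetric] measure_le_0_iff)
    then have "measure (\<omega> X) (bball \<Omega> y s) = 0"
      using change_of_pole(2)[OF y(1) s(1) B bball_borel order_refl X s(3)]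
      by (cases "measure (\<omega> X) (bball \<Omega> y s) = 0") auto
    then show ?thesis using s by blast
  qed
  define F where "F = {ball y s | y s. 0 < s \<and> measure (\<omega> X) (bball \<Omega> y s) = 0}"
  have op: "\<And>S. S \<in> F \<Longrightarrow> open S" by (auto simp: F_def)
  obtain F' where F': "F' \<subseteq> F" "countable F'" "\<Union> F' = \<Union> F" by (rule Lindelof[OF op]) auto
  have "(\<Union>B\<in>F'. B \<inter> frontier \<Omega>) \<in> null_sets (\<omega> X)"
  proof (rule null_sets_UN'[OF F'(2)])
    fix B assume "B \<in> F'"
    then obtain y s where B: "B = ball y s" "measure (\<omega> X) (bball \<Omega> y s) = 0" using F' by (auto simp: F_def)
    then show "B \<inter> frontier \<Omega> \<in> null_sets (\<omega> X)"
      using bball_sets[OF X, of y s] by (auto simp: null_sets_def emeasure_omega[OF X] bball_def)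
  qed
  moreover have "bball \<Omega> x r \<subseteq> (\<Union>B\<in>F'. B \<inter> frontier \<Omega>)"
  proof
    fix y assume y: "y \<in> bball \<Omega> x r"
    then obtain s where "s > 0" "measure (\<omega> X) (bball \<Omega> y s) = 0" using local by blast
    then have "y \<in> \<Union> F" by (auto simp: F_def intro!: exI[of _ "ball y s"])
    then show "y \<in> (\<Union>B\<in>F'. B \<inter> frontier \<Omega>)" using F'(3) y by (auto simp: bball_def)
  qed
  ultimately have "bball \<Omega> x r \<in> null_sets (\<omega> X)" by (rule null_sets_subset[OF _ bball_sets[OF X]])
  then show ?thesis using emeasure_omega[OF X, of "bball \<Omega> x r"] by (auto simp: null_sets_def)
qed

text \<open>A ball that is null for one pole is null for all poles, but the decay estimate gives it almost full mass for
poles close to its centre.\<close>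

lemma positive_on_balls:
  assumes Y: "Y \<in> \<Omega>" and x: "x \<in> frontier \<Omega>" "0 < r"
  shows "0 < measure (\<omega> Y) (bball \<Omega> x r)"
proof (rule ccontr)
  assume "\<not> 0 < measure (\<omega> Y) (bball \<Omega> x r)"
  then have null: "measure (\<omega> Y) (bball \<Omega> x r) = 0" by (metis less_eq_real_def measure_nonneg)
  define s where "s = min r (dist Y x / 2)"
  have s: "0 < s" "s \<le> r" "2 * s \<le> dist Y x"
    using x dist_frontier_pos[OF Y x(1)] by (auto simp: s_def)
  have sub: "bball \<Omega> x s \<subseteq> bball \<Omega> x r" using s by (auto simp: bball_def)
  have "measure (\<omega> Y) (bball \<Omega> x s) = 0"
    using measure_mono_omega[OF Y sub bball_sets[OF Y]] null measure_le_0_iff by metis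
  note all = null_ball_for_all_poles[OF x(1) s(1) Y s(3) this]
  \<comment> \<open>for a pole within \<open>\<eta> * s / 2\<close> of \<open>x\<close> the decay estimate leaves at most half of the mass outside \<open>ball x s\<close>\<close>
  define \<eta> where "\<eta> = (1 / (2 * K)) powr (1 / \<gamma>)"
  have \<eta>: "0 < \<eta>" "\<eta> powr \<gamma> = 1 / (2 * K)"
    using K_pos \<gamma>_pos by (auto simp: \<eta>_def powr_powr)
  define \<epsilon> where "\<epsilon> = min (s / 2) (\<eta> * (s / 2))"
  have \<epsilon>: "0 < \<epsilon>" "\<epsilon> \<le> s / 2" "\<epsilon> \<le> \<eta> * (s / 2)" using s \<eta> by (auto simp: \<epsilon>_def)
  have "x \<in> closure \<Omega>" using x by (simp add: frontier_def)
  then obtain X where X: "X \<in> \<Omega>" "dist X x < \<epsilon>" using \<epsilon> by (meson closure_approachable)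
  define E where "E = frontier \<Omega> - ball x s"
  have E: "E \<in> sets borel" "E \<subseteq> frontier \<Omega>" unfolding E_def by (auto intro: borel_closed)
  interpret prob_space "\<omega> X" by (rule prob_omega[OF X(1)])
  have "E = space (\<omega> X) - bball \<Omega> x s" by (auto simp: space_omega[OF X(1)] E_def bball_def)
  then have one: "measure (\<omega> X) E = 1"
    using prob_compl[OF bball_sets[OF X(1)], of x s] all[OF X(1)] by simp
  then have "E \<noteq> {}" by auto
  have far: "s / 2 \<le> infdist X E"
    unfolding infdist_notempty[OF \<open>E \<noteq> {}\<close>]
  proof (rule cINF_greatest[OF \<open>E \<noteq> {}\<close>])
    fix e assume "e \<in> E"
    then have "s \<le> dist x e" by (auto simp: E_def)
    then show "s / 2 \<le> dist X e" using X(2) \<epsilon>(2) dist_triangle[of x e X] by (simp add: dist_commute)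
  qed
  have "bdist \<Omega> X \<le> \<epsilon>" using bdist_le[OF x(1), of X] X(2) by linarith
  then have "bdist \<Omega> X / infdist X E \<le> \<epsilon> / (s / 2)"
    using far s(1) \<epsilon>(1) by (intro frac_le) auto
  also have "\<dots> \<le> \<eta>" using \<epsilon>(3) s(1) by (simp add: field_simps)
  finally have ratio: "bdist \<Omega> X / infdist X E \<le> \<eta>" .
  have "0 \<le> bdist \<Omega> X / infdist X E" by (simp add: infdist_nonneg)
  then have "(bdist \<Omega> X / infdist X E) powr \<gamma> \<le> \<eta> powr \<gamma>"
    using ratio \<gamma>_pos by (intro powr_mono2) auto
  then have "K * (bdist \<Omega> X / infdist X E) powr \<gamma> \<le> K * (1 / (2 * K))"
    using \<eta> K_pos by (intro mult_left_mono) auto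
  also have "\<dots> < 1" using K_pos by simp
  finally show False using em_decay X(1) E one by (force simp: em_decay_def)
qed

lemma elliptic_family_extension:
  assumes "max 1 K \<le> K'"
  shows "elliptic_family \<Omega> c ext (ennreal K')"
proof (intro elliptic_family.intro elliptic_family_axioms.intro)
  show "corkscrew_domain \<Omega> c" by (rule corkscrew_domain_axioms)
  have K': "1 \<le> K'" "K \<le> K'" "0 \<le> K'" using assms by auto
  show "1 \<le> ennreal K'" "ennreal K' < \<infinity>" using K' by (auto simp: ennreal_ge_1)
  fix X assume X: "X \<in> \<Omega>"
  show "sets (ext X) = sets borel" by (simp add: extend_boundary_family_def)
  show "prob_space (ext X)"
    unfolding extend_boundary_family_def
    by (rule prob_space.prob_space_distr[OF prob_omega[OF X] measurable_id_omega[OF X]])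
  show "emeasure (ext X) (- frontier \<Omega>) = 0" using X by (simp add: emeasure_ext borel_closed borel_comp)
  show "0 < emeasure (ext X) (ball x r)" if "x \<in> frontier \<Omega>" "0 < r" for x r
    using positive_on_balls[OF X that] by (simp add: emeasure_ext_ball[OF X] emeasure_omega[OF X])
  show "emeasure (ext X) (ball x (2 * r)) \<le> ennreal K' * emeasure (ext X) (ball x r)"
    if "x \<in> frontier \<Omega>" "0 < r" "3 * r \<le> dist X x" for x r
  proof -
    have "measure (\<omega> X) (bball \<Omega> x (2 * r)) \<le> K * measure (\<omega> X) (bball \<Omega> x r)"
      using em_doubling that X by (auto simp: em_doubling_def dist_commute not_less)
    also have "\<dots> \<le> K' * measure (\<omega> X) (bball \<Omega> x r)" using K' by (intro mult_right_mono) auto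
    finally show ?thesis
      using K' by (simp add: emeasure_ext_ball[OF X] emeasure_omega[OF X] ennreal_mult[symmetric] ennreal_leI)
  qed
next
  have K': "1 \<le> K'" "K \<le> K'" "0 \<le> K'" using assms by auto
  fix x r B E Y
  assume *: "x \<in> frontier \<Omega>" "0 < r" "corkscrew_point c \<Omega> x r B" "E \<in> sets borel" "E \<subseteq> ball x r"
    "Y \<in> \<Omega>" "2 * r \<le> dist Y x"
  have B: "B \<in> \<Omega>" using *(3) by (simp add: corkscrew_point_def)
  let ?E = "E \<inter> frontier \<Omega>" and ?\<Delta> = "bball \<Omega> x r"
  have E: "?E \<in> sets borel" "?E \<subseteq> ?\<Delta>" using *(4,5) by (auto simp: bball_def intro: borel_closed)
  have pos: "0 < measure (\<omega> Y) ?\<Delta>" by (rule positive_on_balls[OF *(6,1,2)])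
  note change = change_of_pole[OF *(1,2,3) E *(6,7)]
  have "measure (\<omega> Y) ?E \<le> K * measure (\<omega> B) ?E * measure (\<omega> Y) ?\<Delta>"
    using change(2) pos by (simp add: field_simps)
  also have "\<dots> \<le> K' * measure (\<omega> B) ?E * measure (\<omega> Y) ?\<Delta>"
    using K' by (intro mult_right_mono) auto
  finally show "emeasure (ext Y) E \<le> ennreal K' * emeasure (ext B) E * emeasure (ext Y) (ball x r)"
    using * B K' by (simp add: emeasure_ext_measure bball_def ennreal_mult[symmetric] ennreal_leI)
  have "measure (\<omega> B) ?E * measure (\<omega> Y) ?\<Delta> \<le> K * measure (\<omega> Y) ?E"
    using change(1) pos K_pos by (simp add: field_simps)
  also have "\<dots> \<le> K' * measure (\<omega> Y) ?E" using K' by (intro mult_right_mono) auto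
  finally show "emeasure (ext B) E * emeasure (ext Y) (ball x r) \<le> ennreal K' * emeasure (ext Y) E"
    using * B K' by (simp add: emeasure_ext_measure bball_def ennreal_mult[symmetric] ennreal_leI)
qed

end

text \<open>If \<open>m\<close> vanished, the comparison with the Green function would make small boundary balls null.\<close>

lemma em_green_imp_measure_nonzero:
  assumes E: "elliptic_estimates \<Omega> c \<omega> K \<gamma>" and green: "em_green \<Omega> m A c K' \<omega>"
    and x: "x \<in> frontier \<Omega>" and sets: "\<Omega> \<in> sets m"
  shows "0 < emeasure m \<Omega>"
proof (rule ccontr)
  interpret elliptic_estimates \<Omega> c \<omega> K \<gamma> by fact
  assume "\<not> 0 < emeasure m \<Omega>"
  then have "emeasure m \<Omega> = 0" by simp
  then have zero: "measure m (ball y s \<inter> \<Omega>) = 0" for y s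
    using emeasure_mono[OF Int_lower2 sets, of "ball y s"] by (simp add: measure_def)
  have "\<Omega> \<noteq> {}" using x by auto
  then obtain X where X: "X \<in> \<Omega>" by auto
  have fne: "frontier \<Omega> \<noteq> {}" using x by auto
  obtain z where z: "z \<in> frontier \<Omega>" "dist z X = bdist \<Omega> X" using exists_foot[OF fne] by blast
  define r where "r = bdist \<Omega> X / 2"
  have r: "0 < r" "dist X z = 2 * r" using bdist_pos[OF open_domain fne X] z by (auto simp: r_def dist_commute)
  obtain Y where Y: "Y \<in> \<Omega>" "dist Y z < r / 2" "c * (r / 2) \<le> bdist \<Omega> Y"
    by (rule exists_corkscrew_ball[OF z(1) _ X, of "r / 2"]) (use r in auto)
  have cork: "corkscrew_point c \<Omega> z (r / 2) Y"
  proof (rule corkscrew_pointI[OF Y(1) _ _ z(1)])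
    have "0 < c * (r / 2)" using c_pos r by simp
    then show "c * (r / 2) / 100 \<le> bdist \<Omega> Y" using Y(3) by linarith
    show "dist Y z \<le> 100 * (r / 2)" using Y(2) r by linarith
  qed
  obtain G where G: "\<forall>y\<in>bball \<Omega> z r. \<forall>s\<in>{0<..<r}. \<forall>Y\<in>ball z r \<inter> \<Omega>. corkscrew_point c \<Omega> y s Y \<longrightarrow>
      inverse K' * (measure m (ball y s \<inter> \<Omega>) / s\<^sup>2) * G Y \<le> measure (\<omega> X) (bball \<Omega> y s) \<and>
      measure (\<omega> X) (bball \<Omega> y s) \<le> K' * (measure m (ball y s \<inter> \<Omega>) / s\<^sup>2) * G Y"
    using green X z(1) r unfolding em_green_def r_def by blast
  have "measure (\<omega> X) (bball \<Omega> z (r / 2)) \<le> 0"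
    using G[rule_format, of z "r / 2" Y] cork Y r z zero by (auto simp: bball_def dist_commute)
  then show False using positive_on_balls[OF X z(1), of "r / 2"] r by simp
qed

text \<open>Local integrability of the weight makes one ball finite, and doubling propagates finiteness to all balls.  In the same
way one null ball would make all of \<open>\<Omega>\<close> null.\<close>

lemma weighted_domain_of_measure:
  fixes \<Omega> :: "(real ^ 'n) set"
  assumes op: "open \<Omega>" and ne: "\<Omega> \<noteq> {}" and w: "weighted_measure_on \<Omega> m" and d: "doubling_on \<Omega> m"
    and pos: "0 < emeasure m \<Omega>"
  obtains Cm where "weighted_domain \<Omega> m Cm"
proof -
  obtain w where w: "w \<in> borel_measurable (lebesgue_on \<Omega>)" "\<forall>X\<in>\<Omega>. 0 \<le> w X"
    "\<And>K. compact K \<Longrightarrow> K \<subseteq> \<Omega> \<Longrightarrow> set_integrable lebesgue K w"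
    "m = density (lebesgue_on \<Omega>) (\<lambda>X. ennreal (w X))"
    using w unfolding weighted_measure_on_def by blast
  have sets_m: "sets m = sets (lebesgue_on \<Omega>)" unfolding w(4) by simp
  have borel_m: "S \<inter> \<Omega> \<in> sets m" if "S \<in> sets borel" for S
    unfolding sets_m sets_restrict_space
    by (rule image_eqI[of _ _ S]) (use that in \<open>auto intro: sets_completionI_sets\<close>)
  have space_m: "space m = \<Omega>" using sets_eq_imp_space_eq[OF sets_m] by (simp add: space_restrict_space)
  obtain C where C: "C > 0" "\<And>X r. X \<in> closure \<Omega> \<Longrightarrow> r > 0 \<Longrightarrow>
      emeasure m (ball X (2 * r) \<inter> \<Omega>) \<le> ennreal C * emeasure m (ball X r \<inter> \<Omega>)"
    using d unfolding doubling_on_def by blast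
  have iter: "emeasure m (ball X (2 ^ k * r) \<inter> \<Omega>) \<le> ennreal C ^ k * emeasure m (ball X r \<inter> \<Omega>)"
    if X: "X \<in> closure \<Omega>" "0 < r" for X r k
  proof (induction k)
    case (Suc k)
    have "emeasure m (ball X (2 ^ Suc k * r) \<inter> \<Omega>) \<le> ennreal C * emeasure m (ball X (2 ^ k * r) \<inter> \<Omega>)"
      using C(2)[OF X(1), of "2 ^ k * r"] X(2) by (simp add: mult.assoc)
    also have "\<dots> \<le> ennreal C * (ennreal C ^ k * emeasure m (ball X r \<inter> \<Omega>))"
      by (rule mult_left_mono[OF Suc]) simp
    finally show ?case by (simp add: mult.assoc)
  qed simp
  have mono: "emeasure m (ball X r \<inter> \<Omega>) \<le> emeasure m (ball Y s \<inter> \<Omega>)" if "ball X r \<subseteq> ball Y s" for X r Y s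
    using that borel_m[of "ball Y s"] by (intro emeasure_mono) auto
  have cover: "\<exists>k. ball Y s \<subseteq> ball X (2 ^ k * r)" if "0 < r" for X Y :: "real ^ 'n" and r s
  proof -
    obtain k where k: "(dist Y X + s) / r < 2 ^ k" using real_arch_pow[of 2 "(dist Y X + s) / r"] by auto
    then have "dist Y X + s \<le> 2 ^ k * r" using that by (simp add: field_simps)
    then show ?thesis by (intro exI[of _ k] ball_subset_ball_iff[THEN iffD2] disjI1)
  qed
  obtain X0 where X0: "X0 \<in> \<Omega>" using ne by auto
  obtain r0 where r0: "0 < r0" "cball X0 r0 \<subseteq> \<Omega>" using op X0 by (meson open_contains_cball)
  have X0cl: "X0 \<in> closure \<Omega>" using X0 closure_subset by blast
  have small: "emeasure m (ball X0 r0 \<inter> \<Omega>) < \<infinity>"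
  proof -
    have int: "set_integrable lebesgue (cball X0 r0) w" by (rule w(3)) (use r0 in auto)
    have "emeasure m (ball X0 r0 \<inter> \<Omega>) \<le> emeasure m (cball X0 r0 \<inter> \<Omega>)"
      using borel_m[of "cball X0 r0"] by (intro emeasure_mono) auto
    also have "\<dots> = (\<integral>\<^sup>+X. ennreal (w X) * indicator (cball X0 r0 \<inter> \<Omega>) X \<partial>lebesgue_on \<Omega>)"
      unfolding w(4) using w(1) borel_m[of "cball X0 r0"] sets_m
      by (intro emeasure_density measurable_compose[OF _ measurable_ennreal]) auto
    also have "\<dots> = (\<integral>\<^sup>+X. ennreal (w X) * indicator (cball X0 r0 \<inter> \<Omega>) X * indicator \<Omega> X \<partial>lebesgue)"
      using op by (intro nn_integral_restrict_space) (auto intro: sets_completionI_sets)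
    also have "\<dots> = (\<integral>\<^sup>+X. ennreal (norm (indicator (cball X0 r0) X *\<^sub>R w X)) \<partial>lebesgue)"
      using r0 w(2) by (intro nn_integral_cong) (auto simp: indicator_def)
    also have "\<dots> < \<infinity>"
      using int unfolding set_integrable_def integrable_iff_bounded by auto
    finally show ?thesis .
  qed
  have finite: "emeasure m (ball Y s \<inter> \<Omega>) < \<infinity>" for Y s
  proof -
    obtain k where "ball Y s \<subseteq> ball X0 (2 ^ k * r0)" using cover[OF r0(1)] by blast
    then have "emeasure m (ball Y s \<inter> \<Omega>) \<le> ennreal C ^ k * emeasure m (ball X0 r0 \<inter> \<Omega>)"
      using order_trans[OF mono iter[OF X0cl r0(1)]] by blast
    also have "\<dots> < \<infinity>" using small by (simp add: ennreal_mult_less_top power_less_top_ennreal)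
    finally show ?thesis .
  qed
  have positive: "0 < emeasure m (ball X r \<inter> \<Omega>)" if X: "X \<in> closure \<Omega>" "0 < r" for X r
  proof (rule ccontr)
    assume "\<not> 0 < emeasure m (ball X r \<inter> \<Omega>)"
    then have zero: "emeasure m (ball X r \<inter> \<Omega>) = 0" by simp
    have "emeasure m (ball X (2 ^ k * r) \<inter> \<Omega>) = 0" for k
      using iter[OF X, of k] zero by simp
    then have null: "ball X (2 ^ k * r) \<inter> \<Omega> \<in> null_sets m" for k
      using borel_m by (auto simp: null_sets_def)
    have "\<Omega> = (\<Union>k. ball X (2 ^ k * r) \<inter> \<Omega>)"
    proof -
      have "\<exists>k. Z \<in> ball X (2 ^ k * r)" for Z
        using cover[OF X(2), of Z 1 X] by (meson centre_in_ball subsetD zero_less_one)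
      then show ?thesis by auto
    qed
    then have "\<Omega> \<in> null_sets m" using null null_sets_UN[of _ m] by metis
    then show False using pos by (simp add: null_sets_def)
  qed
  have "weighted_domain \<Omega> m (ennreal (max 1 C))"
  proof
    show "emeasure m (ball X (2 * r) \<inter> \<Omega>) \<le> ennreal (max 1 C) * emeasure m (ball X r \<inter> \<Omega>)"
      if "X \<in> closure \<Omega>" "0 < r" for X r
      by (rule order_trans[OF C(2)[OF that] mult_right_mono]) (auto intro: ennreal_leI)
  qed (use op sets_m finite positive in \<open>auto simp: ennreal_ge_1\<close>)
  then show thesis by (rule that)
qed

text \<open>A given elliptic measure agrees at all poles in \<open>\<Omega>\<close> with the one that satisfies the estimates, by uniqueness, and
the estimates only involve such poles.\<close>

lemma pde_friendly_estimates:
  assumes op: "open \<Omega>" and friendly: "pde_friendly \<Omega> m"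
  obtains c where "\<And>\<omega>. is_elliptic_measure \<Omega> m \<omega> \<Longrightarrow>
    \<exists>K \<gamma> A. elliptic_estimates \<Omega> c \<omega> K \<gamma> \<and> em_green \<Omega> m A c K \<omega>"
proof -
  obtain c where c: "c \<in> {0<..<1}" "corkscrew_condition c \<Omega>"
    and est: "\<And>CL. CL > 0 \<Longrightarrow> \<exists>C>0. \<exists>\<gamma>\<in>{0<..<1}. \<forall>A. elliptic_matrix \<Omega> CL A \<longrightarrow>
           (\<exists>\<omega>. elliptic_measure_of \<Omega> m A \<omega> \<and>
              (\<forall>\<omega>'. elliptic_measure_of \<Omega> m A \<omega>' \<longrightarrow> (\<forall>X\<in>\<Omega>. \<omega>' X = \<omega> X)) \<and>
              em_doubling \<Omega> C \<omega> \<and> em_change_of_pole \<Omega> c C \<omega> \<and>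
              em_decay \<Omega> C \<gamma> \<omega> \<and> em_green \<Omega> m A c C \<omega>)"
    using friendly unfolding pde_friendly_def by blast
  have "\<exists>K \<gamma> A. elliptic_estimates \<Omega> c \<omega>' K \<gamma> \<and> em_green \<Omega> m A c K \<omega>'"
    if ell: "is_elliptic_measure \<Omega> m \<omega>'" for \<omega>'
  proof -
    obtain CL A where A: "CL > 0" "elliptic_matrix \<Omega> CL A" "elliptic_measure_of \<Omega> m A \<omega>'"
      using ell unfolding is_elliptic_measure_def by blast
    obtain K \<gamma> where K: "0 < K" "\<gamma> \<in> {0<..<1}" and all: "\<forall>A. elliptic_matrix \<Omega> CL A \<longrightarrow>
           (\<exists>\<omega>. elliptic_measure_of \<Omega> m A \<omega> \<and>
              (\<forall>\<omega>'. elliptic_measure_of \<Omega> m A \<omega>' \<longrightarrow> (\<forall>X\<in>\<Omega>. \<omega>' X = \<omega> X)) \<and>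
              em_doubling \<Omega> K \<omega> \<and> em_change_of_pole \<Omega> c K \<omega> \<and>
              em_decay \<Omega> K \<gamma> \<omega> \<and> em_green \<Omega> m A c K \<omega>)"
      using est[OF A(1)] by (elim exE conjE bexE) (rule that)
    obtain \<omega> where \<omega>: "\<forall>\<omega>'. elliptic_measure_of \<Omega> m A \<omega>' \<longrightarrow> (\<forall>X\<in>\<Omega>. \<omega>' X = \<omega> X)"
      "em_doubling \<Omega> K \<omega>" "em_change_of_pole \<Omega> c K \<omega>" "em_decay \<Omega> K \<gamma> \<omega>" "em_green \<Omega> m A c K \<omega>"
      using all A(2) by blast
    have eq: "\<omega>' X = \<omega> X" if "X \<in> \<Omega>" for X using \<omega>(1) A(3) that by blast
    have "\<forall>X\<in>\<Omega>. prob_space (\<omega>' X) \<and> sets (\<omega>' X) = sets (restrict_space borel (frontier \<Omega>))"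
      using A(3) unfolding elliptic_measure_of_def by (rule conjunct1)
    then have "boundary_family \<Omega> \<omega>'" by (intro boundary_family.intro) simp_all
    moreover have "corkscrew_domain \<Omega> c" using op c by (intro corkscrew_domain.intro) auto
    moreover have "em_doubling \<Omega> K \<omega>'" using \<omega>(2) eq by (simp add: em_doubling_def)
    moreover have "em_change_of_pole \<Omega> c K \<omega>'"
      using \<omega>(3) eq by (simp add: em_change_of_pole_def corkscrew_point_def)
    moreover have "em_decay \<Omega> K \<gamma> \<omega>'" using \<omega>(4) eq by (simp add: em_decay_def)
    moreover have "em_green \<Omega> m A c K \<omega>'" using \<omega>(5) eq by (simp add: em_green_def)
    ultimately show ?thesis
      using K by (intro exI[of _ K] exI[of _ \<gamma>] exI[of _ A] conjI elliptic_estimates.intro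
          elliptic_estimates_axioms.intro) auto
  qed
  then show thesis by (rule that)
qed

lemma KCM_iff_Carleson:
  assumes "weighted_domain \<Omega> m Cm" and "boundary_family \<Omega> \<omega>" and f: "f \<in> borel_measurable m"
  shows "f \<in> KCM \<Omega> m \<omega> \<longleftrightarrow> (\<exists>M<\<infinity>. Carleson \<Omega> m (extend_boundary_family \<omega>)
    (\<lambda>Z. ennreal (\<bar>f Z\<bar>\<^sup>2) / whitney_mass \<Omega> m Z) M)"
proof -
  interpret weighted_domain \<Omega> m Cm by fact
  interpret boundary_family \<Omega> \<omega> by fact
  let ?G = "\<lambda>Z. ennreal (\<bar>f Z\<bar>\<^sup>2) / whitney_mass \<Omega> m Z"
  have G: "?G \<in> borel_measurable m"
    using f by (intro borel_measurable_divide_ennreal measurable_whitney_mass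
        measurable_compose[OF _ measurable_ennreal] borel_measurable_power borel_measurable_abs)
  have area: "area_functional_sq \<Omega> m r f = area \<Omega> m ?G r" for r
    by (rule ext) (simp add: area_functional_sq_def area_def whitney_mass_def)
  have eq: "(\<integral>\<^sup>+y\<in>ball x r. area \<Omega> m ?G r y \<partial>ext X) = (\<integral>\<^sup>+y\<in>bball \<Omega> x r. area_functional_sq \<Omega> m r f y \<partial>\<omega> X)"
    if "X \<in> \<Omega>" for x r X
    unfolding area by (rule nn_integral_ext_ball[OF that measurable_area[OF G]])
  have iff: "Carleson \<Omega> m ext ?G M \<longleftrightarrow> (\<forall>x\<in>frontier \<Omega>. \<forall>r>0. \<forall>X\<in>\<Omega> - ball x (2 * r).
     (\<integral>\<^sup>+y\<in>bball \<Omega> x r. area_functional_sq \<Omega> m r f y \<partial>\<omega> X) \<le> M * emeasure (\<omega> X) (bball \<Omega> x r))" for M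
    unfolding Carleson_def using eq by (auto simp: emeasure_ext_ball dist_commute not_less)
  show ?thesis
  proof
    assume "f \<in> KCM \<Omega> m \<omega>"
    then obtain M where "M > 0" "Carleson \<Omega> m ext ?G (ennreal M)" unfolding KCM_def iff by blast
    then show "\<exists>M<\<infinity>. Carleson \<Omega> m ext ?G M" by (intro exI[of _ "ennreal M"]) simp
  next
    assume "\<exists>M<\<infinity>. Carleson \<Omega> m ext ?G M"
    then obtain M where M: "M < \<infinity>" "Carleson \<Omega> m ext ?G M" by blast
    define M' where "M' = enn2real M + 1"
    have "M' > 0" unfolding M'_def by (intro add_nonneg_pos) auto
    have "M = ennreal (enn2real M)" using M(1) by simp
    also have "\<dots> \<le> ennreal M'" unfolding M'_def by (intro ennreal_leI) simp
    finally have "Carleson \<Omega> m ext ?G (ennreal M')"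
      using M(2) unfolding Carleson_def by (meson mult_right_mono order_trans zero_le)
    with \<open>M' > 0\<close> show "f \<in> KCM \<Omega> m \<omega>" unfolding KCM_def iff by blast
  qed
qed

section \<open>The equivalence\<close>

text \<open>As boundary balls have positive measure, the quotients in \<open>A\<^sub>\<infinity>\<close> can be cleared.\<close>

lemma A_infinity_extension:
  assumes E0: "elliptic_estimates \<Omega> c \<omega>0 K0 \<gamma>0" and E1: "elliptic_estimates \<Omega> c \<omega>1 K1 \<gamma>1"
    and A: "\<omega>1 \<in> A_infinity \<Omega> \<omega>0" and k: "0 < k"
  obtains \<zeta> :: ennreal where "0 < \<zeta>" "\<zeta> < \<infinity>"
    "\<And>x r X E. x \<in> frontier \<Omega> \<Longrightarrow> 0 < r \<Longrightarrow> X \<in> \<Omega> \<Longrightarrow> 2 * r \<le> dist X x \<Longrightarrow>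
      E \<in> sets borel \<Longrightarrow> E \<subseteq> ball x r \<Longrightarrow>
      emeasure (extend_boundary_family \<omega>1 X) E \<le> \<zeta> * emeasure (extend_boundary_family \<omega>1 X) (ball x r) \<Longrightarrow>
      ennreal k * emeasure (extend_boundary_family \<omega>0 X) E \<le> emeasure (extend_boundary_family \<omega>0 X) (ball x r)"
proof -
  interpret E0: elliptic_estimates \<Omega> c \<omega>0 K0 \<gamma>0 by fact
  interpret E1: elliptic_estimates \<Omega> c \<omega>1 K1 \<gamma>1 by fact
  have "0 < 1 / k" using k by simp
  then obtain \<zeta> where \<zeta>: "\<zeta> > 0" and abs: "\<forall>x\<in>frontier \<Omega>. \<forall>r>0. \<forall>X\<in>\<Omega> - ball x (2 * r). \<forall>E.
     E \<in> sets borel \<longrightarrow> E \<subseteq> bball \<Omega> x r \<longrightarrow>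
     measure (\<omega>1 X) E / measure (\<omega>1 X) (bball \<Omega> x r) < \<zeta> \<longrightarrow>
     measure (\<omega>0 X) E / measure (\<omega>0 X) (bball \<Omega> x r) < 1 / k"
    using A unfolding A_infinity_def by blast
  show thesis
  proof (rule that[of "ennreal (\<zeta> / 2)"])
    fix x r X E
    assume x: "x \<in> frontier \<Omega>" "0 < r" and X: "X \<in> \<Omega>" "2 * r \<le> dist X x"
      and E: "E \<in> sets borel" "E \<subseteq> ball x r"
      and small: "emeasure (E1.ext X) E \<le> ennreal (\<zeta> / 2) * emeasure (E1.ext X) (ball x r)"
    let ?E = "E \<inter> frontier \<Omega>" and ?\<Delta> = "bball \<Omega> x r"
    have E': "?E \<in> sets borel" "?E \<subseteq> ?\<Delta>" using E by (auto simp: bball_def intro: borel_closed)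
    have pos: "0 < measure (\<omega>0 X) ?\<Delta>" "0 < measure (\<omega>1 X) ?\<Delta>"
      using E0.positive_on_balls[OF X(1) x] E1.positive_on_balls[OF X(1) x] .
    have "measure (\<omega>1 X) ?E \<le> \<zeta> / 2 * measure (\<omega>1 X) ?\<Delta>"
      using small E(1) X(1) \<zeta> unfolding bball_def
      by (simp add: E1.emeasure_ext_measure ennreal_mult[symmetric])
    moreover have "0 < \<zeta> / 2 * measure (\<omega>1 X) ?\<Delta>" using \<zeta> pos by simp
    ultimately have "measure (\<omega>1 X) ?E < \<zeta> * measure (\<omega>1 X) ?\<Delta>" by linarith
    then have "measure (\<omega>1 X) ?E / measure (\<omega>1 X) ?\<Delta> < \<zeta>" using pos by (simp add: field_simps)
    moreover have "X \<in> \<Omega> - ball x (2 * r)" using X by (simp add: dist_commute)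
    ultimately have "measure (\<omega>0 X) ?E / measure (\<omega>0 X) ?\<Delta> < 1 / k"
      using abs x E' by blast
    then have "k * measure (\<omega>0 X) ?E \<le> measure (\<omega>0 X) ?\<Delta>" using pos k by (simp add: field_simps)
    then show "ennreal k * emeasure (E0.ext X) E \<le> emeasure (E0.ext X) (ball x r)"
      using E(1) X(1) k by (simp add: E0.emeasure_ext_measure bball_def ennreal_mult[symmetric] ennreal_leI)
  qed (use \<zeta> in auto)
qed

lemma A_infinityI_extension:
  assumes E0: "elliptic_estimates \<Omega> c \<omega>0 K0 \<gamma>0" and E1: "elliptic_estimates \<Omega> c \<omega>1 K1 \<gamma>1"
    and abs: "\<And>\<xi>. 0 < \<xi> \<Longrightarrow> \<exists>\<zeta>. 0 < \<zeta> \<and> \<zeta> < \<infinity> \<and> (\<forall>x r X E. x \<in> frontier \<Omega> \<longrightarrow> 0 < r \<longrightarrow> X \<in> \<Omega> \<longrightarrow>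
      2 * r \<le> dist X x \<longrightarrow> E \<in> sets borel \<longrightarrow> E \<subseteq> ball x r \<longrightarrow>
      emeasure (extend_boundary_family \<omega>1 X) E < \<zeta> * emeasure (extend_boundary_family \<omega>1 X) (ball x r) \<longrightarrow>
      emeasure (extend_boundary_family \<omega>0 X) E \<le> ennreal \<xi> * emeasure (extend_boundary_family \<omega>0 X) (ball x r))"
  shows "\<omega>1 \<in> A_infinity \<Omega> \<omega>0"
proof -
  interpret E0: elliptic_estimates \<Omega> c \<omega>0 K0 \<gamma>0 by fact
  interpret E1: elliptic_estimates \<Omega> c \<omega>1 K1 \<gamma>1 by fact
  have "\<exists>\<zeta>>0. \<forall>x\<in>frontier \<Omega>. \<forall>r>0. \<forall>X\<in>\<Omega> - ball x (2 * r). \<forall>E.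
     E \<in> sets borel \<longrightarrow> E \<subseteq> bball \<Omega> x r \<longrightarrow>
     measure (\<omega>1 X) E / measure (\<omega>1 X) (bball \<Omega> x r) < \<zeta> \<longrightarrow>
     measure (\<omega>0 X) E / measure (\<omega>0 X) (bball \<Omega> x r) < \<xi>" if \<xi>: "\<xi> > 0" for \<xi>
  proof -
    obtain \<zeta> where \<zeta>: "0 < \<zeta>" "\<zeta> < \<infinity>" and ac: "\<And>x r X E. x \<in> frontier \<Omega> \<Longrightarrow> 0 < r \<Longrightarrow> X \<in> \<Omega> \<Longrightarrow>
      2 * r \<le> dist X x \<Longrightarrow> E \<in> sets borel \<Longrightarrow> E \<subseteq> ball x r \<Longrightarrow>
      emeasure (E1.ext X) E < \<zeta> * emeasure (E1.ext X) (ball x r) \<Longrightarrow>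
      emeasure (E0.ext X) E \<le> ennreal (\<xi> / 2) * emeasure (E0.ext X) (ball x r)"
      using abs[of "\<xi> / 2"] \<xi> by auto
    define z where "z = enn2real \<zeta>"
    have z: "0 < z" "\<zeta> = ennreal z" using \<zeta> by (auto simp: z_def enn2real_positive_iff)
    show ?thesis
    proof (intro exI[of _ z] conjI ballI allI impI)
      fix x r X E
      assume x: "x \<in> frontier \<Omega>" "0 < r" and X': "X \<in> \<Omega> - ball x (2 * r)"
        and E: "E \<in> sets borel" "E \<subseteq> bball \<Omega> x r"
        and small: "measure (\<omega>1 X) E / measure (\<omega>1 X) (bball \<Omega> x r) < z"
      let ?\<Delta> = "bball \<Omega> x r"
      have X: "X \<in> \<Omega>" "2 * r \<le> dist X x" using X' by (auto simp: dist_commute)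
      have pos: "0 < measure (\<omega>0 X) ?\<Delta>" "0 < measure (\<omega>1 X) ?\<Delta>"
        using E0.positive_on_balls[OF X(1) x] E1.positive_on_balls[OF X(1) x] .
      have E': "E \<subseteq> ball x r" "E \<inter> frontier \<Omega> = E" using E by (auto simp: bball_def)
      have "measure (\<omega>1 X) E < z * measure (\<omega>1 X) ?\<Delta>" using small pos by (simp add: field_simps)
      then have "ennreal (measure (\<omega>1 X) E) < ennreal (z * measure (\<omega>1 X) ?\<Delta>)"
        using z pos by (intro ennreal_lessI) auto
      then have "emeasure (E1.ext X) E < \<zeta> * emeasure (E1.ext X) (ball x r)"
        using z E E' X by (simp add: E1.emeasure_ext_measure bball_def ennreal_mult)
      then have "emeasure (E0.ext X) E \<le> ennreal (\<xi> / 2) * emeasure (E0.ext X) (ball x r)"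
        by (rule ac[OF x X E(1) E'(1)])
      then have "measure (\<omega>0 X) E \<le> \<xi> / 2 * measure (\<omega>0 X) ?\<Delta>"
        using \<xi> E E' X unfolding bball_def by (simp add: E0.emeasure_ext_measure ennreal_mult[symmetric])
      moreover have "0 < \<xi> / 2 * measure (\<omega>0 X) ?\<Delta>" using \<xi> pos by simp
      ultimately have "measure (\<omega>0 X) E < \<xi> * measure (\<omega>0 X) ?\<Delta>" by linarith
      then show "measure (\<omega>0 X) E / measure (\<omega>0 X) ?\<Delta> < \<xi>" using pos by (simp add: field_simps)
    qed (rule z)
  qed
  then show ?thesis unfolding A_infinity_def by blast
qed

lemma (in weighted_domain) L2_loc_sqrt:
  assumes g: "g \<in> borel_measurable borel" "\<And>Z. 0 \<le> g Z" "\<And>Z. g Z \<le> B"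
  shows "L2_loc m \<Omega> (\<lambda>Z. sqrt (g Z))"
  unfolding L2_loc_def
proof (intro conjI allI impI)
  have "(\<lambda>Z. sqrt (g Z)) \<in> borel_measurable borel" using g(1) by measurable
  from measurable_m_of_borel[OF this]
  show "(\<lambda>Z. sqrt (g Z)) \<in> borel_measurable (restrict_space m \<Omega>)" by (rule measurable_restrict_space1)
  fix K assume K: "compact K \<and> K \<subseteq> \<Omega>"
  then have "bounded K" by (simp add: compact_imp_bounded)
  then obtain R where R: "K \<subseteq> ball 0 R" using bounded_subset_ballD[of K 0] by auto
  have "(\<integral>\<^sup>+X\<in>K. ennreal ((norm (sqrt (g X)))\<^sup>2) \<partial>m) \<le> (\<integral>\<^sup>+X. ennreal B * indicator (ball 0 R \<inter> \<Omega>) X \<partial>m)"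
  proof (rule nn_integral_mono_m)
    fix X assume "X \<in> \<Omega>"
    have "ennreal ((norm (sqrt (g X)))\<^sup>2) \<le> ennreal B" using g(2,3)[of X] by (intro ennreal_leI) simp
    moreover have "X \<in> K \<Longrightarrow> X \<in> ball 0 R \<inter> \<Omega>" using R K by blast
    ultimately show "ennreal ((norm (sqrt (g X)))\<^sup>2) * indicator K X \<le> ennreal B * indicator (ball 0 R \<inter> \<Omega>) X"
      by (cases "X \<in> K") simp_all
  qed
  also have "\<dots> = ennreal B * emeasure m (ball 0 R \<inter> \<Omega>)"
    by (intro nn_integral_cmult_indicator borel_Int_sets_m) simp
  also have "\<dots> < \<infinity>" using m_ball_finite by (simp add: ennreal_mult_less_top)
  finally show "(\<integral>\<^sup>+X\<in>K. ennreal ((norm (sqrt (g X)))\<^sup>2) \<partial>m) < \<infinity>" .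
qed

theorem corollary1p33:
  fixes \<Omega> :: "(real ^ 'n) set" and m :: "(real ^ 'n) measure"
    and \<omega>0 \<omega>1 :: "real ^ 'n \<Rightarrow> (real ^ 'n) measure"
  assumes "CARD('n) \<ge> 2"
    and "open \<Omega>"
    and "pde_friendly \<Omega> m"
    and "is_elliptic_measure \<Omega> m \<omega>0"
    and "is_elliptic_measure \<Omega> m \<omega>1"
  shows "\<omega>1 \<in> A_infinity \<Omega> \<omega>0 \<longleftrightarrow>
    (\<forall>f :: real ^ 'n \<Rightarrow> real. L2_loc m \<Omega> f \<longrightarrow> f \<in> KCM \<Omega> m \<omega>1 \<longrightarrow> f \<in> KCM \<Omega> m \<omega>0)"
proof (cases "frontier \<Omega> = {}")
  case True
  have "\<omega>1 \<in> A_infinity \<Omega> \<omega>0" and "f \<in> KCM \<Omega> m \<omega>0" for f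
    unfolding A_infinity_def KCM_def True by (auto intro: exI[of _ "1 :: real"])
  then show ?thesis by blast
next
  case False
  then obtain x0 where x0: "x0 \<in> frontier \<Omega>" by auto
  then have ne: "\<Omega> \<noteq> {}" by auto
  obtain c where est: "\<And>\<omega>. is_elliptic_measure \<Omega> m \<omega> \<Longrightarrow>
    \<exists>K \<gamma> A. elliptic_estimates \<Omega> c \<omega> K \<gamma> \<and> em_green \<Omega> m A c K \<omega>"
    using pde_friendly_estimates[OF assms(2,3)] by metis
  obtain K0 \<gamma>0 A where E0: "elliptic_estimates \<Omega> c \<omega>0 K0 \<gamma>0" and green: "em_green \<Omega> m A c K0 \<omega>0"
    using est[OF assms(4)] by blast
  obtain K1 \<gamma>1 where E1: "elliptic_estimates \<Omega> c \<omega>1 K1 \<gamma>1"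
    using est[OF assms(5)] by blast
  interpret E0: elliptic_estimates \<Omega> c \<omega>0 K0 \<gamma>0 by fact
  interpret E1: elliptic_estimates \<Omega> c \<omega>1 K1 \<gamma>1 by fact
  have weight: "weighted_measure_on \<Omega> m" and doubl: "doubling_on \<Omega> m"
    using assms(3) unfolding pde_friendly_def by blast+
  have "\<Omega> \<in> sets m"
    using weight assms(2) unfolding weighted_measure_on_def
    by (auto simp: sets_restrict_space intro!: image_eqI[of _ _ UNIV])
  then have "0 < emeasure m \<Omega>" by (rule em_green_imp_measure_nonzero[OF E0 green x0])
  then obtain Cm where W: "weighted_domain \<Omega> m Cm"
    using weighted_domain_of_measure[OF assms(2) ne weight doubl] by blast
  interpret W: weighted_domain \<Omega> m Cm by fact
  define K where "K = max (max 1 K0) K1"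
  have K: "1 \<le> K" "max 1 K0 \<le> K" "max 1 K1 \<le> K" by (auto simp: K_def)
  interpret T: two_families \<Omega> m Cm c E0.ext E1.ext "ennreal K"
    by (intro two_families.intro W E0.elliptic_family_extension E1.elliptic_family_extension K)
  have B: "boundary_family \<Omega> \<omega>0" "boundary_family \<Omega> \<omega>1" by unfold_locales
  note iff = KCM_iff_Carleson[OF W B(1)] KCM_iff_Carleson[OF W B(2)]
  show ?thesis
  proof
    assume A: "\<omega>1 \<in> A_infinity \<Omega> \<omega>0"
    have "0 < 4 * K ^ 10" using K by simp
    from A_infinity_extension[OF E0 E1 A this] obtain \<zeta> :: ennreal where \<zeta>: "0 < \<zeta>" "\<zeta> < \<infinity>" and
      ac: "\<And>x r X E. x \<in> frontier \<Omega> \<Longrightarrow> 0 < r \<Longrightarrow> X \<in> \<Omega> \<Longrightarrow> 2 * r \<le> dist X x \<Longrightarrow>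
      E \<in> sets borel \<Longrightarrow> E \<subseteq> ball x r \<Longrightarrow> emeasure (E1.ext X) E \<le> \<zeta> * emeasure (E1.ext X) (ball x r) \<Longrightarrow>
      ennreal (4 * K ^ 10) * emeasure (E0.ext X) E \<le> emeasure (E0.ext X) (ball x r)" by blast
    have const: "ennreal (4 * K ^ 10) = 4 * ennreal K ^ 10"
      using K by (simp add: ennreal_mult ennreal_power)
    show "\<forall>f. L2_loc m \<Omega> f \<longrightarrow> f \<in> KCM \<Omega> m \<omega>1 \<longrightarrow> f \<in> KCM \<Omega> m \<omega>0"
    proof (intro allI impI)
      fix f :: "real ^ 'n \<Rightarrow> real" assume "L2_loc m \<Omega> f" and kcm: "f \<in> KCM \<Omega> m \<omega>1"
      then have "f \<in> borel_measurable (restrict_space m \<Omega>)" by (simp add: L2_loc_def)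
      moreover have "sets (restrict_space m \<Omega>) = sets m"
      proof -
        have "(\<inter>) \<Omega> ` sets m = (\<lambda>S. S) ` sets m"
          using sets.sets_into_space[of _ m] W.space_m by (intro image_cong) auto
        then show ?thesis by (simp add: sets_restrict_space)
      qed
      ultimately have f: "f \<in> borel_measurable m" by (simp cong: measurable_cong_sets)
      let ?G = "\<lambda>Z. ennreal (\<bar>f Z\<bar>\<^sup>2) / whitney_mass \<Omega> m Z"
      have G: "?G \<in> borel_measurable m"
        using f by (intro borel_measurable_divide_ennreal W.measurable_whitney_mass
            measurable_compose[OF _ measurable_ennreal] borel_measurable_power borel_measurable_abs)
      obtain M where M: "M < \<infinity>" "Carleson \<Omega> m E1.ext ?G M" using kcm iff(2)[OF f] by blast
      obtain M' where "M' < \<infinity>" "Carleson \<Omega> m E0.ext ?G M'"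
        by (rule T.Carleson_transfer[OF G M(2,1) \<zeta> ac[unfolded const]])
      then show "f \<in> KCM \<Omega> m \<omega>0" using iff(1)[OF f] by blast
    qed
  next
    assume kcm: "\<forall>f :: real ^ 'n \<Rightarrow> real. L2_loc m \<Omega> f \<longrightarrow> f \<in> KCM \<Omega> m \<omega>1 \<longrightarrow> f \<in> KCM \<Omega> m \<omega>0"
    have transfer: "\<forall>g :: real ^ 'n \<Rightarrow> real. g \<in> borel_measurable borel \<longrightarrow> (\<forall>Z. 0 \<le> g Z \<and> g Z \<le> 2) \<longrightarrow>
      (\<exists>M<\<infinity>. Carleson \<Omega> m E1.ext (\<lambda>Z. ennreal (g Z) / whitney_mass \<Omega> m Z) M) \<longrightarrow>
      (\<exists>M<\<infinity>. Carleson \<Omega> m E0.ext (\<lambda>Z. ennreal (g Z) / whitney_mass \<Omega> m Z) M)"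
    proof (intro allI impI)
      fix g :: "real ^ 'n \<Rightarrow> real"
      assume gm: "g \<in> borel_measurable borel" and g02: "\<forall>Z. 0 \<le> g Z \<and> g Z \<le> 2"
        and carleson: "\<exists>M<\<infinity>. Carleson \<Omega> m E1.ext (\<lambda>Z. ennreal (g Z) / whitney_mass \<Omega> m Z) M"
      have g: "g \<in> borel_measurable borel" "\<And>Z. 0 \<le> g Z" "\<And>Z. g Z \<le> 2" using gm g02 by auto
      let ?f = "\<lambda>Z. sqrt (g Z)"
      have L2: "L2_loc m \<Omega> ?f" by (rule W.L2_loc_sqrt[OF g])
      have f: "?f \<in> borel_measurable m"
        using W.measurable_m_of_borel[OF g(1)] by measurable
      have sq: "\<bar>?f Z\<bar>\<^sup>2 = g Z" for Z using g(2) by simp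
      show "\<exists>M<\<infinity>. Carleson \<Omega> m E0.ext (\<lambda>Z. ennreal (g Z) / whitney_mass \<Omega> m Z) M"
        using kcm[rule_format, OF L2] carleson iff[OF f] unfolding sq by blast
    qed
    show "\<omega>1 \<in> A_infinity \<Omega> \<omega>0"
    proof (rule A_infinityI_extension[OF E0 E1])
      fix \<xi> :: real assume \<xi>: "0 < \<xi>"
      have "0 < ennreal (\<xi> / K ^ 4)" using \<xi> K by simp
      then obtain \<zeta> :: ennreal where \<zeta>: "0 < \<zeta>" "\<zeta> < \<infinity>" and ac: "\<And>x r X E. x \<in> frontier \<Omega> \<Longrightarrow> 0 < r \<Longrightarrow>
        X \<in> \<Omega> \<Longrightarrow> 2 * r \<le> dist X x \<Longrightarrow> E \<in> sets borel \<Longrightarrow> E \<subseteq> ball x r \<Longrightarrow>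
        emeasure (E1.ext X) E < \<zeta> * emeasure (E1.ext X) (ball x r) \<Longrightarrow>
        emeasure (E0.ext X) E \<le> ennreal (\<xi> / K ^ 4) * ennreal K ^ 4 * emeasure (E0.ext X) (ball x r)"
        by (rule T.absolute_continuity_from_Carleson_transfer[OF transfer]) (rule that)
      have "ennreal (\<xi> / K ^ 4) * ennreal K ^ 4 = ennreal \<xi>"
        using \<xi> K by (simp add: ennreal_power ennreal_mult[symmetric])
      then show "\<exists>\<zeta>. 0 < \<zeta> \<and> \<zeta> < \<infinity> \<and> (\<forall>x r X E. x \<in> frontier \<Omega> \<longrightarrow> 0 < r \<longrightarrow> X \<in> \<Omega> \<longrightarrow>
        2 * r \<le> dist X x \<longrightarrow> E \<in> sets borel \<longrightarrow> E \<subseteq> ball x r \<longrightarrow>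
        emeasure (E1.ext X) E < \<zeta> * emeasure (E1.ext X) (ball x r) \<longrightarrow>
        emeasure (E0.ext X) E \<le> ennreal \<xi> * emeasure (E0.ext X) (ball x r))"
        using \<zeta> ac by auto
    qed
  qed
qed

end
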